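(* Let $G$ be a connected planar graph on at least $3$ vertices. Then $\kappa(G)-1\leq \kappa_3(G)\leq \kappa(G)$.
   Context: All graphs are finite and simple. $\kappa(G)$ denotes the (vertex) connectivity of $G$: the minimum cardinality of a vertex set $Q$ such that $G-Q$ is disconnected or trivial. For a set $S$ of vertices of a connected graph $G$, a tree connecting $S$ is a subtree of $G$ containing all vertices of $S$; $\kappa(S)$ denotes the maximum number $\ell$ of edge-disjoint trees $T_1,\ldots,T_\ell$ in $G$, each connecting $S$, such that $V(T_i)\cap V(T_j)=S$ for all distinct $i,j$. The $3$-connectivity is $\kappa_3(G)=\min\{\kappa(S): S\subseteq V(G),\ |S|=3\}$. *)

theory Defs
  imports "HOL-Analysis.Analysis"
begin

datatype 'a graph = Graph (verts: "'a set") (edges: "'a set set")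

definition finite_simple_graph :: "'a graph \<Rightarrow> bool" where
  "finite_simple_graph G \<longleftrightarrow>
     finite (verts G) \<and> (\<forall>e\<in>edges G. e \<subseteq> verts G \<and> card e = 2)"

definition subgraph :: "'a graph \<Rightarrow> 'a graph \<Rightarrow> bool" where
  "subgraph H G \<longleftrightarrow>
     finite_simple_graph H \<and> verts H \<subseteq> verts G \<and> edges H \<subseteq> edges G"

definition delete_verts :: "'a graph \<Rightarrow> 'a set \<Rightarrow> 'a graph" where
  "delete_verts G Q = Graph (verts G - Q) {e \<in> edges G. e \<inter> Q = {}}"

definition connected_graph :: "'a graph \<Rightarrow> bool" where
  "connected_graph G \<longleftrightarrow>
     verts G \<noteq> {} \<and>
     (\<forall>u\<in>verts G. \<forall>v\<in>verts G. (u, v) \<in> {(x, y). {x, y} \<in> edges G}\<^sup>*)"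

definition trivial_graph :: "'a graph \<Rightarrow> bool" where
  "trivial_graph G \<longleftrightarrow> card (verts G) \<le> 1"

definition is_cycle :: "'a graph \<Rightarrow> 'a list \<Rightarrow> bool" where
  "is_cycle G c \<longleftrightarrow>
     length c \<ge> 3 \<and> distinct c \<and>
     (\<forall>i<length c. {c ! i, c ! (Suc i mod length c)} \<in> edges G)"

definition tree :: "'a graph \<Rightarrow> bool" where
  "tree T \<longleftrightarrow> finite_simple_graph T \<and> connected_graph T \<and> (\<nexists>c. is_cycle T c)"

definition connectivity :: "'a graph \<Rightarrow> nat" where
  "connectivity G =
     Min {card Q | Q. Q \<subseteq> verts G \<and>
       (\<not> connected_graph (delete_verts G Q) \<or> trivial_graph (delete_verts G Q))}"

definition connecting_tree :: "'a graph \<Rightarrow> 'a set \<Rightarrow> 'a graph \<Rightarrow> bool" where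
  "connecting_tree G S T \<longleftrightarrow> subgraph T G \<and> tree T \<and> S \<subseteq> verts T"

text \<open>
  Collecting the trees into a set rather than an indexed family loses nothing when S has at
  least two elements: a connecting tree then has an edge, so edge-disjoint trees are distinct.
\<close>

definition tree_packing :: "'a graph \<Rightarrow> 'a set \<Rightarrow> 'a graph set \<Rightarrow> bool" where
  "tree_packing G S \<T> \<longleftrightarrow>
     (\<forall>T\<in>\<T>. connecting_tree G S T) \<and>
     (\<forall>T\<in>\<T>. \<forall>T'\<in>\<T>. T \<noteq> T' \<longrightarrow>
        edges T \<inter> edges T' = {} \<and> verts T \<inter> verts T' = S)"

definition set_connectivity :: "'a graph \<Rightarrow> 'a set \<Rightarrow> nat" where
  "set_connectivity G S = Max {card \<T> | \<T>. tree_packing G S \<T>}"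

definition three_connectivity :: "'a graph \<Rightarrow> nat" where
  "three_connectivity G = Min {set_connectivity G S | S. S \<subseteq> verts G \<and> card S = 3}"

text \<open>
  Vertices are drawn as distinct points of the plane and edges as arcs (injective paths) between
  the points of their ends; the rest of each arc meets neither a vertex nor another arc.
\<close>

definition plane_drawing ::
    "'a graph \<Rightarrow> ('a \<Rightarrow> complex) \<Rightarrow> ('a set \<Rightarrow> real \<Rightarrow> complex) \<Rightarrow> bool" where
  "plane_drawing G p \<gamma> \<longleftrightarrow>
     inj_on p (verts G) \<and>
     (\<forall>e\<in>edges G. arc (\<gamma> e) \<and> {pathstart (\<gamma> e), pathfinish (\<gamma> e)} = p ` e) \<and>
     (\<forall>e\<in>edges G. (path_image (\<gamma> e) - p ` e) \<inter> p ` verts G = {}) \<and>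
     (\<forall>e\<in>edges G. \<forall>f\<in>edges G. e \<noteq> f \<longrightarrow>
        (path_image (\<gamma> e) - p ` e) \<inter> path_image (\<gamma> f) = {})"

definition planar_graph :: "'a graph \<Rightarrow> bool" where
  "planar_graph G \<longleftrightarrow> (\<exists>p \<gamma>. plane_drawing G p \<gamma>)"

end

theory Submission
  imports Defs
begin

text \<open>
  Upper bound: if a minimum separator leaves at least three vertices, choose \<open>S\<close> outside of it with two
  vertices separated; every tree uses a vertex of the separator. Otherwise a degree bounds the
  number of trees.

  Lower bound, for connectivity \<open>k \<le> 5\<close>: for \<open>S = {a, b, c}\<close> take \<open>k\<close> internally disjoint paths
  from \<open>a\<close> to \<open>b\<close> and a fan from \<open>c\<close> to them. As long as the fan has fewer than \<open>k\<close> ends it can be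
  augmented, and of three ends on one path the middle one is dropped, so in the end at most two ends lie
  inside each path. A path with one end gives a tree; a path with two ends gives an \<open>a\<close>-\<open>c\<close> and a \<open>b\<close>-\<open>c\<close> path,
  and a path without ends remains an \<open>a\<close>-\<open>b\<close> path. Pairing paths of different kinds gives \<open>k - 1\<close> trees.

  Planarity enters only through \<open>k \<le> 5\<close>, that is, through a vertex of degree at most \<open>5\<close>: a
  graph with \<open>n \<ge> 2\<close> vertices and at least \<open>3n - 4\<close> edges has a \<open>K\<^sub>3\<^sub>,\<^sub>3\<close> minor, hence contains a
  subdivided \<open>K\<^sub>3\<^sub>,\<^sub>3\<close>, which cannot be drawn: two of the three chords of its hexagon lie on the same side of the
  Jordan curve formed by the hexagon.
\<close>

section \<open>Paths and fans\<close>

text \<open>The bound 5 is forced by counting pieces. Let s of the k paths carry one fan end, d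
  carry two and u none, with m = k - s = d + u, and let neither a nor b be an end, so that 2d \<ge>
  m. Besides the s complete pieces there are 2d + u = m + d incomplete ones, from which m - 1 pairs
  must be formed, so d \<ge> m - 2 is needed. As d may be as small as m/2 rounded up, this is safe
  just for m \<le> 5: for k = 6, three paths with two ends and three with none leave nine pieces
  where ten are wanted. If c lies on one of the paths, that path is cut at c into the first two
  members of the fan, and the other k - 1 paths are kept; this leads to the same inequality.

  The edge bound does without faces and Euler's formula, since the arcs of a drawing are arbitrary;
  all the topology concerns a hexagon and its chords. The number 3n - 4 is the exact threshold for
  the minor: copies of \<open>K\<^sub>5\<close> glued along one common edge have 3n - 5 edges and no
  such minor. At most 3n - 5 edges still keep the average degree below 6.\<close>

fun ledges :: "'a list \<Rightarrow> 'a set set" where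
  "ledges (x # y # xs) = insert {x, y} (ledges (y # xs))"
| "ledges _ = {}"

abbreviation reach :: "'a set set \<Rightarrow> ('a \<times> 'a) set" where
  "reach E \<equiv> {(x, y). {x, y} \<in> E}\<^sup>*"

definition gpath :: "'a set set \<Rightarrow> 'a list \<Rightarrow> bool" where
  "gpath E xs \<longleftrightarrow> xs \<noteq> [] \<and> distinct xs \<and> ledges xs \<subseteq> E"

lemma ledges_split: "ledges (xs @ y # ys) = ledges (xs @ [y]) \<union> ledges (y # ys)"
  by (induction xs rule: ledges.induct) auto

lemma ledges_snoc: "xs \<noteq> [] \<Longrightarrow> ledges (xs @ [y]) = insert {last xs, y} (ledges xs)"
  by (induction xs rule: ledges.induct) auto

lemma ledges_append:
  "xs \<noteq> [] \<Longrightarrow> ys \<noteq> [] \<Longrightarrow> ledges (xs @ ys) = insert {last xs, hd ys} (ledges xs \<union> ledges ys)"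
  by (induction xs rule: ledges.induct; cases ys) auto

lemma ledges_rev [simp]: "ledges (rev xs) = ledges xs"
proof (induction xs rule: ledges.induct)
  case (1 x y xs)
  have "ledges (rev (x # y # xs)) = insert {y, x} (ledges (rev (y # xs)))"
    using ledges_snoc[of "rev xs @ [y]" x] by simp
  with 1 show ?case by (simp add: insert_commute)
qed auto

lemma ledges_subset: "e \<in> ledges xs \<Longrightarrow> e \<subseteq> set xs"
  by (induction xs rule: ledges.induct) auto

lemma ledges_card: "distinct xs \<Longrightarrow> e \<in> ledges xs \<Longrightarrow> card e = 2"
  by (induction xs rule: ledges.induct) auto

lemma ledges_mem_iff: "e \<in> ledges xs \<longleftrightarrow> (\<exists>us x y vs. xs = us @ x # y # vs \<and> e = {x, y})"
proof
  show "e \<in> ledges xs \<Longrightarrow> \<exists>us x y vs. xs = us @ x # y # vs \<and> e = {x, y}"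
  proof (induction xs rule: ledges.induct)
    case (1 x y xs)
    show ?case
    proof (cases "e = {x, y}")
      case True then show ?thesis by (metis append_Nil)
    next
      case False
      with 1 obtain us a b vs where "y # xs = us @ a # b # vs" "e = {a, b}" by auto
      then show ?thesis by (metis append_Cons)
    qed
  qed auto
qed (auto simp: ledges_split[of _ _ "_ # _"])

lemma gpath_rev [simp]: "gpath E (rev xs) \<longleftrightarrow> gpath E xs"
  by (simp add: gpath_def)

lemma gpath_hd: "gpath E xs \<Longrightarrow> hd xs \<in> set xs"
  and gpath_last: "gpath E xs \<Longrightarrow> last xs \<in> set xs"
  by (simp_all add: gpath_def)

lemma gpath_mono: "gpath E xs \<Longrightarrow> E \<subseteq> F \<Longrightarrow> gpath F xs"
  by (auto simp: gpath_def)

lemma gpath_single [simp]: "gpath E [x]"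
  by (simp add: gpath_def)

lemma gpath_prefix: "gpath E (xs @ y # ys) \<Longrightarrow> gpath E (xs @ [y])"
  by (auto simp: gpath_def ledges_split[of xs y ys])

lemma gpath_suffix: "gpath E (xs @ y # ys) \<Longrightarrow> gpath E (y # ys)"
  by (auto simp: gpath_def ledges_split[of xs y ys])

lemma gpath_glue:
  assumes "gpath E (xs @ [y])" "gpath E (y # ys)" "set xs \<inter> set ys = {}"
  shows "gpath E (xs @ y # ys)"
  using assms by (auto simp: gpath_def ledges_split[of xs y ys])

lemma gpath_subset:
  assumes "gpath E xs" "\<And>e. e \<in> E \<Longrightarrow> e \<subseteq> V" "hd xs \<in> V"
  shows "set xs \<subseteq> V"
proof
  fix v assume v: "v \<in> set xs"
  then obtain us vs where xs: "xs = us @ v # vs" by (meson split_list)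
  show "v \<in> V"
  proof (cases us rule: rev_cases)
    case Nil
    with xs assms(3) show ?thesis by simp
  next
    case (snoc us' u)
    then have "{u, v} \<in> ledges xs" using xs by (auto simp: ledges_split[of us' u "v # vs"])
    with assms(1,2) show ?thesis by (auto simp: gpath_def)
  qed
qed

lemma rtrancl_gpath:
  assumes "(u, v) \<in> reach E"
  obtains xs where "gpath E xs" "hd xs = u" "last xs = v"
proof -
  from assms have "\<exists>xs. gpath E xs \<and> hd xs = u \<and> last xs = v"
  proof (induction rule: rtrancl_induct)
    case base
    have "gpath E [u]" by simp
    then show ?case by (intro exI[of _ "[u]"]) auto
  next
    case (step y z)
    then obtain xs where xs: "gpath E xs" "hd xs = u" "last xs = y" by blast
    show ?case
    proof (cases "z \<in> set xs")
      \<comment> \<open>A return to \<open>z\<close> is cut short to the initial segment ending in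
        \<open>z\<close>, which keeps the list distinct.\<close>
      case True
      then obtain us vs where *: "xs = us @ z # vs" by (meson split_list)
      with xs show ?thesis by (intro exI[of _ "us @ [z]"]) (auto dest: gpath_prefix simp: hd_append)
    next
      case False
      with xs step(2) show ?thesis
        by (intro exI[of _ "xs @ [z]"]) (auto simp: gpath_def ledges_snoc)
    qed
  qed
  with that show thesis by blast
qed

lemma ledges_rtrancl:
  assumes "x \<in> set xs" "y \<in> set xs"
  shows "(x, y) \<in> reach (ledges xs)"
proof -
  have *: "\<forall>y\<in>set xs. (hd xs, y) \<in> reach (ledges xs)" for xs :: "'a list"
  proof (induction xs rule: ledges.induct)
    case (1 a b xs)
    let ?r = "{(u, v). {u, v} \<in> ledges (a # b # xs)}"
    have sub: "reach (ledges (b # xs)) \<subseteq> ?r\<^sup>*" by (rule rtrancl_mono) auto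
    have "(a, b) \<in> ?r" by simp
    then have "(a, y) \<in> ?r\<^sup>*" if "(b, y) \<in> ?r\<^sup>*" for y using that by (rule converse_rtrancl_into_rtrancl)
    with 1 sub show ?case by auto
  qed auto
  have "sym (reach (ledges xs))"
    by (rule sym_rtrancl) (auto simp: sym_def insert_commute)
  with *[of xs] assms show ?thesis by (meson symD rtrancl_trans)
qed

text \<open>Cutting a path at its first vertex in \<open>B\<close> leaves a path that meets
  \<open>B\<close> only in its end, the form that fans and tripods ask for.\<close>

lemma gpath_first_hit:
  assumes "gpath E xs" "set xs \<inter> B \<noteq> {}"
  obtains ys zs where "xs = ys @ zs" "gpath E ys" "set ys \<inter> B = {last ys}"
proof -
  from assms(2) have "\<exists>x\<in>set xs. x \<in> B" by blast
  then obtain ys b zs where *: "xs = ys @ b # zs" "b \<in> B" "\<forall>y\<in>set ys. y \<notin> B"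
    using split_list_first_prop[of xs "\<lambda>x. x \<in> B"] by blast
  have "gpath E (ys @ [b])" using assms(1) unfolding *(1) by (rule gpath_prefix)
  with * that[of "ys @ [b]" zs] show thesis by auto
qed

text \<open>The paths are indexed by their ends, so the ends are distinct and \<open>W\<close>
  counts the paths. Each path avoids the whole target \<open>B\<close>, not only \<open>W\<close>,
  except for its end.\<close>

definition fan :: "'a set set \<Rightarrow> 'a \<Rightarrow> 'a set \<Rightarrow> 'a set \<Rightarrow> ('a \<Rightarrow> 'a list) \<Rightarrow> bool" where
  "fan E c B W F \<longleftrightarrow> c \<notin> B \<and> W \<subseteq> B \<and>
     (\<forall>w\<in>W. gpath E (F w) \<and> hd (F w) = c \<and> last (F w) = w \<and> set (F w) \<inter> B = {w}) \<and>
     (\<forall>w\<in>W. \<forall>w'\<in>W. w \<noteq> w' \<longrightarrow> set (F w) \<inter> set (F w') = {c})"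

lemma fan_extend:
  assumes "fan E c B W F" "t \<in> B" "t \<notin> W" "gpath E p" "hd p = c" "last p = t" "set p \<inter> B = {t}"
    and "\<And>w. w \<in> W \<Longrightarrow> set p \<inter> set (F w) = {c}"
  shows "fan E c B (insert t W) (F(t := p))"
  using assms unfolding fan_def by (auto 0 3 simp: Int_commute)

text \<open>Augmentation of a linkage in which no old end is given up, after Diestel's third proof of
  Menger's theorem: the target grows by the part of the last path met by the new path \<open>R\<close> and the
  rest of \<open>R\<close>.\<close>

lemma fan_augment:
  assumes "finite V" "\<And>e. e \<in> E \<Longrightarrow> e \<subseteq> V" "B \<subseteq> V" "fan E c B W F"
    and sep: "\<And>Q. c \<notin> Q \<Longrightarrow> finite Q \<Longrightarrow> card Q \<le> card W \<Longrightarrow>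
      \<exists>xs. gpath E xs \<and> hd xs = c \<and> last xs \<in> B \<and> set xs \<inter> Q = {}"
  shows "\<exists>t F'. t \<in> B - W \<and> fan E c B (insert t W) F'"
  using assms(3-5)
proof (induction "card (V - B)" arbitrary: B W F rule: less_induct)
  case less
  note fan = less.prems(2)
  have cB: "c \<notin> B" and WB: "W \<subseteq> B" using fan by (simp_all add: fan_def)
  have F: "gpath E (F w) \<and> hd (F w) = c \<and> last (F w) = w \<and> set (F w) \<inter> B = {w}" if "w \<in> W" for w
    using fan that by (simp add: fan_def)
  have F2: "set (F w) \<inter> set (F w') = {c}" if "w \<in> W" "w' \<in> W" "w \<noteq> w'" for w w'
    using fan that by (simp add: fan_def)
  have finW: "finite W" using WB less.prems(1) assms(1) by (meson finite_subset)
  have hdF: "c \<in> set (F w)" "w \<in> set (F w)" if "w \<in> W" for w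
    using F[OF that] gpath_hd[of E "F w"] gpath_last[of E "F w"] by simp_all
  have "c \<notin> W" using cB WB by blast
  \<comment> \<open>The old ends themselves are an admissible \<open>Q\<close>. The resulting path
    reaches the target away from them, but it may still cross the old fan.\<close>
  from less.prems(3)[OF this finW order.refl] obtain xs where
    xs: "gpath E xs" "hd xs = c" "last xs \<in> B" "set xs \<inter> W = {}" by blast
  have "set xs \<inter> B \<noteq> {}" using xs(3) gpath_last[OF xs(1)] by blast
  from gpath_first_hit[OF xs(1) this] obtain R zs
    where R0: "xs = R @ zs" and Rp: "gpath E R" and RB: "set R \<inter> B = {last R}" .
  define r where "r = last R"
  have Rne: "R \<noteq> []" using Rp by (simp add: gpath_def)
  have hdR: "hd R = c" using R0 xs(2) Rne by simp
  have RW: "set R \<inter> W = {}" using R0 xs(4) by auto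
  have rB: "r \<in> B" "r \<in> set R" using RB r_def by auto
  have rW: "r \<notin> W" using rB RW by auto
  define U where "U = insert c (\<Union>w\<in>W. set (F w))"
  have "\<exists>x\<in>set R. x \<in> U" using hdR Rne U_def by (metis insertI1 list.set_sel(1))
  \<comment> \<open>\<open>x\<close> is the last contact of \<open>R\<close> with the old fan, so
    the rest \<open>zs\<close> of \<open>R\<close> is free of it.\<close>
  then obtain ys x zs where R: "R = ys @ x # zs" and xU: "x \<in> U" and zU: "\<forall>z\<in>set zs. z \<notin> U"
    using split_list_last_prop[of R "\<lambda>x. x \<in> U"] by blast
  show ?case
  proof (cases "x = c")
    \<comment> \<open>\<open>R\<close> meets the old fan only in \<open>c\<close> and serves as the
      new path.\<close>
    case True
    have "ys = []" using R hdR Rp True by (cases ys) (auto simp: gpath_def)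
    then have "set R = insert c (set zs)" using R True by simp
    then have *: "set R \<inter> set (F w) = {c}" if "w \<in> W" for w
      using zU that hdF U_def by fastforce
    have "fan E c B (insert r W) (F(r := R))"
      using fan_extend[OF fan rB(1) rW Rp hdR _ _ *] RB r_def by auto
    with rB rW show ?thesis by blast
  next
    case xc: False
    then obtain w where w: "w \<in> W" "x \<in> set (F w)" using xU U_def by auto
    have xR: "x \<in> set R" using R by simp
    have xW: "x \<notin> W" using xR RW by auto
    have xB: "x \<notin> B" using F[OF w(1)] w xW by auto
    obtain ps qs where Fw: "F w = ps @ x # qs" using w(2) by (meson split_list)
    have qsne: "qs \<noteq> []" using Fw F[OF w(1)] w(1) xW by auto
    have dFw: "distinct (F w)" using F[OF w(1)] by (simp add: gpath_def)
    have lastq: "last (x # qs) = w" "w \<in> set qs" using Fw F[OF w(1)] qsne by (auto simp: last_append)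
    have dR: "distinct R" using Rp by (simp add: gpath_def)
    have psne: "ps \<noteq> []" using Fw F[OF w(1)] xc by (cases ps) auto
    have hdps: "hd ps = c" using Fw F[OF w(1)] psne by simp
    then have cps: "c \<in> set ps" using psne by (metis list.set_sel(1))
    have ysne: "ys \<noteq> []" using R hdR xc by (cases ys) auto
    have cys: "c \<in> set ys" using hdR R ysne by (metis hd_append2 list.set_sel(1))
    have zne: "zs \<noteq> []" using rB xB R r_def by auto
    have lastz: "last (x # zs) = r" "r \<in> set zs" using R zne r_def by (auto simp: last_append)
    have dps: "distinct (ps @ x # qs)" and pathFw: "gpath E (ps @ x # qs)"
      and setFw: "set ps \<union> insert x (set qs) = set (F w)"
      using dFw F[OF w(1)] unfolding Fw by simp_all
    have wps: "w \<notin> set ps" using dps lastq(2) by auto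
    have FwB: "set (F w) \<inter> B = {w}" using F[OF w(1)] by simp
    have psB: "set ps \<inter> B = {}" using FwB wps setFw[symmetric] by auto
    have zsF: "set zs \<inter> set (F v) = {}" if "v \<in> W" for v
      using zU that unfolding U_def by auto
    have pszs: "set ps \<inter> set zs = {}" using zsF[OF w(1)] setFw[symmetric] by auto
    \<comment> \<open>With \<open>F w\<close> cut at \<open>x\<close>, the fan has as many ends as
      before, now with \<open>x\<close> in place of \<open>w\<close>. The target gains at least
      \<open>x\<close>, and the separation hypothesis is inherited because it only asks for a path
      into a larger set.\<close>
    define B' where "B' = B \<union> set (x # qs) \<union> set (x # zs)"
    define W' where "W' = insert x (W - {w})"
    define F' where "F' = F(x := ps @ [x])"
    have cardW': "card W' = card W" using card.remove[OF finW w(1)] xW finW by (simp add: W'_def)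
    have cV: "set xs' \<subseteq> V" if "gpath E xs'" "last xs' \<in> V" for xs'
      using gpath_subset[of E "rev xs'" V] that assms(2) by (auto simp: hd_rev)
    have "set (F w) \<subseteq> V" "set R \<subseteq> V"
      using cV F[OF w(1)] less.prems(1) WB w Rp rB r_def by auto
    then have B'V: "B' \<subseteq> V" using less.prems(1) by (auto simp: B'_def Fw R)
    have "x \<in> V" using B'V by (auto simp: B'_def)
    then have "card (V - B') < card (V - B)"
      using assms(1) xB by (intro psubset_card_mono) (auto simp: B'_def)
    moreover have "fan E c B' W' F'"
      unfolding fan_def
    proof (intro conjI ballI impI)
      show "c \<notin> B'" using cB cps dps cys dR unfolding R by (auto simp: B'_def)
      show "W' \<subseteq> B'" using WB by (auto simp: W'_def B'_def)
    next
      fix v assume v: "v \<in> W'"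
      have "gpath E (F' v) \<and> hd (F' v) = c \<and> last (F' v) = v \<and> set (F' v) \<inter> B' = {v}"
      proof (cases "v = x")
        case True
        have "gpath E (ps @ [x])" using pathFw by (rule gpath_prefix)
        moreover have "set (ps @ [x]) \<inter> B' = {x}"
          using dps xB psB pszs by (auto simp: B'_def)
        ultimately show ?thesis using True hdps psne by (simp add: F'_def)
      next
        case False
        then have vW: "v \<in> W" "v \<noteq> w" using v by (auto simp: W'_def)
        have "set (F v) \<inter> set (F w) = {c}" using F2[OF vW(1) w(1) vW(2)] .
        then have "set (F v) \<inter> set (x # qs) = {}" using setFw[symmetric] cps dps by auto
        moreover have "set (F v) \<inter> set zs = {}" using zsF[OF vW(1)] by auto
        ultimately show ?thesis using F[OF vW(1)] False by (auto simp: F'_def B'_def)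
      qed
      then show "gpath E (F' v)" "hd (F' v) = c" "last (F' v) = v" "set (F' v) \<inter> B' = {v}" by auto
    next
      fix v v' assume v: "v \<in> W'" "v' \<in> W'" "v \<noteq> v'"
      have *: "set (ps @ [x]) \<inter> set (F u) = {c}" if "u \<in> W - {w}" for u
        using F2[of w u] that w(1) setFw[symmetric] hdF(1)[of u] cps by auto
      show "set (F' v) \<inter> set (F' v') = {c}"
        using v * F2 by (cases "v = x"; cases "v' = x") (auto simp: F'_def W'_def Int_commute)
    qed
    moreover have "\<exists>xs. gpath E xs \<and> hd xs = c \<and> last xs \<in> B' \<and> set xs \<inter> Q = {}"
      if "c \<notin> Q" "finite Q" "card Q \<le> card W'" for Q
      using less.prems(3)[of Q] that cardW' by (auto simp: B'_def)
    ultimately obtain y G where y: "y \<in> B'" "y \<notin> W'" and G: "fan E c B' (insert y W') G"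
      using less.hyps[of B' W' F'] B'V by blast
    have Gp: "gpath E (G v)" "hd (G v) = c" "last (G v) = v" "set (G v) \<inter> B' = {v}" "v \<in> set (G v)" "c \<in> set (G v)"
      if "v \<in> insert y W'" for v
    proof -
      show *: "gpath E (G v)" "hd (G v) = c" "last (G v) = v" "set (G v) \<inter> B' = {v}"
        using G that unfolding fan_def by blast+
      then show "v \<in> set (G v)" by auto
      show "c \<in> set (G v)" using * by (metis gpath_def list.set_sel(1))
    qed
    have G2: "set (G v) \<inter> set (G v') = {c}" if "v \<in> insert y W'" "v' \<in> insert y W'" "v \<noteq> v'" for v v'
      using G that unfolding fan_def by blast
    have xW': "x \<in> W'" by (simp add: W'_def)
    have yx: "y \<noteq> x" using y xW' by auto
    \<comment> \<open>A path of the new fan is continued along a tail of \<open>F w\<close> or of \<open>R\<close>.\<close>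
    have cont: "\<exists>p. gpath E p \<and> hd p = c \<and> last p = last (v # us) \<and> set p = set (G v) \<union> set us"
      if v: "v \<in> insert y W'" and us: "gpath E (v # us)" "set us \<subseteq> B'" for v us
    proof -
      obtain as where as: "G v = as @ [v]"
        using Gp[OF v] by (metis append_butlast_last_id gpath_def)
      have "set as \<inter> set us = {}" using Gp(4)[OF v] us as by (auto simp: gpath_def)
      then have "gpath E (as @ v # us)" using gpath_glue us as Gp[OF v] by metis
      moreover have "hd (as @ v # us) = c" using as Gp(2)[OF v] by (cases as) auto
      ultimately show ?thesis using as by (intro exI[of _ "as @ v # us"]) auto
    qed
    have BB': "B \<subseteq> B'" "set qs \<subseteq> B'" "set zs \<subseteq> B'" by (auto simp: B'_def)
    have qsF: "set qs \<subseteq> set (F w)" "x \<notin> set qs" "set qs \<inter> B \<subseteq> {w}" "set qs \<inter> set zs = {}"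
      using setFw[symmetric] dps FwB zsF[OF w(1)] by auto
    have qsF': "x \<notin> set zs" using dR unfolding R by simp
    have "set R \<inter> B = {r}" using RB r_def by simp
    then have zsB: "set zs \<inter> B = {r}" using lastz(2) unfolding R by auto
    have old: "u \<in> insert y W'" "u \<notin> set qs" "u \<notin> set zs" if "u \<in> W - {w}" for u
    proof -
      show "u \<in> insert y W'" using that by (auto simp: W'_def)
      show "u \<notin> set zs" using that RW R by auto
      have "c \<noteq> u" using that cB WB by auto
      then show "u \<notin> set qs" using F2[of w u] w(1) that hdF[of u] setFw[symmetric] by auto
    qed
    \<comment> \<open>This is the common end of the cases below: \<open>p\<close> restores the end
      \<open>w\<close>, \<open>q\<close> leads to a new end \<open>t\<close>, and the paths to the
      other old ends are those of \<open>G\<close>.\<close>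
    have fin: ?thesis
      if t: "t \<in> B" "t \<notin> W"
        and p: "gpath E p" "hd p = c" "last p = w" "set p \<inter> B = {w}"
        and q: "gpath E q" "hd q = c" "last q = t" "set q \<inter> B = {t}"
        and pq: "set p \<inter> set q = {c}"
        and rest: "\<And>u. u \<in> W - {w} \<Longrightarrow> set p \<inter> set (G u) = {c} \<and> set q \<inter> set (G u) = {c}"
      for t p q
    proof -
      have tw: "t \<noteq> w" using t w by auto
      have Gu: "set (G u) \<inter> B = {u}" if "u \<in> W - {w}" for u
        using Gp(4)[OF old(1)[OF that]] BB' that WB by auto
      have GG: "set (G u) \<inter> set (G u') = {c}" if "u \<in> W - {w}" "u' \<in> W - {w}" "u \<noteq> u'" for u u'
        using G2 old(1) that by blast
      have 0: "fan E c B (W - {w}) G"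
        using cB WB Gp(1-3)[OF old(1)] Gu GG unfolding fan_def by blast
      have 1: "fan E c B (insert w (W - {w})) (G(w := p))"
        by (rule fan_extend[OF 0]) (use p w(1) WB rest in auto)
      then have 1: "fan E c B W (G(w := p))" using w(1) by (simp add: insert_absorb)
      have "fan E c B (insert t W) (G(w := p, t := q))"
        by (rule fan_extend[OF 1]) (use t q pq rest tw in \<open>auto simp: Int_commute\<close>)
      with t show ?thesis by blast
    qed
    have xqs: "gpath E (x # qs)" using pathFw by (rule gpath_suffix)
    have xzs: "gpath E (x # zs)" using Rp unfolding R by (rule gpath_suffix)
    have Gold: "set (G u) \<inter> set qs = {}" "set (G u) \<inter> set zs = {}" if "u \<in> W - {w}" for u
      using Gp(4)[OF old(1)[OF that]] old(2,3)[OF that] BB' by auto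
    have GGold: "set (G v) \<inter> set (G u) = {c}" if "u \<in> W - {w}" "v = x \<or> v = y" for u v
    proof -
      have "u \<noteq> v" using that y xW by (auto simp: W'_def)
      then show ?thesis using G2[of v u] old(1)[OF that(1)] that xW' by auto
    qed
    have Gx: "set (G x) \<inter> B' = {x}" and Gy: "set (G y) \<inter> B' = {y}"
      using Gp(4)[of x] Gp(4)[of y] xW' by auto
    have Gxy: "set (G x) \<inter> set (G y) = {c}" using G2[of x y] xW' yx by auto
    have wB: "w \<in> B" using w(1) WB by blast
    have Gxe: "\<And>z. z \<in> set (G x) \<Longrightarrow> z \<in> B' \<Longrightarrow> z = x"
      and Gye: "\<And>z. z \<in> set (G y) \<Longrightarrow> z \<in> B' \<Longrightarrow> z = y"
      and Gxye: "\<And>z. z \<in> set (G x) \<Longrightarrow> z \<in> set (G y) \<Longrightarrow> z = c"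
      and qse: "\<And>z. z \<in> set qs \<Longrightarrow> z \<in> B \<Longrightarrow> z = w"
      and zse: "\<And>z. z \<in> set zs \<Longrightarrow> z \<in> B \<Longrightarrow> z = r"
      and qzse: "\<And>z. z \<in> set zs \<Longrightarrow> z \<in> set qs \<Longrightarrow> False"
      and BB'e: "\<And>z. z \<in> B \<Longrightarrow> z \<in> B'" "\<And>z. z \<in> set qs \<Longrightarrow> z \<in> B'" "\<And>z. z \<in> set zs \<Longrightarrow> z \<in> B'"
      using Gx Gy Gxy qsF(3,4) zsB BB' by auto
    have cG: "c \<in> set (G x)" "c \<in> set (G y)" using Gp(6)[of x] Gp(6)[of y] xW' by auto
    show ?thesis
    proof (cases "y \<in> set qs")
      \<comment> \<open>The path to \<open>y\<close> goes on along the tail of \<open>F w\<close> to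
        \<open>w\<close>, and the path to \<open>x\<close> takes the tail of \<open>R\<close>; the
        new end is \<open>r\<close>.\<close>
      case True
      then obtain q1 q2 where q: "qs = q1 @ y # q2" by (meson split_list)
      have "gpath E (y # q2)" using xqs q gpath_suffix[of E "x # q1" y q2] by simp
      then obtain p where p: "gpath E p" "hd p = c" "last p = last (y # q2)" "set p = set (G y) \<union> set q2"
        using cont[of y q2] q BB' by auto
      obtain p' where p': "gpath E p'" "hd p' = c" "last p' = last (x # zs)" "set p' = set (G x) \<union> set zs"
        using cont[of x zs] xzs xW' BB' by auto
      have lp: "last p = w" using p(3) lastq(1) q by (simp add: last_append split: if_splits)
      have q2: "set q2 \<subseteq> set qs" using q by auto
      show ?thesis
      proof (rule fin[OF rB(1) rW p(1,2) lp _ p'(1,2)])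
        have wp: "w \<in> set p" using lp gpath_last[OF p(1)] by simp
        have "z = w" if "z \<in> set p" "z \<in> B" for z
          using that True q2 Gye BB'e qse unfolding p(4) by blast
        then show "set p \<inter> B = {w}" using wp wB by blast
        show "last p' = r" using p'(3) lastz by simp
        have "z = r" if "z \<in> set p'" "z \<in> B" for z
          using that Gxe BB'e zse xB unfolding p'(4) by blast
        then show "set p' \<inter> B = {r}" using p'(4) rB(1) lastz(2) by blast
        have "z = c" if "z \<in> set p" "z \<in> set p'" for z
          using that Gxye Gxe Gye BB'e qzse qsF(2) q2 True unfolding p(4) p'(4) by blast
        then show "set p \<inter> set p' = {c}" using cG p(4) p'(4) by blast
      next
        fix u assume u: "u \<in> W - {w}"
        show "set p \<inter> set (G u) = {c} \<and> set p' \<inter> set (G u) = {c}"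
          using GGold[OF u, of x] GGold[OF u, of y] Gold[OF u] q2 unfolding p(4) p'(4) by auto
      qed
    next
      \<comment> \<open>Here the path to \<open>x\<close> recovers \<open>w\<close> along all of
        \<open>qs\<close>. The path to \<open>y\<close> either ends in \<open>B\<close> already, so
        that \<open>y\<close> is the new end, or goes on along \<open>R\<close> to
        \<open>r\<close>.\<close>
      case False
      obtain p where p: "gpath E p" "hd p = c" "last p = last (x # qs)" "set p = set (G x) \<union> set qs"
        using cont[of x qs] xqs xW' BB' by auto
      have "z = w" if "z \<in> set p" "z \<in> B" for z
        using that Gxe BB'e qse xB unfolding p(4) by blast
      then have pB: "set p \<inter> B = {w}" using p(4) wB lastq(2) by blast
      have lp: "last p = w" using p(3) lastq by simp
      have pu: "set p \<inter> set (G u) = {c}" if "u \<in> W - {w}" for u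
        using GGold[OF that, of x] Gold[OF that] unfolding p(4) by auto
      show ?thesis
      proof (cases "y \<in> B")
        case True
        have yW: "y \<notin> W" using y False lastq by (auto simp: W'_def)
        show ?thesis
        proof (rule fin[OF True yW p(1,2) lp pB Gp(1-3)])
          show "set (G y) \<inter> B = {y}" using Gye BB'e True Gp(5)[of y] by blast
          have "z = c" if "z \<in> set p" "z \<in> set (G y)" for z
            using that Gxye Gye BB'e False unfolding p(4) by blast
          then show "set p \<inter> set (G y) = {c}" using cG p(4) by blast
          show "set p \<inter> set (G u) = {c} \<and> set (G y) \<inter> set (G u) = {c}" if "u \<in> W - {w}" for u
            using pu[OF that] GGold[OF that, of y] by auto
        qed auto
      next
        case yB: False
        then have "y \<in> set zs" using y False yx by (auto simp: B'_def)
        then obtain z1 z2 where z: "zs = z1 @ y # z2" by (meson split_list)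
        have "gpath E (y # z2)" using xzs z gpath_suffix[of E "x # z1" y z2] by simp
        then obtain p' where p': "gpath E p'" "hd p' = c" "last p' = last (y # z2)" "set p' = set (G y) \<union> set z2"
          using cont[of y z2] z BB' by auto
        have lp': "last p' = r" using p'(3) lastz(1) z by (simp add: last_append split: if_splits)
        have z2: "set z2 \<subseteq> set zs" using z by auto
        have rp': "r \<in> set p'" using lp' gpath_last[OF p'(1)] by simp
        show ?thesis
        proof (rule fin[OF rB(1) rW p(1,2) lp pB p'(1,2) lp'])
          have "v = r" if "v \<in> set p'" "v \<in> B" for v
            using that Gye BB'e zse yB z2 unfolding p'(4) by blast
          then show "set p' \<inter> B = {r}" using rp' rB(1) by blast
          have "v = c" if "v \<in> set p" "v \<in> set p'" for v
            using that Gxye Gxe Gye BB'e qzse qsF' z2 False unfolding p(4) p'(4) by blast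
          then show "set p \<inter> set p' = {c}" using cG p(4) p'(4) by blast
          show "set p \<inter> set (G u) = {c} \<and> set p' \<inter> set (G u) = {c}" if "u \<in> W - {w}" for u
            using pu[OF that] GGold[OF that, of y] Gold[OF that] z2 unfolding p'(4) by auto
        qed
      qed
    qed
  qed
qed

section \<open>Trees and packings\<close>

definition nbrs :: "'a set set \<Rightarrow> 'a \<Rightarrow> 'a set" where
  "nbrs E v = {u. {v, u} \<in> E}"

lemma finite_simple_graphD:
  assumes "finite_simple_graph G"
  shows "finite (verts G)" "finite (edges G)"
    "\<And>e. e \<in> edges G \<Longrightarrow> e \<subseteq> verts G" "\<And>e. e \<in> edges G \<Longrightarrow> card e = 2"
proof -
  show *: "finite (verts G)" "\<And>e. e \<in> edges G \<Longrightarrow> e \<subseteq> verts G" "\<And>e. e \<in> edges G \<Longrightarrow> card e = 2"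
    using assms by (auto simp: finite_simple_graph_def)
  have "edges G \<subseteq> Pow (verts G)" using *(2) by blast
  then show "finite (edges G)" by (rule finite_subset) (use *(1) in simp)
qed

lemma sym_adj_rtrancl: "sym (reach E)"
  by (rule sym_rtrancl) (auto simp: sym_def insert_commute)

lemma connected_graph_alt:
  assumes "r \<in> verts G"
  shows "connected_graph G \<longleftrightarrow> (\<forall>v\<in>verts G. (r, v) \<in> reach (edges G))"
proof
  assume *: "\<forall>v\<in>verts G. (r, v) \<in> reach (edges G)"
  show "connected_graph G"
    unfolding connected_graph_def
  proof (intro conjI ballI)
    fix u v assume "u \<in> verts G" "v \<in> verts G"
    with * have "(r, u) \<in> reach (edges G)" "(r, v) \<in> reach (edges G)"
      by blast+
    then show "(u, v) \<in> reach (edges G)"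
      by (blast intro: symD[OF sym_adj_rtrancl] rtrancl_trans)
  qed (use assms in blast)
qed (use assms in \<open>simp add: connected_graph_def\<close>)

lemma connected_graph_union:
  assumes "connected_graph H" "connected_graph K" "verts H \<inter> verts K \<noteq> {}"
  shows "connected_graph (Graph (verts H \<union> verts K) (edges H \<union> edges K))"
proof -
  obtain r where r: "r \<in> verts H" "r \<in> verts K" using assms(3) by blast
  let ?R = "reach (edges H \<union> edges K)"
  have "reach (edges H) \<subseteq> ?R" "reach (edges K) \<subseteq> ?R"
    by (rule rtrancl_mono; auto)+
  then show ?thesis
    using assms(1,2) r unfolding connected_graph_alt[OF r(1)] connected_graph_alt[OF r(2)]
    by (subst connected_graph_alt[of r]) auto
qed

definition lgraph :: "'a list \<Rightarrow> 'a graph" where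
  "lgraph xs = Graph (set xs) (ledges xs)"

lemma connected_lgraph: "xs \<noteq> [] \<Longrightarrow> connected_graph (lgraph xs)"
  by (auto simp: connected_graph_def lgraph_def intro: ledges_rtrancl)

lemma connected_edge_at:
  assumes "connected_graph T" "v \<in> verts T" "w \<in> verts T" "v \<noteq> w"
  shows "\<exists>e\<in>edges T. v \<in> e"
proof -
  have "(v, w) \<in> reach (edges T)" using assms by (simp add: connected_graph_def)
  then obtain u where "{v, u} \<in> edges T" using assms(4) by (auto elim: converse_rtranclE)
  then show ?thesis by blast
qed

text \<open>The list \<open>c\<close>, read from head to last vertex, is a detour around its closing
  edge; length at least 3 keeps that edge off the list.\<close>

lemma cycle_edge_redundant:
  assumes "is_cycle (Graph V E) c"
  shows "{last c, hd c} \<in> E" "(last c, hd c) \<in> reach (E - {{last c, hd c}})"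
proof -
  have len: "length c \<ge> 3" and dis: "distinct c"
    and E: "\<And>i. i < length c \<Longrightarrow> {c ! i, c ! (Suc i mod length c)} \<in> E"
    using assms by (auto simp: is_cycle_def)
  have ne: "c \<noteq> []" using len by auto
  show 1: "{last c, hd c} \<in> E"
    using E[of "length c - 1"] len ne by (simp add: last_conv_nth hd_conv_nth)
  have "ledges c \<subseteq> E - {{last c, hd c}}"
  proof
    fix e assume "e \<in> ledges c"
    then obtain us x y vs where c: "c = us @ x # y # vs" "e = {x, y}" by (auto simp: ledges_mem_iff)
    have "x = c ! length us" "y = c ! Suc (length us)" "Suc (length us) < length c"
      using c by (auto simp: nth_append)
    then have "e \<in> E" using E[of "length us"] c(2) by simp
    moreover have "e \<noteq> {last c, hd c}"
    proof
      assume "e = {last c, hd c}"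
      then have "x = hd c \<and> y = last c \<or> x = last c \<and> y = hd c"
        using c(2) by (auto simp: doubleton_eq_iff)
      then show False
      proof
        assume *: "x = hd c \<and> y = last c"
        have "us = []" using * dis c(1) by (cases us) auto
        moreover have "vs = []" using * dis c(1) by (cases vs rule: rev_cases) auto
        ultimately show False using c len by simp
      next
        assume *: "x = last c \<and> y = hd c"
        then show False using dis c(1) by (cases vs rule: rev_cases) (auto split: if_splits)
      qed
    qed
    ultimately show "e \<in> E - {{last c, hd c}}" by blast
  qed
  then have "reach (ledges c) \<subseteq> reach (E - {{last c, hd c}})"
    by (intro rtrancl_mono) blast
  then show "(last c, hd c) \<in> reach (E - {{last c, hd c}})"
    using ledges_rtrancl[of "last c" c "hd c"] ne by auto
qed

section \<open>Trees inside connected subgraphs, and packings\<close>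

lemma spanning_tree:
  assumes "finite_simple_graph H" "connected_graph H"
  shows "\<exists>T. tree T \<and> verts T = verts H \<and> edges T \<subseteq> edges H"
proof -
  define P where "P F \<longleftrightarrow> F \<subseteq> edges H \<and> connected_graph (Graph (verts H) F)" for F
  have "P (edges H)" using assms(2) by (simp add: P_def)
  from ex_has_least_nat[of P, OF this, of card] obtain F
    where F: "P F" "\<And>F'. P F' \<Longrightarrow> card F \<le> card F'" by blast
  have finF: "finite F" using F(1) finite_simple_graphD(2)[OF assms(1)] finite_subset by (auto simp: P_def)
  have "\<nexists>c. is_cycle (Graph (verts H) F) c"
  proof
    assume "\<exists>c. is_cycle (Graph (verts H) F) c"
    then obtain c where c: "is_cycle (Graph (verts H) F) c" by blast
    let ?e = "{last c, hd c}"
    let ?R = "{(x, y). {x, y} \<in> F - {?e}}"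
    note e = cycle_edge_redundant[OF c]
    have "(hd c, last c) \<in> ?R\<^sup>*" using e(2) by (rule symD[OF sym_adj_rtrancl])
    then have "{(x, y). {x, y} \<in> F} \<subseteq> ?R\<^sup>*"
      using e(2) by (auto simp: doubleton_eq_iff)
    then have "reach F \<subseteq> ?R\<^sup>*" by (rule rtrancl_subset_rtrancl)
    then have "P (F - {?e})" using F(1) unfolding P_def connected_graph_def by auto
    then show False using F(2)[of "F - {?e}"] e(1) finF by (meson card_Diff1_less linorder_not_less)
  qed
  moreover have "finite_simple_graph (Graph (verts H) F)"
    using assms(1) F(1) by (auto simp: finite_simple_graph_def P_def)
  ultimately have "tree (Graph (verts H) F)" using F(1) by (auto simp: tree_def P_def)
  then show ?thesis using F(1) by (intro exI[of _ "Graph (verts H) F"]) (auto simp: P_def)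
qed

text \<open>\<open>Max\<close> is meaningful only on a finite set; here a tree is determined by a
  set of vertices and a set of edges of \<open>G\<close>.\<close>

lemma finite_tree_packings:
  assumes "finite_simple_graph G"
  shows "finite {card \<T> | \<T>. tree_packing G S \<T>}"
proof -
  let ?U = "(\<lambda>(V, E). Graph V E) ` (Pow (verts G) \<times> Pow (edges G))"
  have "finite ?U" using finite_simple_graphD[OF assms] by simp
  moreover have "\<T> \<subseteq> ?U" if "tree_packing G S \<T>" for \<T>
  proof
    fix T assume "T \<in> \<T>"
    then have "verts T \<subseteq> verts G" "edges T \<subseteq> edges G"
      using that by (auto simp: tree_packing_def connecting_tree_def subgraph_def)
    then show "T \<in> ?U" by (intro image_eqI[of _ _ "(verts T, edges T)"]) auto
  qed
  then have "{card \<T> | \<T>. tree_packing G S \<T>} \<subseteq> card ` Pow ?U" by blast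
  ultimately show ?thesis by (meson finite_Pow_iff finite_imageI finite_subset)
qed

lemma set_connectivity_le:
  assumes "finite_simple_graph G" "\<And>\<T>. tree_packing G S \<T> \<Longrightarrow> card \<T> \<le> k"
  shows "set_connectivity G S \<le> k"
proof -
  have "tree_packing G S {}" by (simp add: tree_packing_def)
  then show ?thesis
    unfolding set_connectivity_def using finite_tree_packings[OF assms(1), of S] assms(2)
    by (subst Max_le_iff) auto
qed

text \<open>It is enough to pack connected subgraphs that overlap only inside \<open>S\<close>,
  since each has a spanning tree. Two distinct vertices in \<open>S\<close> give every tree an edge;
  edge-disjoint trees with different indices are then different, and the set of trees has as many
  members as \<open>I\<close>.\<close>

lemma set_connectivity_ge:
  assumes G: "finite_simple_graph G" and S: "u \<in> S" "v \<in> S" "u \<noteq> v"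
    and X: "\<And>i. i \<in> I \<Longrightarrow> subgraph (X i) G \<and> connected_graph (X i) \<and> S \<subseteq> verts (X i)"
    and dis: "\<And>i j. i \<in> I \<Longrightarrow> j \<in> I \<Longrightarrow> i \<noteq> j \<Longrightarrow>
      edges (X i) \<inter> edges (X j) = {} \<and> verts (X i) \<inter> verts (X j) \<subseteq> S"
  shows "card I \<le> set_connectivity G S"
proof -
  have "\<exists>T. tree T \<and> verts T = verts (X i) \<and> edges T \<subseteq> edges (X i)" if "i \<in> I" for i
    using X[OF that] spanning_tree by (auto simp: subgraph_def)
  then obtain T where T: "\<And>i. i \<in> I \<Longrightarrow> tree (T i) \<and> verts (T i) = verts (X i) \<and> edges (T i) \<subseteq> edges (X i)"
    by metis
  have ne: "edges (T i) \<noteq> {}" if "i \<in> I" for i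
  proof -
    have "u \<in> verts (T i)" "v \<in> verts (T i)" using T[OF that] X[OF that] S by blast+
    then show ?thesis
      using connected_edge_at[of "T i" u v] T[OF that] S(3) by (auto simp: tree_def)
  qed
  have "inj_on T I"
  proof (rule inj_onI, rule ccontr)
    fix i j assume *: "i \<in> I" "j \<in> I" "T i = T j" "i \<noteq> j"
    then have "edges (T i) \<subseteq> edges (X i) \<inter> edges (X j)" using T[of i] T[of j] by auto
    then show False using dis[of i j] ne[of i] * by auto
  qed
  moreover have "tree_packing G S (T ` I)"
    unfolding tree_packing_def
  proof (intro conjI ballI impI)
    fix Y assume "Y \<in> T ` I"
    then obtain i where i: "i \<in> I" "Y = T i" by blast
    then show "connecting_tree G S Y"
      using T[OF i(1)] X[OF i(1)] by (auto simp: connecting_tree_def subgraph_def tree_def)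
  next
    fix Y Z assume "Y \<in> T ` I" "Z \<in> T ` I" "Y \<noteq> Z"
    then obtain i j where *: "i \<in> I" "Y = T i" "j \<in> I" "Z = T j" "i \<noteq> j" by blast
    show "edges Y \<inter> edges Z = {}" using dis[OF *(1,3,5)] T[OF *(1)] T[OF *(3)] * by blast
    show "verts Y \<inter> verts Z = S"
      using dis[OF *(1,3,5)] T[OF *(1)] T[OF *(3)] X[OF *(1)] X[OF *(3)] *(2,4) by auto
  qed
  ultimately have "card I \<in> {card \<T> | \<T>. tree_packing G S \<T>}"
    by (metis (mono_tags, lifting) card_image mem_Collect_eq)
  then show ?thesis
    unfolding set_connectivity_def using finite_tree_packings[OF G] by (rule Max_ge[rotated])
qed

subsection \<open>The upper bound\<close>

lemma connectivity_attained:
  assumes "finite_simple_graph G"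
  shows "\<exists>Q\<subseteq>verts G. card Q = connectivity G \<and>
    (\<not> connected_graph (delete_verts G Q) \<or> trivial_graph (delete_verts G Q))"
    and "Q \<subseteq> verts G \<Longrightarrow> \<not> connected_graph (delete_verts G Q) \<or> trivial_graph (delete_verts G Q)
      \<Longrightarrow> connectivity G \<le> card Q"
proof -
  let ?A = "{card Q | Q. Q \<subseteq> verts G \<and>
       (\<not> connected_graph (delete_verts G Q) \<or> trivial_graph (delete_verts G Q))}"
  have "?A \<subseteq> card ` Pow (verts G)" by blast
  then have fin: "finite ?A" using finite_simple_graphD(1)[OF assms] by (meson finite_Pow_iff finite_imageI finite_subset)
  have "trivial_graph (delete_verts G (verts G))" by (simp add: trivial_graph_def delete_verts_def)
  then have "?A \<noteq> {}" by blast
  with fin have "Min ?A \<in> ?A" by (rule Min_in)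
  then show "\<exists>Q\<subseteq>verts G. card Q = connectivity G \<and>
    (\<not> connected_graph (delete_verts G Q) \<or> trivial_graph (delete_verts G Q))"
    unfolding connectivity_def by (smt (verit) mem_Collect_eq)
  show "Q \<subseteq> verts G \<Longrightarrow> \<not> connected_graph (delete_verts G Q) \<or> trivial_graph (delete_verts G Q)
      \<Longrightarrow> connectivity G \<le> card Q"
    unfolding connectivity_def using fin by (intro Min_le) auto
qed

lemma connected_delete_verts:
  assumes "finite_simple_graph G" "finite Q" "card Q < connectivity G"
  shows "connected_graph (delete_verts G Q)" "card (verts G - Q) \<ge> 2"
proof -
  have eq: "delete_verts G Q = delete_verts G (Q \<inter> verts G)"
    using finite_simple_graphD(3)[OF assms(1)] by (auto simp: delete_verts_def)
  have "card (Q \<inter> verts G) \<le> card Q" using assms(2) by (simp add: card_mono)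
  then have "connected_graph (delete_verts G Q) \<and> \<not> trivial_graph (delete_verts G Q)"
    unfolding eq using connectivity_attained(2)[OF assms(1), of "Q \<inter> verts G"] assms(3) by auto
  then show "connected_graph (delete_verts G Q)" "card (verts G - Q) \<ge> 2"
    by (auto simp: trivial_graph_def delete_verts_def)
qed

lemma nbrs_simple:
  assumes "finite_simple_graph G"
  shows "nbrs (edges G) v \<subseteq> verts G - {v}"
proof
  fix u assume "u \<in> nbrs (edges G) v"
  then have "{v, u} \<in> edges G" by (simp add: nbrs_def)
  then have "{v, u} \<subseteq> verts G" "card {v, u} = 2" using finite_simple_graphD[OF assms] by blast+
  then show "u \<in> verts G - {v}" by (cases "u = v") auto
qed

lemma edges_at_eq:
  assumes "finite_simple_graph G"
  shows "{e \<in> edges G. v \<in> e} = (\<lambda>u. {v, u}) ` nbrs (edges G) v"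
proof
  show "{e \<in> edges G. v \<in> e} \<subseteq> (\<lambda>u. {v, u}) ` nbrs (edges G) v"
  proof
    fix e assume e: "e \<in> {e \<in> edges G. v \<in> e}"
    then have "card e = 2" using finite_simple_graphD(4)[OF assms] by blast
    then obtain x y where "e = {x, y}" by (auto simp: card_2_iff)
    then obtain u where "e = {v, u}" using e by (metis (lifting) insert_commute insertE mem_Collect_eq singletonD)
    then show "e \<in> (\<lambda>u. {v, u}) ` nbrs (edges G) v" using e by (auto simp: nbrs_def)
  qed
qed (auto simp: nbrs_def)

lemma card_edges_at:
  assumes "finite_simple_graph G"
  shows "card {e \<in> edges G. v \<in> e} = card (nbrs (edges G) v)"
  unfolding edges_at_eq[OF assms] by (rule card_image) (auto simp: inj_on_def doubleton_eq_iff)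

text \<open>A tree that contains \<open>v\<close> and \<open>w\<close> spends an edge at
  \<open>v\<close>, and edge-disjoint trees spend different ones.\<close>

lemma set_connectivity_le_degree:
  assumes G: "finite_simple_graph G" and S: "v \<in> S" "w \<in> S" "v \<noteq> w"
  shows "set_connectivity G S \<le> card (nbrs (edges G) v)"
proof (rule set_connectivity_le[OF G])
  fix \<T> assume T: "tree_packing G S \<T>"
  have "\<exists>e\<in>edges T. v \<in> e \<and> e \<in> edges G" if "T \<in> \<T>" for T
  proof -
    have "connecting_tree G S T" using T that by (simp add: tree_packing_def)
    then have T': "connected_graph T" "v \<in> verts T" "w \<in> verts T" "edges T \<subseteq> edges G"
      using S(1,2) by (auto simp: connecting_tree_def tree_def subgraph_def)
    then show ?thesis using connected_edge_at[OF T'(1-3) S(3)] by blast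
  qed
  then obtain f where f: "\<And>T. T \<in> \<T> \<Longrightarrow> f T \<in> edges T \<and> v \<in> f T \<and> f T \<in> edges G" by metis
  have "inj_on f \<T>"
    using T f unfolding inj_on_def tree_packing_def by (metis disjoint_iff)
  moreover have "f ` \<T> \<subseteq> {e \<in> edges G. v \<in> e}" using f by auto
  ultimately have "card \<T> \<le> card {e \<in> edges G. v \<in> e}"
    using finite_simple_graphD(2)[OF G] by (intro card_inj_on_le) auto
  then show "card \<T> \<le> card (nbrs (edges G) v)" using card_edges_at[OF G] by simp
qed

text \<open>Different trees meet \<open>Q\<close> in different vertices: these lie outside
  \<open>S\<close>, where the trees are disjoint.\<close>

lemma set_connectivity_le_separator:
  assumes G: "finite_simple_graph G" and Q: "finite Q" "Q \<inter> S = {}" and S: "u \<in> S" "v \<in> S" "S \<subseteq> verts G"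
    and sep: "(u, v) \<notin> reach (edges (delete_verts G Q))"
  shows "set_connectivity G S \<le> card Q"
proof (rule set_connectivity_le[OF G])
  fix \<T> assume T: "tree_packing G S \<T>"
  have "\<exists>q. q \<in> verts T \<and> q \<in> Q" if "T \<in> \<T>" for T
  proof (rule ccontr)
    assume *: "\<nexists>q. q \<in> verts T \<and> q \<in> Q"
    have ct: "connecting_tree G S T" using T that by (simp add: tree_packing_def)
    then have "u \<in> verts T" "v \<in> verts T" using S by (auto simp: connecting_tree_def)
    then have "(u, v) \<in> reach (edges T)"
      using ct by (simp add: connecting_tree_def tree_def connected_graph_def)
    moreover have "edges T \<subseteq> edges (delete_verts G Q)"
      using ct * by (auto simp: connecting_tree_def subgraph_def finite_simple_graph_def delete_verts_def)
    then have "reach (edges T) \<subseteq> reach (edges (delete_verts G Q))"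
      by (intro rtrancl_mono) blast
    ultimately show False using sep by blast
  qed
  then obtain f where f: "\<And>T. T \<in> \<T> \<Longrightarrow> f T \<in> verts T \<and> f T \<in> Q" by metis
  have "inj_on f \<T>"
    using T f Q(2) unfolding inj_on_def tree_packing_def by (metis IntI disjoint_iff)
  then show "card \<T> \<le> card Q" using f Q(1) by (intro card_inj_on_le) auto
qed

lemma finite_three_sets:
  assumes "finite (verts G)"
  shows "finite {set_connectivity G S | S. S \<subseteq> verts G \<and> card S = 3}"
proof -
  have "{set_connectivity G S | S. S \<subseteq> verts G \<and> card S = 3} \<subseteq> set_connectivity G ` Pow (verts G)" by blast
  then show ?thesis using assms by (meson finite_Pow_iff finite_imageI finite_subset)
qed

lemma ex_three_set:
  assumes "finite V" "card V \<ge> 3" "u \<in> V" "v \<in> V" "u \<noteq> v"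
  shows "\<exists>w\<in>V. w \<noteq> u \<and> w \<noteq> v"
proof -
  have "card (V - {u, v}) \<ge> 1" using assms by (simp add: card_Diff_subset)
  then have "V - {u, v} \<noteq> {}" by (metis card.empty not_one_le_zero)
  then show ?thesis by blast
qed

theorem three_connectivity_le_connectivity:
  assumes G: "finite_simple_graph G" and n: "card (verts G) \<ge> 3"
  shows "three_connectivity G \<le> connectivity G"
proof -
  note fin = finite_simple_graphD(1)[OF G]
  obtain Q where Q: "Q \<subseteq> verts G" "card Q = connectivity G"
    and cut: "\<not> connected_graph (delete_verts G Q) \<or> trivial_graph (delete_verts G Q)"
    using connectivity_attained(1)[OF G] by blast
  have finQ: "finite Q" using Q(1) fin finite_subset by blast
  have cardVQ: "card (verts G - Q) + card Q = card (verts G)"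
    using Q(1) fin by (metis card_Diff_subset card_mono finQ le_add_diff_inverse2)
  have key: "three_connectivity G \<le> set_connectivity G S" if "S \<subseteq> verts G" "card S = 3" for S
    unfolding three_connectivity_def using finite_three_sets[OF fin] that by (intro Min_le) auto
  have deg: "three_connectivity G \<le> card (nbrs (edges G) v)" if v: "v \<in> verts G" for v
  proof -
    have "card (verts G - {v}) > 0" using n v fin by simp
    then obtain w where w: "w \<in> verts G" "v \<noteq> w" by (metis DiffE card_gt_0_iff ex_in_conv insertI1)
    with ex_three_set[OF fin n v w(1) w(2)] obtain x where "x \<in> verts G" "x \<noteq> v" "x \<noteq> w" by blast
    with w v have "{v, w, x} \<subseteq> verts G" "card {v, w, x} = 3" by auto
    from key[OF this] set_connectivity_le_degree[OF G, of v "{v, w, x}" w] w show ?thesis by simp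
  qed
  show ?thesis
  proof (cases "card (verts G - Q) \<le> 1")
    \<comment> \<open>A set that leaves at most one of the n vertices has size at least n - 1, and
      no degree is larger than that.\<close>
    case True
    obtain v where v: "v \<in> verts G" using n by (metis card.empty equals0I not_numeral_le_zero)
    have "card (nbrs (edges G) v) \<le> card (verts G - {v})"
      using nbrs_simple[OF G] fin by (intro card_mono) auto
    also have "\<dots> = card (verts G) - 1" using v fin by simp
    finally show ?thesis using deg[OF v] True cardVQ Q(2) by linarith
  next
    case False
    then have "\<not> connected_graph (delete_verts G Q)" using cut by (simp add: trivial_graph_def delete_verts_def)
    moreover have "verts G - Q \<noteq> {}" using False by (metis card.empty zero_le_one)
    ultimately obtain u v where uv: "u \<in> verts G - Q" "v \<in> verts G - Q"
      "(u, v) \<notin> reach (edges (delete_verts G Q))"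
      by (auto simp: connected_graph_def delete_verts_def)
    then have ne: "u \<noteq> v" by auto
    show ?thesis
    proof (cases "card (verts G - Q) \<ge> 3")
      case True
      obtain w where w: "w \<in> verts G - Q" "w \<noteq> u" "w \<noteq> v"
        using ex_three_set[OF _ True uv(1,2) ne] fin by auto
      have "card {u, v, w} = 3" "{u, v, w} \<subseteq> verts G" using w ne uv by auto
      from key[OF this(2,1)] set_connectivity_le_separator[OF G finQ _ _ _ _ uv(3), of "{u, v, w}"]
      show ?thesis using uv w Q(2) by auto
    next
      \<comment> \<open>Exactly \<open>u\<close> and \<open>v\<close> are left and they are not
        adjacent, so all neighbours of \<open>u\<close> lie in \<open>Q\<close>.\<close>
      case few: False
      have "nbrs (edges G) u \<subseteq> Q"
      proof
        fix x assume x: "x \<in> nbrs (edges G) u"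
        show "x \<in> Q"
        proof (rule ccontr)
          assume xQ: "x \<notin> Q"
          then have xV: "x \<in> verts G - Q" "x \<noteq> u" using x nbrs_simple[OF G, of u] by auto
          have "x \<noteq> v"
          proof
            assume "x = v"
            then have "(u, v) \<in> {(x, y). {x, y} \<in> edges (delete_verts G Q)}"
              using x xQ uv(1) by (auto simp: nbrs_def delete_verts_def)
            then show False using uv(3) by blast
          qed
          then have "card {u, v, x} = 3" "{u, v, x} \<subseteq> verts G - Q" using ne xV uv by auto
          then show False using few fin by (metis card_mono finite_Diff)
        qed
      qed
      then have "card (nbrs (edges G) u) \<le> card Q" using finQ by (rule card_mono[rotated])
      then show ?thesis using deg[of u] uv(1) Q(2) by auto
    qed
  qed
qed

section \<open>Disjoint paths between two vertices\<close>

text \<open>This is the fan version of Menger's theorem: augmentation starts from the empty fan and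
  works as long as there are fewer than \<open>k\<close> ends.\<close>

lemma fan_exists:
  assumes "finite V" "\<And>e. e \<in> E \<Longrightarrow> e \<subseteq> V" "B \<subseteq> V" "c \<notin> B"
    and sep: "\<And>Q. c \<notin> Q \<Longrightarrow> finite Q \<Longrightarrow> card Q < k \<Longrightarrow>
      \<exists>xs. gpath E xs \<and> hd xs = c \<and> last xs \<in> B \<and> set xs \<inter> Q = {}"
  shows "\<exists>W F. card W = k \<and> fan E c B W F"
  using sep
proof (induction k)
  case 0
  have "fan E c B {} (\<lambda>_. [])" using assms(4) by (simp add: fan_def)
  then show ?case by (intro exI[of _ "{}"]) auto
next
  case (Suc k)
  then obtain W F where W: "card W = k" "fan E c B W F" by (meson less_SucI)
  have "finite W" using W(2) assms(1,3) by (meson fan_def finite_subset)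
  moreover obtain t F' where "t \<in> B - W" "fan E c B (insert t W) F'"
    using fan_augment[OF assms(1,2,3) W(2)] Suc.prems W(1) by (metis le_imp_less_Suc)
  ultimately show ?case using W(1) by (intro exI[of _ "insert t W"] exI[of _ F']) auto
qed

definition path_system :: "'a set set \<Rightarrow> 'a \<Rightarrow> 'a \<Rightarrow> 'a list set \<Rightarrow> bool" where
  "path_system E a b \<P> \<longleftrightarrow>
     (\<forall>P\<in>\<P>. gpath E P \<and> hd P = a \<and> last P = b) \<and>
     (\<forall>P\<in>\<P>. \<forall>P'\<in>\<P>. P \<noteq> P' \<longrightarrow> set P \<inter> set P' = {a, b} \<and> ledges P \<inter> ledges P' = {})"

text \<open>A path to \<open>b\<close> is cut just before \<open>b\<close>; its last vertex is then
  a neighbour of \<open>b\<close> reached without passing through \<open>b\<close>.\<close>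

lemma last_step_to:
  assumes "(z, b) \<in> reach (edges (delete_verts G R))" "z \<noteq> b"
  shows "\<exists>y. {b, y} \<in> edges G \<and> y \<notin> R \<and> (z, y) \<in> reach (edges (delete_verts G (insert b R)))"
proof -
  obtain xs where xs: "gpath (edges (delete_verts G R)) xs" "hd xs = z" "last xs = b"
    using rtrancl_gpath[OF assms(1)] .
  define ys where "ys = butlast xs"
  have ne: "xs \<noteq> []" using xs by (simp add: gpath_def)
  then have eq: "xs = ys @ [b]" using xs(3) by (metis append_butlast_last_id ys_def)
  have yne: "ys \<noteq> []" using eq xs(2) assms(2) by auto
  have hdys: "hd ys = z" using eq xs(2) yne by simp
  have E: "insert {last ys, b} (ledges ys) \<subseteq> edges (delete_verts G R)"
    using xs(1) yne by (auto simp: gpath_def eq ledges_snoc)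
  have "b \<notin> set ys" using xs(1) eq by (auto simp: gpath_def)
  then have "ledges ys \<subseteq> edges (delete_verts G (insert b R))"
    using E ledges_subset[of _ ys] by (auto simp: delete_verts_def) 
  then have "reach (ledges ys) \<subseteq> reach (edges (delete_verts G (insert b R)))"
    by (intro rtrancl_mono) blast
  moreover have "(z, last ys) \<in> reach (ledges ys)"
    using ledges_rtrancl[of z ys "last ys"] hdys yne by auto
  ultimately show ?thesis using E by (intro exI[of _ "last ys"]) (auto simp: delete_verts_def insert_commute)
qed

text \<open>This supplies the hypothesis for a fan from \<open>a\<close> to the neighbours of
  \<open>b\<close> after \<open>b\<close> is deleted. If \<open>a\<close> and \<open>b\<close> are
  adjacent, their edge is one of the wanted paths and only \<open>k - 1\<close> others are needed;
  the unit saved in the size of \<open>Q\<close> pays for deleting \<open>a\<close> or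
  \<open>b\<close> as well.\<close>

lemma menger_separators:
  assumes G: "finite_simple_graph G" and ab: "a \<in> verts G" "b \<in> verts G" "a \<noteq> b"
    and Q: "a \<notin> Q" "finite Q" "card Q < (if {a, b} \<in> edges G then k - 1 else k)" and k: "k \<le> connectivity G"
  shows "\<exists>y. {b, y} \<in> edges G \<and> y \<noteq> a \<and> (a, y) \<in> reach (edges (delete_verts G (insert b Q)))"
proof -
  \<comment> \<open>\<open>b\<close> must not be deleted yet, because the connection is to run into
    \<open>b\<close> before its last step is cut off.\<close>
  define Q' where "Q' = Q - {b}"
  have Q': "finite Q'" "card Q' \<le> card Q" "insert b Q' = insert b Q" using Q(2) by (auto simp: Q'_def card_Diff1_le)
  let ?R = "\<lambda>Q. reach (edges (delete_verts G Q))"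
  show ?thesis
  proof (cases "{a, b} \<in> edges G")
    case False
    have "connected_graph (delete_verts G Q')"
      using connected_delete_verts(1)[OF G Q'(1)] Q'(2) Q(3) k False by auto
    moreover have "a \<in> verts (delete_verts G Q')" "b \<in> verts (delete_verts G Q')"
      using ab Q(1) by (auto simp: Q'_def delete_verts_def)
    ultimately have "(a, b) \<in> ?R Q'" by (simp add: connected_graph_def)
    from last_step_to[OF this ab(3)] obtain y where "{b, y} \<in> edges G" "(a, y) \<in> ?R (insert b Q')"
      by blast
    moreover have "y \<noteq> a" using False calculation(1) by (auto simp: insert_commute)
    ultimately show ?thesis unfolding Q'(3) by blast
  next
    case True
    have card: "card (insert b Q') < connectivity G" "card (insert a Q') < connectivity G"
      using Q'(2) Q(3) k True card_insert_if[OF Q'(1), of b] card_insert_if[OF Q'(1), of a]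
      by (auto split: if_splits)
    have con: "connected_graph (delete_verts G (insert b Q'))" "connected_graph (delete_verts G (insert a Q'))"
      using connected_delete_verts(1)[OF G] Q'(1) card by auto
    \<comment> \<open>A third vertex \<open>z\<close> links a connection from \<open>a\<close> that
      avoids \<open>b\<close> with a connection into \<open>b\<close> that avoids \<open>a\<close>.
      The latter enters \<open>b\<close> from a neighbour other than \<open>a\<close>.\<close>
    have "card (verts G - insert b Q') \<ge> 2" using connected_delete_verts(2)[OF G] Q'(1) card by auto
    then have "\<not> verts G - insert b Q' \<subseteq> {a}" using card_mono[of "{a}" "verts G - insert b Q'"] by auto
    then obtain z where z: "z \<in> verts G" "z \<notin> insert b Q'" "z \<noteq> a" by blast
    have "a \<in> verts (delete_verts G (insert b Q'))" "z \<in> verts (delete_verts G (insert b Q'))"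
      using ab Q(1) z by (auto simp: Q'_def delete_verts_def)
    then have az: "(a, z) \<in> ?R (insert b Q')" using con by (simp add: connected_graph_def)
    have "b \<in> verts (delete_verts G (insert a Q'))" "z \<in> verts (delete_verts G (insert a Q'))"
      using ab Q(1) z by (auto simp: Q'_def delete_verts_def)
    then have "(z, b) \<in> ?R (insert a Q')" using con by (simp add: connected_graph_def)
    then obtain y where y: "{b, y} \<in> edges G" "y \<notin> insert a Q'" "(z, y) \<in> ?R (insert b (insert a Q'))"
      using last_step_to[of z b G "insert a Q'"] z by blast
    have mono: "?R (insert b (insert a Q')) \<subseteq> ?R (insert b Q')"
      by (intro rtrancl_mono) (auto simp: delete_verts_def)
    have "(a, y) \<in> ?R (insert b Q')" using rtrancl_trans[OF az subsetD[OF mono y(3)]] .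
    moreover have "y \<noteq> a" using y(2) by simp
    ultimately show ?thesis using y(1) unfolding Q'(3) by blast
  qed
qed

text \<open>The paths of a fan from \<open>a\<close> to neighbours of \<open>b\<close> are prolonged
  by \<open>b\<close>, and the edge between \<open>a\<close> and \<open>b\<close> is added as a path
  where it exists.\<close>

theorem menger_bundle:
  assumes G: "finite_simple_graph G" and ab: "a \<in> verts G" "b \<in> verts G" "a \<noteq> b"
    and k: "k \<le> connectivity G" "k \<ge> 1"
  shows "\<exists>\<P>. finite \<P> \<and> card \<P> = k \<and> path_system (edges G) a b \<P>"
proof -
  let ?E = "edges G"
  define E' where "E' = edges (delete_verts G {b})"
  define B where "B = nbrs ?E b - {a}"
  define m where "m = (if {a, b} \<in> ?E then k - 1 else k)"
  have E'V: "\<And>e. e \<in> E' \<Longrightarrow> e \<subseteq> verts G - {b}"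
    using finite_simple_graphD(3)[OF G] by (auto simp: E'_def delete_verts_def)
  have BV: "B \<subseteq> verts G - {b}" using nbrs_simple[OF G, of b] by (auto simp: B_def)
  have "\<exists>xs. gpath E' xs \<and> hd xs = a \<and> last xs \<in> B \<and> set xs \<inter> Q = {}"
    if Q: "a \<notin> Q" "finite Q" "card Q < m" for Q
  proof -
    obtain y where y: "{b, y} \<in> ?E" "y \<noteq> a" "(a, y) \<in> reach (edges (delete_verts G (insert b Q)))"
      using menger_separators[OF G ab Q[unfolded m_def] k(1)] by blast
    obtain xs where xs: "gpath (edges (delete_verts G (insert b Q))) xs" "hd xs = a" "last xs = y"
      using rtrancl_gpath[OF y(3)] .
    have "set xs \<subseteq> verts G - insert b Q"
      using finite_simple_graphD(3)[OF G] ab Q(1) xs(2)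
      by (intro gpath_subset[OF xs(1)]) (auto simp: delete_verts_def)
    moreover have "gpath E' xs" using xs(1) by (rule gpath_mono) (auto simp: E'_def delete_verts_def)
    ultimately show ?thesis using xs y by (intro exI[of _ xs]) (auto simp: B_def nbrs_def)
  qed
  then have "\<exists>W F. card W = m \<and> fan E' a B W F"
    using finite_simple_graphD(1)[OF G] E'V BV
    by (intro fan_exists[of "verts G - {b}"]) (auto simp: B_def)
  then obtain W F where W: "card W = m" "fan E' a B W F" by blast
  have finW: "finite W"
    using W(2) BV finite_simple_graphD(1)[OF G] by (meson fan_def finite_Diff finite_subset)
  have WB: "W \<subseteq> B" using W(2) by (simp add: fan_def)
  have F: "gpath E' (F w)" "hd (F w) = a" "last (F w) = w" if "w \<in> W" for w
    using W(2) that by (simp_all add: fan_def)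
  have F2: "set (F w) \<inter> set (F w') = {a}" if "w \<in> W" "w' \<in> W" "w \<noteq> w'" for w w'
    using W(2) that by (simp add: fan_def)
  have bF: "b \<notin> set (F w)" if "w \<in> W" for w
    using gpath_subset[OF F(1)[OF that] E'V] F(2)[OF that] ab by auto
  define P where "P w = F w @ [b]" for w
  have Fne: "F w \<noteq> []" if "w \<in> W" for w using F(1)[OF that] by (simp add: gpath_def)
  have ledgesP: "ledges (P w) = insert {w, b} (ledges (F w))" if "w \<in> W" for w
    unfolding P_def using ledges_snoc[OF Fne[OF that], of b] F(3)[OF that] by simp
  have "E' \<subseteq> ?E" by (auto simp: E'_def delete_verts_def)
  then have P: "gpath ?E (P w)" "hd (P w) = a" "last (P w) = b" if "w \<in> W" for w
  proof -
    have "{w, b} \<in> ?E" using WB that by (auto simp: B_def nbrs_def insert_commute)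
    then show "gpath ?E (P w)"
      using F(1)[OF that] bF[OF that] ledgesP[OF that] \<open>E' \<subseteq> ?E\<close> by (auto simp: gpath_def P_def)
  qed (use F Fne that in \<open>simp_all add: P_def\<close>)
  have abP: "{a, b} \<notin> ledges (P w)" if "w \<in> W" for w
    using ledgesP[OF that] ledges_subset[of "{a, b}" "F w"] bF[OF that] WB that ab(3)
    by (auto simp: B_def doubleton_eq_iff)
  \<comment> \<open>A common edge of two paths that meet only in \<open>a\<close> and
    \<open>b\<close> could only join \<open>a\<close> to \<open>b\<close>.\<close>
  have ledges_disj: "ledges p \<inter> ledges q = {}"
    if "set p \<inter> set q = {a, b}" "{a, b} \<notin> ledges p" "distinct p" for p q
  proof (rule ccontr)
    assume "ledges p \<inter> ledges q \<noteq> {}"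
    then obtain e where e: "e \<in> ledges p" "e \<in> ledges q" by blast
    then have "e \<subseteq> {a, b}" "card e = 2" using ledges_subset ledges_card that by (metis le_inf_iff)+
    then have "e = {a, b}" using ab(3) by (metis card_2_iff card_subset_eq finite.emptyI finite.insertI)
    with e that show False by simp
  qed
  have PP: "set (P w) \<inter> set (P w') = {a, b}" if "w \<in> W" "w' \<in> W" "w \<noteq> w'" for w w'
    using F2[OF that] bF that by (auto simp: P_def)
  define D where "D = (if {a, b} \<in> ?E then {[a, b]} else {})"
  have D: "p = [a, b]" "{a, b} \<in> ?E" if "p \<in> D" for p using that by (auto simp: D_def split: if_splits)
  have injP: "inj_on P W" using F(3) by (auto simp: inj_on_def P_def) metis
  have disj: "P ` W \<inter> D = {}"
  proof (rule ccontr)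
    assume "P ` W \<inter> D \<noteq> {}"
    then obtain w where w: "w \<in> W" "P w = [a, b]" using D by blast
    then have "F w = [a]" by (simp add: P_def)
    then show False using F(3)[OF w(1)] w(1) WB by (auto simp: B_def)
  qed
  have "card (P ` W \<union> D) = card W + card D"
    using disj finW injP by (subst card_Un_disjoint) (auto simp: D_def card_image)
  also have "\<dots> = k" using W(1) k(2) by (simp add: m_def D_def)
  finally have "card (P ` W \<union> D) = k" .
  moreover have "path_system ?E a b (P ` W \<union> D)"
    unfolding path_system_def
  proof (intro conjI ballI impI)
    fix p assume "p \<in> P ` W \<union> D"
    then have "gpath ?E p \<and> hd p = a \<and> last p = b"
    proof
      assume "p \<in> D"
      then show ?thesis using D[of p] ab by (auto simp: gpath_def)
    qed (use P in auto)
    then show "gpath ?E p" "hd p = a" "last p = b" by auto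
  next
    fix p q assume pq: "p \<in> P ` W \<union> D" "q \<in> P ` W \<union> D" "p \<noteq> q"
    have dist: "distinct (P w)" if "w \<in> W" for w using P(1)[OF that] by (simp add: gpath_def)
    have PD: "set (P w) \<inter> set [a, b] = {a, b}" if "w \<in> W" for w
    proof -
      have "a \<in> set (P w)" "b \<in> set (P w)"
        using gpath_hd[OF P(1)[OF that]] gpath_last[OF P(1)[OF that]] P(2,3)[OF that] by simp_all
      then show ?thesis by auto
    qed
    have "(p \<in> P ` W \<and> q \<in> P ` W) \<or> (p \<in> P ` W \<and> q \<in> D) \<or> (q \<in> P ` W \<and> p \<in> D)"
      using pq(1,2) D(1)[of p] D(1)[of q] pq(3) by auto
    then consider w w' where "w \<in> W" "w' \<in> W" "p = P w" "q = P w'" "w \<noteq> w'"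
      | w where "w \<in> W" "p = P w" "q = [a, b]" | w where "w \<in> W" "q = P w" "p = [a, b]"
    proof (elim disjE conjE imageE)
      fix w w' assume "p = P w" "w \<in> W" "q = P w'" "w' \<in> W"
      then show thesis using that(1)[of w w'] pq(3) by auto
    next
      fix w assume "q \<in> D" "p = P w" "w \<in> W"
      then show thesis using that(2)[of w] D(1)[of q] by simp
    next
      fix w assume "p \<in> D" "q = P w" "w \<in> W"
      then show thesis using that(3)[of w] D(1)[of p] by simp
    qed
    then have "set p \<inter> set q = {a, b} \<and> ledges p \<inter> ledges q = {}"
    proof cases
      case (1 w w')
      have "set p \<inter> set q = {a, b}" using PP[OF 1(1,2,5)] 1(3,4) by simp
      with ledges_disj[OF this] abP[OF 1(1)] dist[OF 1(1)] 1(3) show ?thesis by simp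
    next
      case (2 w)
      have "set p \<inter> set q = {a, b}" using PD[OF 2(1)] 2(2,3) by simp
      with ledges_disj[OF this] abP[OF 2(1)] dist[OF 2(1)] 2(2) show ?thesis by simp
    next
      case (3 w)
      have "set q \<inter> set p = {a, b}" using PD[OF 3(1)] 3(2,3) by simp
      with ledges_disj[OF this] abP[OF 3(1)] dist[OF 3(1)] 3(2) show ?thesis by (simp add: Int_commute)
    qed
    then show "set p \<inter> set q = {a, b}" "ledges p \<inter> ledges q = {}" by auto
  qed
  ultimately show ?thesis using finW by (intro exI[of _ "P ` W \<union> D"]) (auto simp: D_def)
qed

section \<open>The lower bound\<close>

lemma fan_restrict:
  assumes fan: "fan E c B W F" and sub: "W' \<subseteq> W" "W' \<subseteq> B'" "B' \<subseteq> B"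
  shows "fan E c B' W' F"
proof -
  have F: "gpath E (F w) \<and> hd (F w) = c \<and> last (F w) = w \<and> set (F w) \<inter> B = {w}" if "w \<in> W'" for w
    using fan that sub(1) by (auto simp: fan_def)
  have "set (F w) \<inter> B' = {w}" if "w \<in> W'" for w
    using F[OF that] that sub(2,3) by auto
  moreover have "c \<notin> B'" using fan sub(3) by (auto simp: fan_def)
  moreover have "set (F w) \<inter> set (F w') = {c}" if "w \<in> W'" "w' \<in> W'" "w \<noteq> w'" for w w'
    using fan subsetD[OF sub(1) that(1)] subsetD[OF sub(1) that(2)] that(3) by (simp add: fan_def)
  ultimately show ?thesis using F sub(2) by (simp add: fan_def)
qed

text \<open>\<open>\<P>\<close> may have one path fewer than \<open>k\<close>. This makes room for
  the case that \<open>c\<close> lies on a path of the bundle, which is then taken out of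
  \<open>\<P>\<close>.\<close>

locale path_system_setting =
  fixes G :: "'a graph" and a b c :: 'a and \<P> :: "'a list set" and k :: nat
  assumes simple: "finite_simple_graph G"
    and abc: "a \<in> verts G" "b \<in> verts G" "c \<in> verts G" "a \<noteq> b" "a \<noteq> c" "b \<noteq> c"
    and fin\<P>: "finite \<P>" and sys: "path_system (edges G) a b \<P>"
    and c_notin: "\<And>P. P \<in> \<P> \<Longrightarrow> c \<notin> set P"
    and k_le: "k \<le> connectivity G" "k \<le> card \<P> + 1"
begin

abbreviation E :: "'a set set" where "E \<equiv> edges G"

definition T :: "'a set" where "T = {a, b} \<union> \<Union> (set ` \<P>)"

text \<open>The vertices strictly between two fan ends on the same path; the fan may use them freely.\<close>

definition inner :: "'a set \<Rightarrow> 'a set" where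
  "inner W = {v. \<exists>P\<in>\<P>. \<exists>i j l. i < j \<and> j < l \<and> l < length P \<and>
     P ! i \<in> W - {a, b} \<and> P ! j = v \<and> P ! l \<in> W - {a, b}}"

text \<open>The target of the fan depends on the fan's own ends. Fan paths may run through the part
  between two ends on a path, while the segments used for the trees stay inside the target.\<close>

definition outer :: "'a set \<Rightarrow> 'a set" where "outer W = T - inner W"

lemma path:
  assumes "P \<in> \<P>"
  shows "gpath E P" "distinct P" "P \<noteq> []" "P ! 0 = a" "P ! (length P - 1) = b" "length P \<ge> 2"
    "a \<in> set P" "b \<in> set P" "ledges P \<subseteq> E"
proof -
  show *: "gpath E P" using assms sys by (simp add: path_system_def)
  then show d: "distinct P" "P \<noteq> []" "ledges P \<subseteq> E" by (auto simp: gpath_def)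
  have "hd P = a" "last P = b" using assms sys by (simp_all add: path_system_def)
  then show 0: "P ! 0 = a" "P ! (length P - 1) = b" using d by (simp_all add: hd_conv_nth last_conv_nth)
  then show "length P \<ge> 2" using d(2) abc(4) by (cases P; cases "tl P") auto
  show "a \<in> set P" "b \<in> set P" using \<open>hd P = a\<close> \<open>last P = b\<close> gpath_hd[OF *] gpath_last[OF *] by simp_all
qed

lemma path_ends:
  assumes "P \<in> \<P>" "i < length P"
  shows "P ! i = a \<longleftrightarrow> i = 0" "P ! i = b \<longleftrightarrow> i = length P - 1"
  using path[OF assms(1)] assms(2) nth_eq_iff_index_eq[of P i 0] nth_eq_iff_index_eq[of P i "length P - 1"]
  by auto

lemma path_disjoint:
  assumes "P \<in> \<P>" "P' \<in> \<P>" "P \<noteq> P'"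
  shows "set P \<inter> set P' = {a, b}" "ledges P \<inter> ledges P' = {}"
  using assms sys by (simp_all add: path_system_def)

lemma path_unique:
  assumes "P \<in> \<P>" "P' \<in> \<P>" "i < length P" "j < length P'" "P ! i = P' ! j" "P ! i \<notin> {a, b}"
  shows "P' = P \<and> j = i"
proof -
  have "P' = P"
  proof (rule ccontr)
    assume "P' \<noteq> P"
    moreover have "P ! i \<in> set P" "P ! i \<in> set P'" using nth_mem[OF assms(3)] nth_mem[OF assms(4)] assms(5) by simp_all
    ultimately show False using path_disjoint(1)[OF assms(1,2)] assms(6) by blast
  qed
  then show ?thesis using assms path(2) nth_eq_iff_index_eq[of P i j] by auto
qed

lemma inner_iff:
  assumes "P \<in> \<P>" "j < length P"
  shows "P ! j \<in> inner W \<longleftrightarrow>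
    (\<exists>i l. i < j \<and> j < l \<and> l < length P \<and> P ! i \<in> W - {a, b} \<and> P ! l \<in> W - {a, b})"
proof
  assume "P ! j \<in> inner W"
  then obtain P' i' j' l' where *: "P' \<in> \<P>" "i' < j'" "j' < l'" "l' < length P'"
    "P' ! i' \<in> W - {a, b}" "P' ! j' = P ! j" "P' ! l' \<in> W - {a, b}"
    unfolding inner_def by blast
  have "P' ! j' \<notin> {a, b}" using path_ends[OF *(1), of j'] * by auto
  then have "P' = P \<and> j' = j" using path_unique[of P P' j j'] * assms by auto
  with * show "\<exists>i l. i < j \<and> j < l \<and> l < length P \<and> P ! i \<in> W - {a, b} \<and> P ! l \<in> W - {a, b}" by blast
next
  assume "\<exists>i l. i < j \<and> j < l \<and> l < length P \<and> P ! i \<in> W - {a, b} \<and> P ! l \<in> W - {a, b}"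
  with assms show "P ! j \<in> inner W" unfolding inner_def by blast
qed

lemma inner_ends: "a \<notin> inner W" "b \<notin> inner W"
proof -
  have "P ! j \<notin> {a, b}" if "P \<in> \<P>" "i < j" "j < l" "l < length P" for P i j l
    using path_ends[OF that(1), of j] that by auto
  then show "a \<notin> inner W" "b \<notin> inner W" unfolding inner_def by blast+
qed

lemma T_verts: "T \<subseteq> verts G" "c \<notin> T"
proof -
  have "set P \<subseteq> verts G" if "P \<in> \<P>" for P
  proof (rule gpath_subset[OF path(1)[OF that]])
    show "hd P \<in> verts G" using path[OF that] abc(1) by (metis hd_conv_nth)
  qed (use finite_simple_graphD(3)[OF simple] in blast)
  then show "T \<subseteq> verts G" "c \<notin> T" using abc c_notin by (auto simp: T_def)
qed

lemma outer_sub: "outer W \<subseteq> T" by (auto simp: outer_def)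

lemma finite_outer: "finite (outer W)"
  using outer_sub[of W] T_verts(1) finite_simple_graphD(1)[OF simple] by (meson finite_subset)

lemma outer_ends: "a \<in> outer W" "b \<in> outer W"
  using inner_ends by (auto simp: outer_def T_def)

text \<open>Nothing precedes the second vertex of a path except \<open>a\<close>, which does not
  count as a flanking end; hence second vertices, like \<open>a\<close>, never become inner. Two
  paths with the same second vertex would both be \<open>[a, b]\<close>. So fewer than
  \<open>k\<close> vertices never cover the target, as augmentation requires.\<close>

lemma card_outer: "k \<le> card (outer W)"
proof -
  have second: "P ! 1 \<in> outer W \<and> P ! 1 \<noteq> a" if "P \<in> \<P>" for P
  proof -
    have len: "1 < length P" using path(6)[OF that] by simp
    have "P ! 1 \<noteq> a" using path_ends(1)[OF that len] by simp
    moreover have "P ! 1 \<notin> inner W" using inner_iff[OF that len, of W] path(4)[OF that] by auto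
    moreover have "P ! 1 \<in> T" using that nth_mem[OF len] by (auto simp only: T_def)
    ultimately show ?thesis by (simp add: outer_def)
  qed
  have "inj_on (\<lambda>P. P ! 1) \<P>"
  proof (rule inj_onI, rule ccontr)
    fix P P' assume P: "P \<in> \<P>" "P' \<in> \<P>" "P ! 1 = P' ! 1" "P \<noteq> P'"
    have len: "1 < length P" "1 < length P'" using path(6) P(1,2) by force+
    have "P ! 1 = b"
    proof (rule ccontr)
      assume "P ! 1 \<noteq> b"
      then have "P ! 1 \<notin> {a, b}" using second[OF P(1)] by simp
      from path_unique[OF P(1,2) len P(3) this] P(4) show False by simp
    qed
    then have "length P = 2" "length P' = 2"
      using path_ends(2)[OF P(1) len(1)] path_ends(2)[OF P(2) len(2)] P(3) len by auto
    then have "P = [P ! 0, P ! 1]" "P' = [P' ! 0, P' ! 1]"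
      by (auto simp: list_eq_iff_nth_eq less_2_cases_iff)
    then show False using P path(4) by metis
  qed
  then have "card ((\<lambda>P. P ! 1) ` \<P>) = card \<P>" by (rule card_image)
  moreover have "a \<notin> (\<lambda>P. P ! 1) ` \<P>" using second by blast
  ultimately have "card (insert a ((\<lambda>P. P ! 1) ` \<P>)) = card \<P> + 1" using fin\<P> by simp
  moreover have "insert a ((\<lambda>P. P ! 1) ` \<P>) \<subseteq> outer W" using second outer_ends by auto
  then have "card (insert a ((\<lambda>P. P ! 1) ` \<P>)) \<le> card (outer W)" by (rule card_mono[OF finite_outer])
  ultimately show ?thesis using k_le(2) by linarith
qed

text \<open>The middle one of three ends on a path would be inner and thus outside the
  target.\<close>

lemma no_three:
  assumes "W \<subseteq> outer W" "P \<in> \<P>" "i < length P" "j < length P" "l < length P" "i \<noteq> j" "j \<noteq> l" "i \<noteq> l"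
    "P ! i \<in> W - {a, b}" "P ! j \<in> W - {a, b}" "P ! l \<in> W - {a, b}"
  shows False
proof -
  have *: False if "i < j" "j < l" "l < length P" "P ! i \<in> W - {a, b}" "P ! j \<in> W - {a, b}" "P ! l \<in> W - {a, b}" for i j l
  proof -
    have "P ! j \<in> inner W" using inner_iff[OF assms(2), of j W] that by (meson less_trans)
    then show False using that(5) assms(1) by (auto simp: outer_def)
  qed
  show False using *[of i j l] *[of i l j] *[of j i l] *[of j l i] *[of l i j] *[of l j i] assms(3-)
    by (metis linorder_neqE_nat)
qed

text \<open>If after augmentation no end is flanked by two others, the fan has grown. Otherwise an
  old end \<open>x\<close> lies between the new end \<open>t\<close> and another one;
  \<open>x\<close> is dropped, and the target loses at least \<open>x\<close>. As \<open>a\<close>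
  and \<open>b\<close> are never inner, they are never dropped.\<close>

lemma fan_to_outer_step:
  assumes fan: "fan E c (outer W) W F" and card: "card W < k"
  shows "\<exists>W' F'. fan E c (outer W') W' F' \<and> W \<inter> {a, b} \<subseteq> W' \<and>
    (outer W' \<subset> outer W \<or> outer W' \<subseteq> outer W \<and> card W' = Suc (card W))"
proof -
  have WB: "W \<subseteq> outer W" using fan by (simp add: fan_def)
  then have finW: "finite W" using finite_outer by (rule finite_subset)
  have "\<exists>xs. gpath E xs \<and> hd xs = c \<and> last xs \<in> outer W \<and> set xs \<inter> Q = {}"
    if Q: "c \<notin> Q" "finite Q" "card Q \<le> card W" for Q
  proof -
    have "\<not> outer W \<subseteq> Q" using card_mono[OF Q(2), of "outer W"] card_outer[of W] Q(3) card by auto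
    then obtain v where v: "v \<in> outer W" "v \<notin> Q" by blast
    have "connected_graph (delete_verts G Q)"
      using connected_delete_verts(1)[OF simple Q(2)] Q(3) card k_le(1) by simp
    moreover have "v \<in> verts (delete_verts G Q)" "c \<in> verts (delete_verts G Q)"
      using v Q(1) abc(3) outer_sub T_verts(1) by (auto simp: delete_verts_def)
    ultimately have "(c, v) \<in> reach (edges (delete_verts G Q))"
      by (simp add: connected_graph_def)
    then obtain xs where xs: "gpath (edges (delete_verts G Q)) xs" "hd xs = c" "last xs = v"
      by (rule rtrancl_gpath)
    have "set xs \<subseteq> verts G - Q"
      using finite_simple_graphD(3)[OF simple] abc(3) Q(1) xs(2)
      by (intro gpath_subset[OF xs(1)]) (auto simp: delete_verts_def)
    moreover have "gpath E xs" using xs(1) by (rule gpath_mono) (auto simp: delete_verts_def)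
    ultimately show ?thesis using xs v by blast
  qed
  then have "\<exists>t F'. t \<in> outer W - W \<and> fan E c (outer W) (insert t W) F'"
    using outer_sub[of W] T_verts(1)
    by (intro fan_augment[OF finite_simple_graphD(1)[OF simple] finite_simple_graphD(3)[OF simple] _ fan]) auto
  then obtain t F' where t: "t \<in> outer W" "t \<notin> W" and F': "fan E c (outer W) (insert t W) F'" by blast
  let ?W = "insert t W"
  have mono: "inner W \<subseteq> inner ?W" unfolding inner_def by blast
  show ?thesis
  proof (cases "?W \<subseteq> outer ?W")
    case True
    have "outer ?W \<subseteq> outer W" using mono by (auto simp: outer_def)
    moreover have "fan E c (outer ?W) ?W F'" using F' True calculation by (intro fan_restrict[OF F']) auto
    moreover have "card ?W = Suc (card W)" using finW t(2) by simp
    ultimately show ?thesis by blast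
  next
    case False
    then obtain x where x: "x \<in> ?W" "x \<notin> outer ?W" by blast
    have "x \<in> T" using x(1) t WB outer_sub by blast
    then have "x \<in> inner ?W" using x(2) by (simp add: outer_def)
    then obtain P i j l where P: "P \<in> \<P>" "i < j" "j < l" "l < length P"
      "P ! i \<in> ?W - {a, b}" "P ! j = x" "P ! l \<in> ?W - {a, b}"
      unfolding inner_def by blast
    have jl: "j < length P" "i < length P" using P by auto
    have ij: "P ! i \<noteq> x" "P ! l \<noteq> x"
      using nth_eq_iff_index_eq[OF path(2)[OF P(1)]] P jl by auto
    have xab: "x \<notin> {a, b}" using path_ends[OF P(1) jl(1)] P by auto
    have xt: "x \<noteq> t"
    proof
      assume "x = t"
      then have "P ! i \<in> W - {a, b}" "P ! l \<in> W - {a, b}" using P ij by auto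
      then have "x \<in> inner W" using inner_iff[OF P(1) jl(1), of W] P by auto
      then show False using \<open>x = t\<close> t(1) by (simp add: outer_def)
    qed
    then have xW: "x \<in> W" using x(1) by simp
    \<comment> \<open>Two old flanking ends would make three ends of \<open>W\<close> on
      \<open>P\<close> together with \<open>x\<close>.\<close>
    have tP: "t = P ! i \<or> t = P ! l"
    proof (rule ccontr)
      assume "\<not> (t = P ! i \<or> t = P ! l)"
      then have "P ! i \<in> W - {a, b}" "P ! l \<in> W - {a, b}" using P by auto
      then show False using no_three[OF WB P(1) jl(2,1) P(4)] P xW xab by auto
    qed
    then have tab: "t \<notin> {a, b}" using P by auto
    obtain m where m: "m < length P" "t = P ! m" using tP P jl by blast
    define W2 where "W2 = ?W - {x}"
    \<comment> \<open>Where \<open>x\<close> served as a flank, \<open>P ! i\<close> or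
      \<open>P ! l\<close> lies further out and takes over.\<close>
    have "inner W \<subseteq> inner W2"
    proof
      fix v assume "v \<in> inner W"
      then obtain P' i' j' l' where P': "P' \<in> \<P>" "i' < j'" "j' < l'" "l' < length P'"
        "P' ! i' \<in> W - {a, b}" "P' ! j' = v" "P' ! l' \<in> W - {a, b}"
        unfolding inner_def by blast
      have len: "i' < length P'" "j' < length P'" using P' by auto
      have "\<exists>i'' < j'. P' ! i'' \<in> W2 - {a, b}"
      proof (cases "P' ! i' = x")
        case True
        then have "P' = P \<and> i' = j" using path_unique[OF P(1) P'(1) jl(1) len(1)] P(6) xab by simp
        then show ?thesis using P P' ij by (intro exI[of _ i]) (auto simp: W2_def)
      qed (use P' W2_def in auto)
      moreover have "\<exists>l'' > j'. l'' < length P' \<and> P' ! l'' \<in> W2 - {a, b}"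
      proof (cases "P' ! l' = x")
        case True
        then have "P' = P \<and> l' = j" using path_unique[OF P(1) P'(1) jl(1) P'(4)] P(6) xab by simp
        then show ?thesis using P P' ij by (intro exI[of _ l]) (auto simp: W2_def)
      qed (use P' W2_def in auto)
      ultimately show "v \<in> inner W2" using inner_iff[OF P'(1) len(2), of W2] P'(6) by blast
    qed
    moreover have "x \<in> inner W2"
      using inner_iff[OF P(1) jl(1), of W2] P ij by (auto simp: W2_def)
    moreover have "x \<in> outer W" using xW WB by blast
    ultimately have psub: "outer W2 \<subset> outer W" by (auto simp: outer_def)
    \<comment> \<open>Three ends of \<open>W2\<close> on one path would include \<open>t\<close> and
      so lie on \<open>P\<close>; the other two and \<open>x\<close> would then be three ends of
      \<open>W\<close> there.\<close>
    have "W2 \<inter> inner W2 = {}"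
    proof (rule ccontr)
      assume "W2 \<inter> inner W2 \<noteq> {}"
      then obtain P' i' j' l' where P': "P' \<in> \<P>" "i' < j'" "j' < l'" "l' < length P'"
        "P' ! i' \<in> W2 - {a, b}" "P' ! j' \<in> W2" "P' ! l' \<in> W2 - {a, b}"
        unfolding inner_def by blast
      have len: "i' < length P'" "j' < length P'" using P' by auto
      have jab: "P' ! j' \<notin> {a, b}" using path_ends[OF P'(1) len(2)] P' by auto
      have "\<not> (P' ! i' \<in> W \<and> P' ! j' \<in> W \<and> P' ! l' \<in> W)"
        using no_three[OF WB P'(1) len P'(4)] P' jab by auto
      then have "t \<in> {P' ! i', P' ! j', P' ! l'}" using P' by (auto simp: W2_def)
      then obtain m' where m': "m' \<in> {i', j', l'}" "t = P' ! m'" by blast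
      have "m' < length P'" using m' len P' by auto
      then have PP: "P' = P" "m' = m" using path_unique[OF P(1) P'(1) m(1)] m(2) m'(2) tab by auto
      have xj: "i' \<noteq> j" "j' \<noteq> j" "l' \<noteq> j" using P' P(6) PP by (auto simp: W2_def)
      have idx: "P ! n \<in> W - {a, b}" if "n \<in> {i', j', l'}" "n \<noteq> m" for n
      proof -
        have n: "n < length P" using that len P' PP by auto
        then have "P ! n \<noteq> t" using nth_eq_iff_index_eq[OF path(2)[OF P(1)] n m(1)] that m by auto
        then show ?thesis using that P' jab PP by (auto simp: W2_def)
      qed
      have jW: "P ! j \<in> W - {a, b}" using P(6) xW xab by simp
      have "\<exists>n n'. n \<in> {i', j', l'} \<and> n' \<in> {i', j', l'} \<and> n \<noteq> n' \<and> n \<noteq> m \<and> n' \<noteq> m"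
        using m'(1) P' PP by fastforce
      then obtain n n' where n: "n \<in> {i', j', l'}" "n' \<in> {i', j', l'}" "n \<noteq> n'" "n \<noteq> m" "n' \<noteq> m" by blast
      have "n < length P" "n' < length P" using n len P' PP by auto
      then show False using no_three[OF WB P(1) _ _ jl(1), of n n'] n xj idx[of n] idx[of n'] jW by auto
    qed
    moreover have "W2 \<subseteq> T" using t WB outer_sub by (auto simp: W2_def)
    ultimately have W2B: "W2 \<subseteq> outer W2" by (auto simp: outer_def)
    have "fan E c (outer W2) W2 F'"
      using psub W2B by (intro fan_restrict[OF F']) (auto simp: W2_def)
    moreover have "W \<inter> {a, b} \<subseteq> W2" using xab by (auto simp: W2_def)
    ultimately show ?thesis using psub by blast
  qed
qed

text \<open>A step that does not shrink the target keeps it from growing and adds an end, so the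
  size of the target and the number of missing ends decrease lexicographically.\<close>

lemma fan_to_outer:
  assumes "fan E c (outer W) W F"
  shows "\<exists>W' F'. fan E c (outer W') W' F' \<and> W \<inter> {a, b} \<subseteq> W' \<and> k \<le> card W'"
  using assms
proof (induction W arbitrary: F rule: wf_induct_rule[OF wf_measures[of "[\<lambda>W. card (outer W), \<lambda>W. k - card W]"]])
  case (1 W)
  show ?case
  proof (cases "card W < k")
    case False
    then show ?thesis using "1.prems" by (intro exI[of _ W] exI[of _ F]) auto
  next
    case True
    obtain W' F' where W': "fan E c (outer W') W' F'" "W \<inter> {a, b} \<subseteq> W'"
      and less: "outer W' \<subset> outer W \<or> outer W' \<subseteq> outer W \<and> card W' = Suc (card W)"
      using fan_to_outer_step[OF "1.prems" True] by blast
    have "card (outer W') < card (outer W) \<or> card (outer W') \<le> card (outer W) \<and> k - card W' < k - card W"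
      using less True by (auto intro: psubset_card_mono card_mono simp: finite_outer)
    then have "(W', W) \<in> measures [\<lambda>W. card (outer W), \<lambda>W. k - card W]" by auto
    from "1.IH"[OF this W'(1)] W'(2) show ?thesis by blast
  qed
qed

end

section \<open>Pairing connected pieces that hold two terminals each\<close>

definition internally_disjoint :: "'a graph \<Rightarrow> 'a set \<Rightarrow> 'i set \<Rightarrow> ('i \<Rightarrow> 'a graph) \<Rightarrow> ('i \<Rightarrow> 'a set) \<Rightarrow> bool" where
  "internally_disjoint G S I X \<kappa> \<longleftrightarrow> finite I \<and>
     (\<forall>i\<in>I. subgraph (X i) G \<and> connected_graph (X i) \<and> \<kappa> i \<subseteq> verts (X i)) \<and>
     (\<forall>i\<in>I. \<forall>j\<in>I. i \<noteq> j \<longrightarrow> edges (X i) \<inter> edges (X j) = {} \<and> verts (X i) \<inter> verts (X j) \<subseteq> S)"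

text \<open>The label of a piece is the set of terminals it is known to contain; \<open>s\<close>, \<open>\<alpha>\<close>, \<open>\<beta>\<close>, \<open>\<gamma>\<close>
  count the pieces with label \<open>S\<close> and with the three pairs \<open>p\<close>, \<open>q\<close>, \<open>r\<close> of terminals.\<close>

definition packs :: "'a graph \<Rightarrow> 'a set \<Rightarrow> 'a set \<Rightarrow> 'a set \<Rightarrow> 'a set \<Rightarrow> nat \<Rightarrow> nat \<Rightarrow> nat \<Rightarrow> nat \<Rightarrow> bool" where
  "packs G S p q r s \<alpha> \<beta> \<gamma> \<longleftrightarrow>
     (\<exists>(I :: ('a list \<times> 'a set) set) X \<kappa>. internally_disjoint G S I X \<kappa> \<and>
       card {i\<in>I. \<kappa> i = S} = s \<and> card {i\<in>I. \<kappa> i = p} = \<alpha> \<and>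
       card {i\<in>I. \<kappa> i = q} = \<beta> \<and> card {i\<in>I. \<kappa> i = r} = \<gamma>)"

lemma packs_rotate: "packs G S p q r s \<alpha> \<beta> \<gamma> \<Longrightarrow> packs G S q r p s \<beta> \<gamma> \<alpha>"
  unfolding packs_def by blast

text \<open>Pieces for two different pairs share a terminal, so their union is connected and holds
  all of \<open>S\<close>. The union takes over the index \<open>i\<close>, and \<open>j\<close> is
  discarded.\<close>

lemma packs_merge:
  assumes "packs G S p q r s (Suc \<alpha>) (Suc \<beta>) \<gamma>"
    and pq: "p \<inter> q \<noteq> {}" "p \<union> q = S" and dist: "p \<noteq> q" "p \<noteq> r" "q \<noteq> r" "S \<notin> {p, q, r}"
  shows "packs G S p q r (Suc s) \<alpha> \<beta> \<gamma>"
proof -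
  obtain I :: "('a list \<times> 'a set) set" and X \<kappa> where fam: "internally_disjoint G S I X \<kappa>"
    and card: "card {i\<in>I. \<kappa> i = S} = s" "card {i\<in>I. \<kappa> i = p} = Suc \<alpha>"
       "card {i\<in>I. \<kappa> i = q} = Suc \<beta>" "card {i\<in>I. \<kappa> i = r} = \<gamma>"
    using assms(1) unfolding packs_def by blast
  have fin: "finite I" using fam by (simp add: internally_disjoint_def)
  have X: "subgraph (X i) G \<and> connected_graph (X i) \<and> \<kappa> i \<subseteq> verts (X i)" if "i \<in> I" for i
    using fam that by (simp add: internally_disjoint_def)
  have pair: "edges (X i) \<inter> edges (X j) = {} \<and> verts (X i) \<inter> verts (X j) \<subseteq> S"
    if "i \<in> I" "j \<in> I" "i \<noteq> j" for i j
    using fam that by (simp add: internally_disjoint_def)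
  have "{i\<in>I. \<kappa> i = p} \<noteq> {}" "{i\<in>I. \<kappa> i = q} \<noteq> {}" using card(2,3) by (metis card.empty nat.distinct(1))+
  then obtain i j where i: "i \<in> I" "\<kappa> i = p" and j: "j \<in> I" "\<kappa> j = q" by blast
  have ij: "i \<noteq> j" using i j dist by auto
  define Y where "Y = Graph (verts (X i) \<union> verts (X j)) (edges (X i) \<union> edges (X j))"
  define X' where "X' = X(i := Y)"
  define \<kappa>' where "\<kappa>' = \<kappa>(i := S)"
  define I' where "I' = I - {j}"
  have sub: "p \<subseteq> verts (X i)" "q \<subseteq> verts (X j)" using X[OF i(1)] X[OF j(1)] i j by auto
  have Y: "subgraph Y G \<and> connected_graph Y \<and> S \<subseteq> verts Y"
  proof (intro conjI)
    show "subgraph Y G"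
      using X[OF i(1)] X[OF j(1)] by (auto simp: Y_def subgraph_def finite_simple_graph_def)
    show "connected_graph Y" unfolding Y_def
      using X[OF i(1)] X[OF j(1)] sub pq(1) by (intro connected_graph_union) auto
    show "S \<subseteq> verts Y" using sub pq(2) by (auto simp: Y_def)
  qed
  have Ypair: "edges Y \<inter> edges (X l) = {} \<and> verts Y \<inter> verts (X l) \<subseteq> S" if "l \<in> I'" "l \<noteq> i" for l
    using pair[OF i(1), of l] pair[OF j(1), of l] that by (auto simp: Y_def I'_def)
  have "{l\<in>I'. \<kappa>' l = S} = insert i {l\<in>I. \<kappa> l = S}" "i \<notin> {l\<in>I. \<kappa> l = S}"
    using i j ij dist by (auto simp: I'_def \<kappa>'_def)
  then have c0: "card {l\<in>I'. \<kappa>' l = S} = Suc s" using card(1) fin by simp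
  have "{l\<in>I'. \<kappa>' l = p} = {l\<in>I. \<kappa> l = p} - {i}" using i j ij dist by (auto simp: I'_def \<kappa>'_def)
  then have c1: "card {l\<in>I'. \<kappa>' l = p} = \<alpha>" using card(2) i by simp
  have "{l\<in>I'. \<kappa>' l = q} = {l\<in>I. \<kappa> l = q} - {j}" using i j ij dist by (auto simp: I'_def \<kappa>'_def)
  then have c2: "card {l\<in>I'. \<kappa>' l = q} = \<beta>" using card(3) j by simp
  have "{l\<in>I'. \<kappa>' l = r} = {l\<in>I. \<kappa> l = r}" using i j ij dist by (auto simp: I'_def \<kappa>'_def)
  then have c3: "card {l\<in>I'. \<kappa>' l = r} = \<gamma>" using card(4) by simp
  have "subgraph (X' l) G \<and> connected_graph (X' l) \<and> \<kappa>' l \<subseteq> verts (X' l)" if "l \<in> I'" for l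
    using X[of l] Y that by (cases "l = i") (auto simp: X'_def \<kappa>'_def I'_def)
  moreover have "edges (X' l) \<inter> edges (X' m) = {} \<and> verts (X' l) \<inter> verts (X' m) \<subseteq> S"
    if lm: "l \<in> I'" "m \<in> I'" "l \<noteq> m" for l m
  proof -
    consider "l = i" "m \<noteq> i" | "m = i" "l \<noteq> i" | "l \<noteq> i" "m \<noteq> i" using lm(3) by blast
    then show ?thesis
    proof cases
      case 1 then show ?thesis using Ypair[of m] lm by (simp add: X'_def)
    next
      case 2 then show ?thesis using Ypair[of l] lm by (simp add: X'_def Int_commute)
    next
      case 3 then show ?thesis using pair[of l m] lm by (simp add: X'_def I'_def)
    qed
  qed
  ultimately have "internally_disjoint G S I' X' \<kappa>'"
    using fin by (simp add: internally_disjoint_def I'_def)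
  then show ?thesis unfolding packs_def using c0 c1 c2 c3 by blast
qed

lemma packs_trees:
  assumes "packs G S p q r s \<alpha> \<beta> \<gamma>" "finite_simple_graph G" "u \<in> S" "v \<in> S" "u \<noteq> v"
  shows "s \<le> set_connectivity G S"
proof -
  obtain I :: "('a list \<times> 'a set) set" and X \<kappa> where fam: "internally_disjoint G S I X \<kappa>"
    and card: "card {i\<in>I. \<kappa> i = S} = s"
    using assms(1) unfolding packs_def by blast
  have "card {i\<in>I. \<kappa> i = S} \<le> set_connectivity G S"
    using fam by (intro set_connectivity_ge[OF assms(2-5), where X = X]) (auto simp: internally_disjoint_def)
  with card show ?thesis by simp
qed

text \<open>Each round pairs two kinds and spares the rarest one, which keeps the four inequalities
  true. They are also necessary, because every pair uses two pieces and at most one of each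
  kind.\<close>

lemma packs_reduce:
  assumes "packs G S p q r s \<alpha> \<beta> \<gamma>"
    and pqr: "p \<inter> q \<noteq> {}" "p \<union> q = S" "p \<inter> r \<noteq> {}" "p \<union> r = S" "q \<inter> r \<noteq> {}" "q \<union> r = S"
      "p \<noteq> q" "p \<noteq> r" "q \<noteq> r" "S \<notin> {p, q, r}"
    and num: "2 * n \<le> \<alpha> + \<beta> + \<gamma>" "n \<le> \<alpha> + \<beta>" "n \<le> \<alpha> + \<gamma>" "n \<le> \<beta> + \<gamma>"
  shows "\<exists>\<alpha> \<beta> \<gamma>. packs G S p q r (s + n) \<alpha> \<beta> \<gamma>"
  using assms(1) num
proof (induction n arbitrary: s \<alpha> \<beta> \<gamma>)
  case 0
  then show ?case by auto
next
  case (Suc n)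
  consider "\<gamma> \<le> \<alpha>" "\<gamma> \<le> \<beta>" | "\<beta> \<le> \<alpha>" "\<beta> \<le> \<gamma>" | "\<alpha> \<le> \<beta>" "\<alpha> \<le> \<gamma>" by linarith
  then show ?case
  proof cases
    case 1
    then have "\<alpha> \<ge> 1" "\<beta> \<ge> 1" using Suc.prems by linarith+
    then obtain \<alpha>' \<beta>' where eq: "\<alpha> = Suc \<alpha>'" "\<beta> = Suc \<beta>'" by (metis Suc_le_D One_nat_def)
    have "packs G S p q r (Suc s) \<alpha>' \<beta>' \<gamma>"
      using packs_merge[OF Suc.prems(1)[unfolded eq]] pqr by simp
    from Suc.IH[OF this] show ?thesis using Suc.prems(2-) 1 unfolding eq by simp
  next
    case 2
    then have "\<alpha> \<ge> 1" "\<gamma> \<ge> 1" using Suc.prems by linarith+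
    then obtain \<alpha>' \<gamma>' where eq: "\<alpha> = Suc \<alpha>'" "\<gamma> = Suc \<gamma>'" by (metis Suc_le_D One_nat_def)
    have "packs G S r p q s (Suc \<gamma>') (Suc \<alpha>') \<beta>"
      using packs_rotate[OF packs_rotate[OF Suc.prems(1)]] unfolding eq .
    from packs_merge[OF this] have "packs G S r p q (Suc s) \<gamma>' \<alpha>' \<beta>" using pqr by (auto simp: Int_commute Un_commute)
    then have "packs G S p q r (Suc s) \<alpha>' \<beta> \<gamma>'" by (rule packs_rotate)
    from Suc.IH[OF this] show ?thesis using Suc.prems(2-) 2 unfolding eq by simp
  next
    case 3
    then have "\<beta> \<ge> 1" "\<gamma> \<ge> 1" using Suc.prems by linarith+
    then obtain \<beta>' \<gamma>' where eq: "\<beta> = Suc \<beta>'" "\<gamma> = Suc \<gamma>'" by (metis Suc_le_D One_nat_def)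
    have "packs G S q r p s (Suc \<beta>') (Suc \<gamma>') \<alpha>"
      using packs_rotate[OF Suc.prems(1)] unfolding eq .
    from packs_merge[OF this] have "packs G S q r p (Suc s) \<beta>' \<gamma>' \<alpha>" using pqr by auto
    then have "packs G S p q r (Suc s) \<alpha> \<beta>' \<gamma>'" by (rule packs_rotate[OF packs_rotate])
    from Suc.IH[OF this] show ?thesis using Suc.prems(2-) 3 unfolding eq by simp
  qed
qed

text \<open>A common edge would need two common vertices.\<close>

lemma ledges_meet_once:
  assumes "set p \<inter> set q \<subseteq> {x}" "distinct p"
  shows "ledges p \<inter> ledges q = {}"
proof (rule ccontr)
  assume "ledges p \<inter> ledges q \<noteq> {}"
  then obtain e where e: "e \<in> ledges p" "e \<in> ledges q" by blast
  then have "e \<subseteq> {x}" using ledges_subset assms(1) by blast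
  then have "card e \<le> 1" using card_mono[of "{x}" e] by simp
  then show False using ledges_card[OF assms(2) e(1)] by simp
qed

section \<open>Pieces cut from the bundle and the fan\<close>

context path_system_setting
begin

text \<open>A piece is a segment of one of the paths (possibly empty) together with the fan paths ending on it.\<close>

definition piece :: "('a \<Rightarrow> 'a list) \<Rightarrow> 'a list \<times> 'a set \<Rightarrow> 'a graph" where
  "piece F i = Graph (set (fst i) \<union> (\<Union>u\<in>snd i. set (F u))) (ledges (fst i) \<union> (\<Union>u\<in>snd i. ledges (F u)))"

text \<open>The segments lie in the target, which a fan path meets only in its end, and that end is
  on the segment of its own piece. An end \<open>a\<close> or \<open>b\<close> may lie on other
  segments too, but it is a terminal. Two fan paths share only \<open>c\<close>.\<close>

lemma piece_disjoint:
  assumes fan: "fan E c (outer W) W F"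
    and L: "set L \<subseteq> outer W" "set M \<subseteq> outer W" "set L \<inter> set M \<subseteq> {a, b}" "ledges L \<inter> ledges M = {}"
    and U: "U \<subseteq> W" "V \<subseteq> W" "U \<inter> V = {}" "U - {a, b} \<subseteq> set L" "V - {a, b} \<subseteq> set M"
  shows "edges (piece F (L, U)) \<inter> edges (piece F (M, V)) = {}"
    and "verts (piece F (L, U)) \<inter> verts (piece F (M, V)) \<subseteq> {a, b, c}"
proof -
  have F: "gpath E (F w)" "set (F w) \<inter> outer W = {w}" if "w \<in> W" for w
    using fan that by (simp_all add: fan_def)
  have F2: "set (F w) \<inter> set (F w') = {c}" if "w \<in> W" "w' \<in> W" "w \<noteq> w'" for w w'
    using fan that by (simp add: fan_def)
  have FL: "set (F u) \<inter> set K \<subseteq> {u}" if "u \<in> W" "set K \<subseteq> outer W" for u K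
    using F(2)[OF that(1)] that(2) by auto
  have LF: "set L \<inter> set (F v) \<subseteq> {a, b}" if "v \<in> V" for v
  proof -
    have "v \<in> W" using U(2) that by blast
    from FL[OF this L(1)] show ?thesis using U(5) L(3) that by blast
  qed
  have MF: "set (F u) \<inter> set M \<subseteq> {a, b}" if "u \<in> U" for u
  proof -
    have "u \<in> W" using U(1) that by blast
    from FL[OF this L(2)] show ?thesis using U(4) L(3) that by blast
  qed
  have FF: "set (F u) \<inter> set (F v) = {c}" if "u \<in> U" "v \<in> V" for u v
    using F2[of u v] U(1-3) that by auto
  show "verts (piece F (L, U)) \<inter> verts (piece F (M, V)) \<subseteq> {a, b, c}"
  proof
    fix x assume "x \<in> verts (piece F (L, U)) \<inter> verts (piece F (M, V))"
    then have "(x \<in> set L \<or> (\<exists>u\<in>U. x \<in> set (F u))) \<and> (x \<in> set M \<or> (\<exists>v\<in>V. x \<in> set (F v)))"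
      by (simp add: piece_def)
    then show "x \<in> {a, b, c}"
      using L(3) LF MF FF by (elim conjE disjE bexE) blast+
  qed
  have dist: "distinct (F w)" if "w \<in> W" for w using F(1)[OF that] by (simp add: gpath_def)
  have eLF: "ledges (F u) \<inter> ledges K = {}" if "u \<in> W" "set K \<subseteq> outer W" for u K
    using FL[OF that] dist[OF that(1)] by (rule ledges_meet_once)
  have eFF: "ledges (F u) \<inter> ledges (F v) = {}" if "u \<in> U" "v \<in> V" for u v
    using FF[OF that] dist[of u] U(1) that by (intro ledges_meet_once[of _ _ c]) auto
  have 1: "ledges (F u) \<inter> ledges M = {}" if "u \<in> U" for u using eLF[of u M] that U(1) L(2) by blast
  have 2: "ledges (F v) \<inter> ledges L = {}" if "v \<in> V" for v using eLF[of v L] that U(2) L(1) by blast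
  show "edges (piece F (L, U)) \<inter> edges (piece F (M, V)) = {}"
  proof (rule ccontr)
    assume "\<not> ?thesis"
    then obtain e where "(e \<in> ledges L \<or> (\<exists>u\<in>U. e \<in> ledges (F u))) \<and> (e \<in> ledges M \<or> (\<exists>v\<in>V. e \<in> ledges (F v)))"
      by (auto simp: piece_def)
    then show False
      using L(4) 1 2 eFF by (elim conjE disjE bexE) blast+
  qed
qed

lemma piece_connected:
  assumes fan: "fan E c (outer W) W F"
    and L: "L = [] \<or> gpath E L" "set L \<subseteq> outer W" and U: "U \<subseteq> W" "L \<noteq> [] \<Longrightarrow> U \<subseteq> set L" "card U \<le> 1" "finite U"
    and ne: "L \<noteq> [] \<or> U \<noteq> {}"
  shows "subgraph (piece F (L, U)) G" "connected_graph (piece F (L, U))"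
proof -
  have F: "gpath E (F w)" "last (F w) = w" "hd (F w) = c" if "w \<in> W" for w
    using fan that by (simp_all add: fan_def)
  have FV: "set (F w) \<subseteq> verts G" if "w \<in> W" for w
    using finite_simple_graphD(3)[OF simple] F(3)[OF that] abc(3) by (intro gpath_subset[OF F(1)[OF that]]) auto
  have LV: "set L \<subseteq> verts G" using L(2) outer_sub T_verts(1) by blast
  have LE: "ledges L \<subseteq> E" using L(1) by (auto simp: gpath_def)
  have FE: "ledges (F w) \<subseteq> E" if "w \<in> W" for w using F(1)[OF that] by (simp add: gpath_def)
  have "e \<subseteq> verts (piece F (L, U))" "card e = 2" if "e \<in> edges (piece F (L, U))" for e
  proof -
    show "e \<subseteq> verts (piece F (L, U))" using that ledges_subset by (fastforce simp: piece_def)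
    have "e \<in> E" using that LE FE U(1) by (auto simp: piece_def)
    then show "card e = 2" using finite_simple_graphD(4)[OF simple] by blast
  qed
  moreover have "verts (piece F (L, U)) \<subseteq> verts G" "edges (piece F (L, U)) \<subseteq> E"
  proof -
    have "(\<Union>u\<in>U. set (F u)) \<subseteq> verts G" "(\<Union>u\<in>U. ledges (F u)) \<subseteq> E"
      using FV FE U(1) by (meson UN_least subsetD)+
    then show "verts (piece F (L, U)) \<subseteq> verts G" "edges (piece F (L, U)) \<subseteq> E"
      using LV LE by (simp_all add: piece_def)
  qed
  moreover have "finite (verts (piece F (L, U)))" using U(4) by (simp add: piece_def)
  ultimately show "subgraph (piece F (L, U)) G"
    by (simp add: subgraph_def finite_simple_graph_def)
  have "U = {} \<or> (\<exists>u. U = {u})" using U(3,4) by (metis One_nat_def card_0_eq card_1_singletonE le_Suc_eq le_zero_eq)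
  then show "connected_graph (piece F (L, U))"
  proof
    assume "U = {}"
    then show ?thesis using connected_lgraph[of L] ne by (simp add: piece_def lgraph_def)
  next
    assume "\<exists>u. U = {u}"
    then obtain u where u: "U = {u}" by blast
    have uW: "u \<in> W" using u U(1) by simp
    have Fu: "connected_graph (lgraph (F u))" using F(1)[OF uW] by (intro connected_lgraph) (simp add: gpath_def)
    show ?thesis
    proof (cases "L = []")
      case True
      then show ?thesis using Fu u by (simp add: piece_def lgraph_def)
    next
      case False
      have "u \<in> set (F u)" using gpath_last[OF F(1)[OF uW]] F(2)[OF uW] by simp
      then have "verts (lgraph L) \<inter> verts (lgraph (F u)) \<noteq> {}" using U(2)[OF False] u by (auto simp: lgraph_def)
      from connected_graph_union[OF connected_lgraph[OF False] Fu this] show ?thesis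
        using u by (simp add: piece_def lgraph_def)
    qed
  qed
qed

end

lemma ledges_append_sub: "ledges ys \<subseteq> ledges (ys @ zs)" "ledges zs \<subseteq> ledges (ys @ zs)"
  by (cases "ys = []"; cases "zs = []"; auto simp: ledges_append)+

lemma ledges_take: "ledges (take n xs) \<subseteq> ledges xs" and ledges_drop: "ledges (drop n xs) \<subseteq> ledges xs"
  using ledges_append_sub[where ys = "take n xs" and zs = "drop n xs"] by simp_all

lemma in_set_takeD:
  assumes "x \<in> set (take (Suc n) xs)"
  shows "\<exists>m\<le>n. m < length xs \<and> x = xs ! m"
proof -
  obtain i where "i < length (take (Suc n) xs)" "x = take (Suc n) xs ! i"
    using assms by (metis in_set_conv_nth)
  then show ?thesis by (intro exI[of _ i]) auto
qed

lemma in_set_dropD: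
  assumes "x \<in> set (drop n xs)"
  shows "\<exists>m\<ge>n. m < length xs \<and> x = xs ! m"
proof -
  obtain i where "i < length (drop n xs)" "x = drop n xs ! i"
    using assms by (metis in_set_conv_nth)
  then show ?thesis by (intro exI[of _ "n + i"]) auto
qed

lemma filter_image_const:
  "(\<And>x. x \<in> X \<Longrightarrow> g (f x) = l) \<Longrightarrow> {i \<in> f ` X. g i = z} = (if l = z then f ` X else {})"
  by auto

context path_system_setting
begin

lemma hits_cases:
  assumes W: "W \<subseteq> outer W" and P: "P \<in> \<P>" and H: "H = W \<inter> set P - {a, b}"
  shows "H = {} \<or> (\<exists>w. H = {w}) \<or> (\<exists>i j. i < j \<and> j < length P \<and> H = {P ! i, P ! j})"
proof (cases "\<exists>x y. x \<in> H \<and> y \<in> H \<and> x \<noteq> y")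
  case False
  then show ?thesis by blast
next
  case True
  then obtain x y where xy: "x \<in> H" "y \<in> H" "x \<noteq> y" by blast
  then have "x \<in> set P" "y \<in> set P" using H by auto
  then obtain i j where ij: "i < length P" "x = P ! i" "j < length P" "y = P ! j"
    by (metis in_set_conv_nth)
  have *: "z \<in> {x, y}" if "z \<in> H" for z
  proof (rule ccontr)
    assume z: "z \<notin> {x, y}"
    have "z \<in> set P" using that H by auto
    then obtain l where l: "l < length P" "z = P ! l" by (metis in_set_conv_nth)
    have "i \<noteq> j" "j \<noteq> l" "i \<noteq> l" using xy(3) z ij l by auto
    from no_three[OF W P ij(1,3) l(1) this] show False using xy that H ij l by auto
  qed
  then have "H = {x, y}" using xy by blast
  moreover have "i < j \<or> j < i" using ij xy by (metis linorder_neqE_nat)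
  ultimately show ?thesis using ij by (metis insert_commute)
qed

text \<open>A nonempty second component brings in a fan path and with it \<open>c\<close>; an end
  \<open>a\<close> or \<open>b\<close> of that fan path counts even if the segment is empty.\<close>

definition label :: "'a list \<times> 'a set \<Rightarrow> 'a set" where
  "label i = (set (fst i) \<inter> {a, b}) \<union> (if snd i = {} then {} else insert c (snd i \<inter> {a, b}))"

text \<open>The bundle is sorted by the number of fan ends inside each path: \<open>s\<close> paths
  have one, \<open>d\<close> have two, \<open>u\<close> have none. Ends at \<open>a\<close> or
  \<open>b\<close> belong to no single path, so their fan paths become pieces of their own and enter
  the counts through \<open>of_bool\<close>.\<close>

lemma packs_of_fan:
  assumes fan: "fan E c (outer W) W F"
  shows "\<exists>s d u. s + d + u = card \<P> \<and> card W \<le> s + 2 * d + card (W \<inter> {a, b}) \<and>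
    packs G {a, b, c} {a, c} {b, c} {a, b} s (d + of_bool (a \<in> W)) (d + of_bool (b \<in> W)) u"
proof -
  have WB: "W \<subseteq> outer W" using fan by (simp add: fan_def)
  define H where "H P = W \<inter> set P - {a, b}" for P
  define P0 where "P0 = {P \<in> \<P>. H P = {}}"
  define P1 where "P1 = {P \<in> \<P>. \<exists>w. H P = {w}}"
  define P2 where "P2 = {P \<in> \<P>. \<exists>i j. i < j \<and> j < length P \<and> H P = {P ! i, P ! j}}"
  have fins: "finite P0" "finite P1" "finite P2" using fin\<P> by (auto simp: P0_def P1_def P2_def)
  have "\<forall>P\<in>P2. \<exists>ij. fst ij < snd ij \<and> snd ij < length P \<and> H P = {P ! fst ij, P ! snd ij}"
    unfolding P2_def by auto
  then obtain ij where ij: "\<And>P. P \<in> P2 \<Longrightarrow> fst (ij P) < snd (ij P) \<and> snd (ij P) < length P \<and> H P = {P ! fst (ij P), P ! snd (ij P)}"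
    by metis
  define lo hi where "lo = (\<lambda>P. fst (ij P))" and "hi = (\<lambda>P. snd (ij P))"
  have lohi: "lo P < hi P" "hi P < length P" "lo P < length P" "H P = {P ! lo P, P ! hi P}" if "P \<in> P2" for P
    using ij[OF that] by (auto simp: lo_def hi_def)
  have card2: "card (H P) = 2" if "P \<in> P2" for P
  proof -
    have "P \<in> \<P>" using that by (simp add: P2_def)
    then have "P ! lo P \<noteq> P ! hi P"
      using nth_eq_iff_index_eq[OF path(2)] lohi[OF that] by auto
    then show ?thesis using lohi(4)[OF that] by simp
  qed
  have un: "\<P> = P0 \<union> P1 \<union> P2"
    using hits_cases[OF WB _ H_def] unfolding P0_def P1_def P2_def by blast
  have d01: "P0 \<inter> P1 = {}" by (auto simp: P0_def P1_def)
  have d2: "(P0 \<union> P1) \<inter> P2 = {}"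
  proof -
    have "card (H P) \<le> 1" if "P \<in> P0 \<union> P1" for P using that by (auto simp: P0_def P1_def)
    then show ?thesis using card2 by fastforce
  qed
  have sum: "card P1 + card P2 + card P0 = card \<P>"
    unfolding un using fins d01 d2 by (simp add: card_Un_disjoint)

  \<comment> \<open>Every end is \<open>a\<close>, \<open>b\<close> or an interior hit of some path,
    which bounds the number of ends by the numbers of paths of each kind.\<close>
  have "W \<subseteq> (W \<inter> {a, b}) \<union> (\<Union>P\<in>\<P>. H P)"
    using WB outer_sub[of W] by (auto simp: H_def T_def)
  moreover have "(\<Union>P\<in>\<P>. H P) = (\<Union>P\<in>P1. H P) \<union> (\<Union>P\<in>P2. H P)" unfolding un by (auto simp: P0_def)
  ultimately have sub: "W \<subseteq> (W \<inter> {a, b}) \<union> ((\<Union>P\<in>P1. H P) \<union> (\<Union>P\<in>P2. H P))" by simp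
  have fW: "finite W" using finite_subset[OF WB finite_outer] .
  then have fH: "finite (H P)" for P by (simp add: H_def)
  have "card W \<le> card ((W \<inter> {a, b}) \<union> ((\<Union>P\<in>P1. H P) \<union> (\<Union>P\<in>P2. H P)))"
    using fins fH by (intro card_mono[OF _ sub]) auto
  moreover have "\<dots> \<le> card (W \<inter> {a, b}) + card ((\<Union>P\<in>P1. H P) \<union> (\<Union>P\<in>P2. H P))"
    by (rule card_Un_le)
  moreover have "card ((\<Union>P\<in>P1. H P) \<union> (\<Union>P\<in>P2. H P)) \<le> card (\<Union>P\<in>P1. H P) + card (\<Union>P\<in>P2. H P)"
    by (rule card_Un_le)
  moreover have "card (H P) = 1" if "P \<in> P1" for P using that by (auto simp: P1_def)
  then have "card (\<Union>P\<in>P1. H P) \<le> card P1" using card_UN_le[OF fins(2), of H] by simp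
  moreover have "card (\<Union>P\<in>P2. H P) \<le> 2 * card P2"
    using card_UN_le[OF fins(3), of H] card2 by (simp add: mult.commute)
  ultimately have cardW: "card W \<le> card P1 + 2 * card P2 + card (W \<inter> {a, b})" by linarith

  \<comment> \<open>A path with two hits keeps its part up to the first and its part from the
    second, both inclusive. What lies strictly between is inner and is discarded, since fan paths
    may use it.\<close>
  define A where "A P = (take (Suc (lo P)) P, {P ! lo P})" for P
  define B where "B P = (drop (hi P) P, {P ! hi P})" for P
  define pieces where "pieces P = (if P \<in> P0 then {(P, {})} else if P \<in> P1 then {(P, H P)} else {A P, B P})" for P
  \<comment> \<open>The empty segment marks a piece that is nothing but a fan path to
    \<open>a\<close> or \<open>b\<close>.\<close>
  define J where "J = (\<lambda>e. ([] :: 'a list, {e})) ` (W \<inter> {a, b})"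
  define I where "I = (\<Union>P\<in>\<P>. pieces P) \<union> J"
  have finI: "finite I" using fin\<P> by (auto simp: I_def J_def pieces_def)
  have own: "L \<noteq> [] \<and> gpath E L \<and> set L \<subseteq> outer W \<and> set L \<subseteq> set P \<and> ledges L \<subseteq> ledges P \<and>
      U \<subseteq> H P \<and> U \<subseteq> set L \<and> card U \<le> 1 \<and> finite U" if P: "P \<in> \<P>" and LU: "(L, U) \<in> pieces P" for P L U
  proof -
    note pP = path[OF P]
    have idx: "\<exists>m<length P. x = P ! m" if "x \<in> set P" for x using that by (metis in_set_conv_nth)
    have PT: "set P \<subseteq> T" using P by (auto simp: T_def)
    have HP: "P ! i \<in> H P" if "P ! i \<in> W - {a, b}" "i < length P" for i using that by (simp add: H_def)
    have H0: "P \<in> P0 \<Longrightarrow> H P = {}" by (simp add: P0_def)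
    have "P \<in> P0 \<or> P \<in> P1 \<or> P \<in> P2" using P unfolding un by simp
    then have "(P \<in> P0 \<union> P1 \<and> L = P \<and> U = H P) \<or> (P \<in> P2 \<and> (L, U) = A P) \<or> (P \<in> P2 \<and> (L, U) = B P)"
      using LU H0 unfolding pieces_def by (cases "P \<in> P0"; cases "P \<in> P1"; simp)
    then consider "P \<in> P0 \<union> P1" "L = P" "U = H P" | "P \<in> P2" "(L, U) = A P" | "P \<in> P2" "(L, U) = B P"
      by (elim disjE conjE)
    then show ?thesis
    proof cases
      case 1
      then have small: "card (H P) \<le> 1" "finite (H P)" by (auto simp: P0_def P1_def)
      have "set P \<inter> inner W = {}"
      proof (rule ccontr)
        assume "set P \<inter> inner W \<noteq> {}"
        then obtain j where j: "j < length P" "P ! j \<in> inner W" using idx by blast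
        then obtain i l where il: "i < j" "j < l" "l < length P" "P ! i \<in> W - {a, b}" "P ! l \<in> W - {a, b}"
          using inner_iff[OF P j(1)] by blast
        then have "{P ! i, P ! l} \<subseteq> H P" "P ! i \<noteq> P ! l"
          using HP nth_eq_iff_index_eq[OF pP(2), of i l] by auto
        then show False using small card_mono[of "H P" "{P ! i, P ! l}"] by simp
      qed
      then show ?thesis using 1 small pP PT by (auto simp: outer_def H_def)
    next
      case 2
      note lh = lohi[OF 2(1)]
      have LU: "L = take (Suc (lo P)) P" "U = {P ! lo P}" using 2 by (auto simp: A_def)
      \<comment> \<open>An inner vertex needs a hit before it, but no hit comes before
        \<open>lo P\<close>. The final part is treated symmetrically.\<close>
      have "x \<notin> inner W" if xL: "x \<in> set L" for x
      proof
        assume x: "x \<in> inner W"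
        obtain m where m: "m \<le> lo P" "m < length P" "x = P ! m"
          using in_set_takeD[OF xL[unfolded LU]] by blast
        then obtain i where i: "i < m" "P ! i \<in> W - {a, b}" using inner_iff[OF P m(2), of W] x by blast
        then have "P ! i \<in> {P ! lo P, P ! hi P}" using HP[of i] lh m by auto
        then show False using nth_eq_iff_index_eq[OF pP(2)] i m lh by auto
      qed
      moreover have "P ! lo P \<in> set L" using LU lh(3) by (auto simp: in_set_conv_nth intro!: exI[of _ "lo P"])
      moreover have "set L \<subseteq> set P" unfolding LU by (rule set_take_subset)
      moreover have "gpath E L" using pP LU ledges_take[of "Suc (lo P)" P] by (auto simp: gpath_def)
      ultimately show ?thesis using LU PT pP(3) lh(4) ledges_take[of "Suc (lo P)" P] by (auto simp: outer_def)
    next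
      case 3
      note lh = lohi[OF 3(1)]
      have LU: "L = drop (hi P) P" "U = {P ! hi P}" using 3 by (auto simp: B_def)
      have "x \<notin> inner W" if xL: "x \<in> set L" for x
      proof
        assume x: "x \<in> inner W"
        obtain m where m: "hi P \<le> m" "m < length P" "x = P ! m"
          using in_set_dropD[OF xL[unfolded LU]] by blast
        then obtain i where i: "m < i" "i < length P" "P ! i \<in> W - {a, b}" using inner_iff[OF P m(2), of W] x by blast
        then have "P ! i \<in> {P ! lo P, P ! hi P}" using HP[of i] lh m by auto
        then show False using nth_eq_iff_index_eq[OF pP(2)] i m lh by auto
      qed
      moreover have "P ! hi P \<in> set L" unfolding LU using lh(2) by (metis Cons_nth_drop_Suc list.set_intros(1))
      moreover have "set L \<subseteq> set P" unfolding LU by (rule set_drop_subset)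
      moreover have "L \<noteq> []" using LU lh(2) by simp
      moreover have "gpath E L" using pP calculation(4) LU ledges_drop[of "hi P" P] by (auto simp: gpath_def)
      ultimately show ?thesis using LU PT lh(4) ledges_drop[of "hi P" P] by (auto simp: outer_def)
    qed
  qed
  have HW: "H P \<subseteq> W - {a, b}" for P by (auto simp: H_def)
  have fam: "internally_disjoint G {a, b, c} I (piece F) label"
    unfolding internally_disjoint_def
  proof (intro conjI ballI impI)
    fix i assume i: "i \<in> I"
    obtain L U where LU: "i = (L, U)" by (cases i)
    have *: "(L = [] \<or> gpath E L) \<and> set L \<subseteq> outer W \<and> U \<subseteq> W \<and> (L \<noteq> [] \<longrightarrow> U \<subseteq> set L) \<and> card U \<le> 1 \<and> finite U \<and> (L \<noteq> [] \<or> U \<noteq> {})"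
    proof (cases "i \<in> J")
      case True then show ?thesis using LU by (auto simp: J_def)
    next
      case False
      then obtain P where P: "P \<in> \<P>" "(L, U) \<in> pieces P" using i LU by (auto simp: I_def)
      from own[OF P] HW[of P] show ?thesis by blast
    qed
    show "subgraph (piece F i) G" "connected_graph (piece F i)"
      unfolding LU using piece_connected[OF fan, of L U] * by auto
    have "c \<in> set (F u)" "u \<in> set (F u)" if "u \<in> W" for u
      using fan that gpath_hd[of E "F u"] gpath_last[of E "F u"] by (auto simp: fan_def)
    then have "insert c U \<subseteq> verts (piece F (L, U))" if "U \<noteq> {}"
      using that * by (fastforce simp: piece_def)
    then show "label i \<subseteq> verts (piece F i)"
      unfolding LU label_def by (auto simp: piece_def)
  next
    fix i j assume ij: "i \<in> I" "j \<in> I" "i \<noteq> j"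
    obtain L U where LU: "i = (L, U)" by (cases i)
    obtain M V where MV: "j = (M, V)" by (cases j)
    have *: "set K \<subseteq> outer W \<and> X \<subseteq> W \<and> X - {a, b} \<subseteq> set K" if KX: "(K, X) \<in> I" for K X
    proof (cases "(K, X) \<in> J")
      case True then show ?thesis by (auto simp: J_def)
    next
      case False
      then obtain P where P: "P \<in> \<P>" "(K, X) \<in> pieces P" using KX by (auto simp: I_def)
      from own[OF P] HW[of P] show ?thesis by blast
    qed
    have **: "set L \<inter> set M \<subseteq> {a, b} \<and> ledges L \<inter> ledges M = {} \<and> U \<inter> V = {}"
    proof (cases "i \<in> J \<or> j \<in> J")
      case True
      have HJ: "X \<inter> {a, b} = {}" if KX: "(K, X) \<in> I" "(K, X) \<notin> J" for K X
      proof -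
        obtain P where P: "P \<in> \<P>" "(K, X) \<in> pieces P" using KX by (auto simp: I_def)
        from own[OF P] HW[of P] show ?thesis by blast
      qed
      show ?thesis using True HJ[of L U] HJ[of M V] ij LU MV by (fastforce simp: J_def)
    next
      case False
      then obtain P Q where P: "P \<in> \<P>" "(L, U) \<in> pieces P" and Q: "Q \<in> \<P>" "(M, V) \<in> pieces Q"
        using ij LU MV by (auto simp: I_def)
      show ?thesis
      proof (cases "P = Q")
        case False
        have "H P \<inter> H Q = {}" using path_disjoint(1)[OF P(1) Q(1) False] by (auto simp: H_def)
        then show ?thesis using own[OF P] own[OF Q] path_disjoint[OF P(1) Q(1) False] by blast
      next
        case True
        have ijP: "i \<in> pieces P" "j \<in> pieces P" using P(2) Q(2) LU MV True by simp_all
        have "P \<notin> P0" "P \<notin> P1" using ijP ij(3) unfolding pieces_def by (auto split: if_splits)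
        then have "P \<in> P2" "(i = A P \<and> j = B P) \<or> (i = B P \<and> j = A P)"
          using P(1) ijP ij(3) unfolding un pieces_def by (simp, simp, blast)
        note lh = lohi[OF this(1)]
        have 1: "set (take (Suc (lo P)) P) \<inter> set (drop (hi P) P) = {}"
          using lh path(2)[OF P(1)] by (intro set_take_disj_set_drop_if_distinct) auto
        have 2: "ledges (take (Suc (lo P)) P) \<inter> ledges (drop (hi P) P) = {}"
          by (rule ledges_meet_once[of _ _ a]) (use 1 path(2)[OF P(1)] in auto)
        have 3: "P ! lo P \<noteq> P ! hi P" using nth_eq_iff_index_eq[OF path(2)[OF P(1)]] lh by auto
        from \<open>(i = A P \<and> j = B P) \<or> (i = B P \<and> j = A P)\<close> show ?thesis
          using 1 2 3 LU MV by (auto simp: A_def B_def Int_commute)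
      qed
    qed
    show "edges (piece F i) \<inter> edges (piece F j) = {}" "verts (piece F i) \<inter> verts (piece F j) \<subseteq> {a, b, c}"
      using piece_disjoint[OF fan, of L M U V] *[of L U] *[of M V] ** ij LU MV by auto
  qed (rule finI)
  have l0: "label (P, {}) = {a, b}" if "P \<in> P0" for P
    using path(7,8)[of P] that by (auto simp: label_def P0_def)
  have l1: "label (P, H P) = {a, b, c}" if "P \<in> P1" for P
    using path(7,8)[of P] that HW[of P] by (auto simp: label_def P1_def)
  have HPn: "P ! lo P \<notin> {a, b}" "P ! hi P \<notin> {a, b}" if "P \<in> P2" for P
    using lohi(4)[OF that] HW[of P] by auto
  have P2P: "P \<in> \<P>" if "P \<in> P2" for P using that by (simp add: P2_def)
  have lA: "label (A P) = {a, c}" if "P \<in> P2" for P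
  proof -
    note lh = lohi[OF that] and pP = path[OF P2P[OF that]]
    have "a \<in> set (take (Suc (lo P)) P)" using pP(3,4) by (cases P) auto
    moreover have "b \<in> set (drop (hi P) P)"
      using pP(5) lh(2) by (auto simp: in_set_conv_nth intro!: exI[of _ "length P - 1 - hi P"])
    then have "b \<notin> set (take (Suc (lo P)) P)"
      using set_take_disj_set_drop_if_distinct[OF pP(2), of "Suc (lo P)" "hi P"] lh by auto
    ultimately show ?thesis using HPn[OF that] by (auto simp: label_def A_def)
  qed
  have lB: "label (B P) = {b, c}" if "P \<in> P2" for P
  proof -
    note lh = lohi[OF that] and pP = path[OF P2P[OF that]]
    have "b \<in> set (drop (hi P) P)"
      using pP(5) lh(2) by (auto simp: in_set_conv_nth intro!: exI[of _ "length P - 1 - hi P"])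
    moreover have "a \<in> set (take (Suc (lo P)) P)" using pP(3,4) by (cases P) auto
    then have "a \<notin> set (drop (hi P) P)"
      using set_take_disj_set_drop_if_distinct[OF pP(2), of "Suc (lo P)" "hi P"] lh by auto
    ultimately show ?thesis using HPn[OF that] by (auto simp: label_def B_def)
  qed
  have lJ: "label ([], {e}) = {e, c}" if "e \<in> {a, b}" for e using that by (auto simp: label_def)
  have IU: "I = (\<lambda>P. (P, {})) ` P0 \<union> (\<lambda>P. (P, H P)) ` P1 \<union> A ` P2 \<union> B ` P2 \<union> J"
  proof -
    have "(\<Union>P\<in>\<P>. pieces P) = (\<Union>P\<in>P0. pieces P) \<union> (\<Union>P\<in>P1. pieces P) \<union> (\<Union>P\<in>P2. pieces P)"
      unfolding un by blast
    moreover have "(\<Union>P\<in>P0. pieces P) = (\<lambda>P. (P, {})) ` P0" by (auto simp: pieces_def)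
    moreover have "(\<Union>P\<in>P1. pieces P) = (\<lambda>P. (P, H P)) ` P1" using d01 by (auto simp: pieces_def)
    moreover have "(\<Union>P\<in>P2. pieces P) = A ` P2 \<union> B ` P2" using d2 by (auto simp: pieces_def)
    ultimately show ?thesis by (simp only: I_def Un_assoc)
  qed
  have ne: "{a, b} \<noteq> {a, c}" "{a, b} \<noteq> {b, c}" "{a, c} \<noteq> {b, c}" "{a, b, c} \<noteq> {a, b}" "{a, b, c} \<noteq> {a, c}" "{a, b, c} \<noteq> {b, c}"
    using abc by auto
  have filt: "{i\<in>I. label i = z} = (if {a, b} = z then (\<lambda>P. (P, {})) ` P0 else {}) \<union>
      (if {a, b, c} = z then (\<lambda>P. (P, H P)) ` P1 else {}) \<union> (if {a, c} = z then A ` P2 else {}) \<union>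
      (if {b, c} = z then B ` P2 else {}) \<union> {i\<in>J. label i = z}" for z
  proof -
    have "{i\<in>I. label i = z} = {i \<in> (\<lambda>P. (P, {})) ` P0. label i = z} \<union> {i \<in> (\<lambda>P. (P, H P)) ` P1. label i = z} \<union>
      {i \<in> A ` P2. label i = z} \<union> {i \<in> B ` P2. label i = z} \<union> {i \<in> J. label i = z}"
      unfolding IU by blast
    then show ?thesis
      using filter_image_const[of P0 label "\<lambda>P. (P, {})" "{a, b}" z, OF l0]
        filter_image_const[of P1 label "\<lambda>P. (P, H P)" "{a, b, c}" z, OF l1]
        filter_image_const[of P2 label A "{a, c}" z, OF lA] filter_image_const[of P2 label B "{b, c}" z, OF lB]
      by simp
  qed
  have labJ: "i = ([], {a}) \<and> a \<in> W \<and> label i = {a, c} \<or> i = ([], {b}) \<and> b \<in> W \<and> label i = {b, c}" if "i \<in> J" for i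
    using that lJ[of a] lJ[of b] unfolding J_def by fastforce
  have inJ: "e \<in> W \<Longrightarrow> e \<in> {a, b} \<Longrightarrow> ([], {e}) \<in> J" for e by (simp add: J_def)
  have J0: "{i\<in>J. label i = {a, b}} = {}" "{i\<in>J. label i = {a, b, c}} = {}"
    using labJ ne by fastforce+
  have Ja: "{i\<in>J. label i = {a, c}} = (if a \<in> W then {([], {a})} else {})"
  proof -
    have "i = ([], {a}) \<and> a \<in> W" if "i \<in> J" "label i = {a, c}" for i using labJ[OF that(1)] that(2) ne(3) by metis
    then show ?thesis using inJ[of a] lJ[of a] by auto
  qed
  have Jb: "{i\<in>J. label i = {b, c}} = (if b \<in> W then {([], {b})} else {})"
  proof -
    have "i = ([], {b}) \<and> b \<in> W" if "i \<in> J" "label i = {b, c}" for i using labJ[OF that(1)] that(2) ne(3) by metis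
    then show ?thesis using inJ[of b] lJ[of b] by auto
  qed
  have "{i\<in>I. label i = {a, b}} = (\<lambda>P. (P, {})) ` P0"
    unfolding filt J0 using ne ne[symmetric] by simp
  then have c0: "card {i\<in>I. label i = {a, b}} = card P0" by (simp add: card_image inj_on_def)
  have "{i\<in>I. label i = {a, b, c}} = (\<lambda>P. (P, H P)) ` P1"
    unfolding filt J0 using ne ne[symmetric] by simp
  then have c1: "card {i\<in>I. label i = {a, b, c}} = card P1" by (simp add: card_image inj_on_def)
  \<comment> \<open>Distinct paths have no common hit, so pieces of distinct paths carry distinct
    ends and are not identified in the count.\<close>
  have uniq: "P = Q" if "P \<in> P2" "Q \<in> P2" "x \<in> H P" "x \<in> H Q" for P Q x
  proof (rule ccontr)
    assume "P \<noteq> Q"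
    from path_disjoint(1)[OF P2P[OF that(1)] P2P[OF that(2)] this] that(3,4) show False by (auto simp: H_def)
  qed
  have "P ! lo P \<in> H P" "P ! hi P \<in> H P" if "P \<in> P2" for P using lohi(4)[OF that] by simp_all
  then have inj: "inj_on A P2" "inj_on B P2"
    using uniq unfolding inj_on_def A_def B_def by (metis prod.inject singleton_inject)+
  have "{i\<in>I. label i = {a, c}} = A ` P2 \<union> (if a \<in> W then {([], {a})} else {})"
    unfolding filt Ja using ne ne[symmetric] by simp
  moreover have "([], {a}) \<notin> A ` P2" using HPn by (auto simp: A_def)
  ultimately have c2: "card {i\<in>I. label i = {a, c}} = card P2 + of_bool (a \<in> W)"
    using fins(3) inj by (simp add: card_image)
  have "{i\<in>I. label i = {b, c}} = B ` P2 \<union> (if b \<in> W then {([], {b})} else {})"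
    unfolding filt Jb using ne ne[symmetric] by simp
  moreover have "([], {b}) \<notin> B ` P2" using HPn by (auto simp: B_def)
  ultimately have c3: "card {i\<in>I. label i = {b, c}} = card P2 + of_bool (b \<in> W)"
    using fins(3) inj by (simp add: card_image)
  have "packs G {a, b, c} {a, c} {b, c} {a, b} (card P1) (card P2 + of_bool (a \<in> W)) (card P2 + of_bool (b \<in> W)) (card P0)"
    unfolding packs_def using fam c0 c1 c2 c3 by blast
  with sum cardW show ?thesis by blast
qed

lemma set_connectivity_bound:
  assumes fan: "fan E c (outer W) W F" and k: "2 \<le> k" "k \<le> 5" "k \<le> card W"
    and size: "card \<P> = k \<or> card \<P> + 1 = k \<and> a \<in> W \<and> b \<in> W"
  shows "k - 1 \<le> set_connectivity G {a, b, c}"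
proof -
  obtain s d u where sdu: "s + d + u = card \<P>" "card W \<le> s + 2 * d + card (W \<inter> {a, b})"
    and packs: "packs G {a, b, c} {a, c} {b, c} {a, b} s (d + of_bool (a \<in> W)) (d + of_bool (b \<in> W)) u"
    using packs_of_fan[OF fan] by blast
  have cW: "card (W \<inter> {a, b}) = of_bool (a \<in> W) + of_bool (b \<in> W)"
    using abc(4) by (cases "a \<in> W"; cases "b \<in> W") auto
  \<comment> \<open>\<open>n\<close> is the number of trees still missing besides the
    \<open>s\<close> complete pieces; truncated subtraction makes it 0 if there are enough
    already.\<close>
  define n where "n = k - 1 - s"
  \<comment> \<open>Only the first inequality draws on \<open>k \<le> 5\<close>. The second follows
    from the number of ends, the other two from the number of paths.\<close>
  have num: "2 * n \<le> (d + of_bool (a \<in> W)) + (d + of_bool (b \<in> W)) + u"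
    "n \<le> (d + of_bool (a \<in> W)) + (d + of_bool (b \<in> W))" "n \<le> (d + of_bool (a \<in> W)) + u" "n \<le> (d + of_bool (b \<in> W)) + u"
    using sdu k size unfolding cW n_def by (cases "a \<in> W"; cases "b \<in> W"; simp; linarith)+
  have "\<exists>\<alpha> \<beta> \<gamma>. packs G {a, b, c} {a, c} {b, c} {a, b} (s + n) \<alpha> \<beta> \<gamma>"
    by (rule packs_reduce[OF packs _ _ _ _ _ _ _ _ _ _ num]) (use abc in auto)
  then obtain \<alpha> \<beta> \<gamma> where "packs G {a, b, c} {a, c} {b, c} {a, b} (s + n) \<alpha> \<beta> \<gamma>" by blast
  from packs_trees[OF this simple, of a b] abc(4) have "s + n \<le> set_connectivity G {a, b, c}" by simp
  then show ?thesis by (simp add: n_def)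
qed

end

theorem set_connectivity_ge_connectivity_minus_1:
  assumes G: "finite_simple_graph G" and S: "S \<subseteq> verts G" "card S = 3" and k: "connectivity G \<le> 5"
  shows "connectivity G - 1 \<le> set_connectivity G S"
proof (cases "connectivity G \<ge> 2")
  case False
  then show ?thesis by simp
next
  case True
  define k where "k = connectivity G"
  obtain a b c where S3: "S = {a, b, c}" "a \<noteq> b" "b \<noteq> c" "a \<noteq> c" using S(2) by (auto simp: card_3_iff)
  then have V: "a \<in> verts G" "b \<in> verts G" "c \<in> verts G" using S(1) by auto
  obtain \<P> where P: "finite \<P>" "card \<P> = k" "path_system (edges G) a b \<P>"
    using menger_bundle[OF G V(1,2) S3(2), of k] True k_def by auto
  have "k - 1 \<le> set_connectivity G {a, b, c}"
  proof (cases "\<exists>P\<in>\<P>. c \<in> set P")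
    case False
    interpret path_system_setting G a b c \<P> k
      by unfold_locales (use G V S3 P False k_def in auto)
    have "fan (edges G) c (outer {}) {} (\<lambda>_. [])" using outer_sub T_verts(2) by (auto simp: fan_def)
    from fan_to_outer[OF this] obtain W F where W: "fan (edges G) c (outer W) W F" "k \<le> card W" by blast
    from set_connectivity_bound[OF W(1) _ _ W(2)] show ?thesis using True k k_def P(2) by simp
  next
    \<comment> \<open>\<open>P\<close> is cut at \<open>c\<close> into two paths that form a
      starting fan with ends \<open>a\<close> and \<open>b\<close>. Both ends persist while the fan
      grows, and their two fan paths make up for the path missing from the bundle.\<close>
    case True
    then obtain P where PP: "P \<in> \<P>" "c \<in> set P" by blast
    have pd: "set P \<inter> set Q = {a, b}" if "Q \<in> \<P> - {P}" for Q
      using P(3) PP(1) that unfolding path_system_def by blast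
    have card: "card (\<P> - {P}) + 1 = k" using PP P \<open>2 \<le> connectivity G\<close> k_def by simp
    have "c \<notin> set Q" if "Q \<in> \<P> - {P}" for Q using pd[OF that] PP(2) S3(3,4) by auto
    then interpret path_system_setting G a b c "\<P> - {P}" k
      by unfold_locales (use G V S3 P card k_def in \<open>auto simp: path_system_def\<close>)
    have gP: "gpath (edges G) P" "hd P = a" "last P = b" using P(3) PP(1) by (auto simp: path_system_def)
    obtain us vs where P_eq: "P = us @ c # vs" using PP(2) by (meson split_list)
    have us: "us \<noteq> []" "hd us = a" using gP(2) S3 P_eq by (cases us; auto)+
    have vs: "vs \<noteq> []" "last vs = b" using gP(3) S3 P_eq by (cases vs; auto)+
    define F where "F = (\<lambda>w. if w = a then rev (us @ [c]) else c # vs)"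
    have dP: "distinct P" using gP(1) by (simp add: gpath_def)
    have ab: "a \<in> set us" "b \<in> set vs" using us vs by auto
    have g1: "gpath (edges G) (us @ [c])" and g2: "gpath (edges G) (c # vs)"
      using gP(1) unfolding P_eq by (rule gpath_prefix, rule gpath_suffix)
    have PT: "set P \<inter> outer {a, b} \<subseteq> {a, b}"
      using outer_sub[of "{a, b}"] pd by (auto simp: T_def)
    have "fan (edges G) c (outer {a, b}) {a, b} F"
      unfolding fan_def
    proof (intro conjI ballI impI)
      show "c \<notin> outer {a, b}" using outer_sub T_verts(2) by blast
      show "{a, b} \<subseteq> outer {a, b}" using outer_ends by blast
    next
      fix w assume w: "w \<in> {a, b}"
      show "gpath (edges G) (F w)" using g1 g2 by (simp add: F_def del: rev_append)
      show "hd (F w) = c" by (simp add: F_def)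
      show "last (F w) = w" using w us vs by (auto simp: F_def last_rev)
      have "set (F w) \<subseteq> set P" "w \<in> set (F w)" using w ab P_eq by (auto simp: F_def)
      moreover have "w' \<notin> set (F w)" if "w' \<in> {a, b}" "w' \<noteq> w" for w'
        using that w ab dP S3 unfolding P_eq by (auto simp: F_def)
      moreover have "w \<in> outer {a, b}" using w outer_ends by blast
      ultimately show "set (F w) \<inter> outer {a, b} = {w}" using PT by blast
    next
      fix w w' assume "w \<in> {a, b}" "w' \<in> {a, b}" "w \<noteq> w'"
      then show "set (F w) \<inter> set (F w') = {c}" using dP unfolding P_eq by (auto simp: F_def)
    qed
    from fan_to_outer[OF this] obtain W F where W: "fan (edges G) c (outer W) W F" "k \<le> card W" "{a, b} \<subseteq> W" by blast
    from set_connectivity_bound[OF W(1) _ _ W(2)] show ?thesis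
      using card W(3) \<open>2 \<le> connectivity G\<close> k k_def by auto
  qed
  then show ?thesis using S3(1) k_def by simp
qed

section \<open>Dense graphs have a \<open>K\<^sub>3\<^sub>,\<^sub>3\<close> minor\<close>

definition induced :: "'a set set \<Rightarrow> 'a set \<Rightarrow> 'a graph" where
  "induced E X = Graph X {e \<in> E. e \<subseteq> X}"

text \<open>The \<open>M i\<close> are branch sets, with indices below 3 on one side and 3 to 5 on
  the other. Branch sets can be lifted when a contraction is undone, which the induction needs; a
  subdivision is extracted only afterwards.\<close>

definition K33_minor :: "'a set \<Rightarrow> 'a set set \<Rightarrow> bool" where
  "K33_minor V E \<longleftrightarrow> (\<exists>M :: nat \<Rightarrow> 'a set.
     (\<forall>i<6. M i \<subseteq> V \<and> connected_graph (induced E (M i))) \<and>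
     (\<forall>i<6. \<forall>j<6. i \<noteq> j \<longrightarrow> M i \<inter> M j = {}) \<and>
     (\<forall>i<3. \<forall>j\<in>{3..<6}. \<exists>x\<in>M i. \<exists>y\<in>M j. {x, y} \<in> E))"

lemma connected_graph_mono:
  assumes "connected_graph (Graph X E)" "E \<subseteq> F"
  shows "connected_graph (Graph X F)"
proof -
  have "reach E \<subseteq> reach F"
    by (rule rtrancl_mono) (use assms(2) in blast)
  then show ?thesis using assms(1) unfolding connected_graph_def by auto
qed

lemma K33_minor_mono:
  assumes "K33_minor V E" "V \<subseteq> V'" "E \<subseteq> E'"
  shows "K33_minor V' E'"
proof -
  obtain M :: "nat \<Rightarrow> 'a set" where M: "\<forall>i<6. M i \<subseteq> V \<and> connected_graph (induced E (M i))"
    "\<forall>i<6. \<forall>j<6. i \<noteq> j \<longrightarrow> M i \<inter> M j = {}" "\<forall>i<3. \<forall>j\<in>{3..<6}. \<exists>x\<in>M i. \<exists>y\<in>M j. {x, y} \<in> E"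
    using assms(1) unfolding K33_minor_def by blast
  have "connected_graph (induced E' (M i))" if "i < 6" for i
    using M(1) that assms(3) connected_graph_mono[of "M i" "{e \<in> E. e \<subseteq> M i}" "{e \<in> E'. e \<subseteq> M i}"]
    by (auto simp: induced_def)
  moreover have "\<forall>i<3. \<forall>j\<in>{3..<6}. \<exists>x\<in>M i. \<exists>y\<in>M j. {x, y} \<in> E'"
    using M(3) assms(3) by (meson subsetD)
  ultimately show ?thesis unfolding K33_minor_def using M(1,2) assms(2) by (intro exI[of _ M]) blast
qed

lemma connected_induced_singleton: "connected_graph (induced E {x})"
  by (simp add: connected_graph_def induced_def)

lemma all_less_6: "(\<forall>i<6::nat. R i) \<longleftrightarrow> R 0 \<and> R 1 \<and> R 2 \<and> R 3 \<and> R 4 \<and> R 5"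
  by (auto simp: numeral_eq_Suc All_less_Suc)

lemma all_less_3: "(\<forall>i<3::nat. R i) \<longleftrightarrow> R 0 \<and> R 1 \<and> R 2"
  by (auto simp: numeral_eq_Suc All_less_Suc)

lemma all_345: "(\<forall>i\<in>{3..<6::nat}. R i) \<longleftrightarrow> R 3 \<and> R 4 \<and> R 5"
proof -
  have "{3..<6::nat} = {3, 4, 5}" by auto
  then show ?thesis by simp
qed

lemma K33_minorI:
  fixes A B :: "nat \<Rightarrow> 'a set"
  assumes "\<forall>i<3. A i \<subseteq> V \<and> connected_graph (induced E (A i))" "\<forall>i<3. B i \<subseteq> V \<and> connected_graph (induced E (B i))"
    and "A 0 \<inter> A 1 = {}" "A 0 \<inter> A 2 = {}" "A 1 \<inter> A 2 = {}" "B 0 \<inter> B 1 = {}" "B 0 \<inter> B 2 = {}" "B 1 \<inter> B 2 = {}"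
    and "\<forall>i<3. \<forall>j<3. A i \<inter> B j = {} \<and> (\<exists>x\<in>A i. \<exists>y\<in>B j. {x, y} \<in> E)"
  shows "K33_minor V E"
  unfolding K33_minor_def
proof (intro exI conjI)
  let ?M = "\<lambda>i. if i < 3 then A i else B (i - 3)"
  show "\<forall>i<6. ?M i \<subseteq> V \<and> connected_graph (induced E (?M i))"
    using assms(1,2) unfolding all_less_6 all_less_3 by simp
  show "\<forall>i<6. \<forall>j<6. i \<noteq> j \<longrightarrow> ?M i \<inter> ?M j = {}"
    using assms(3-) unfolding all_less_6 all_less_3 by (simp add: Int_commute)
  show "\<forall>i<3. \<forall>j\<in>{3..<6}. \<exists>x\<in>?M i. \<exists>y\<in>?M j. {x, y} \<in> E"
    using assms(9) unfolding all_345 all_less_3 by simp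
qed

text \<open>Contracting \<open>v\<close> into \<open>u\<close> is undone by adding \<open>v\<close>
  to the branch set that contains \<open>u\<close>, if there is one. An edge at \<open>u\<close> in
  the contracted graph may stand for an edge at \<open>v\<close>, so this also restores
  connectedness and adjacency.\<close>

lemma K33_minor_contract:
  assumes uv: "{u, v} \<in> E" "u \<in> V" "v \<in> V" "u \<noteq> v"
    and minor: "K33_minor (V - {v}) ({e \<in> E. v \<notin> e} \<union> (\<lambda>w. {u, w}) ` (nbrs E v - {u}))" (is "K33_minor ?V ?E")
  shows "K33_minor V E"
proof -
  obtain M :: "nat \<Rightarrow> 'a set" where M0: "\<forall>i<6. M i \<subseteq> ?V \<and> connected_graph (induced ?E (M i))"
    "\<forall>i<6. \<forall>j<6. i \<noteq> j \<longrightarrow> M i \<inter> M j = {}" "\<forall>i<3. \<forall>j\<in>{3..<6}. \<exists>x\<in>M i. \<exists>y\<in>M j. {x, y} \<in> ?E"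
    using minor unfolding K33_minor_def by (elim exE conjE)
  have M: "M i \<subseteq> ?V \<and> connected_graph (induced ?E (M i))" if "i < 6" for i using M0(1) that by simp
  have Mdisj: "M i \<inter> M j = {}" if "i < 6" "j < 6" "i \<noteq> j" for i j using M0(2) that by simp
  have Madj: "\<exists>x\<in>M i. \<exists>y\<in>M j. {x, y} \<in> ?E" if "i < 3" "j \<in> {3..<6}" for i j using M0(3) that by simp
  define N where "N i = (if u \<in> M i then insert v (M i) else M i)" for i
  have MN: "M i \<subseteq> N i" for i by (auto simp: N_def)
  have E': "{x, y} \<in> E \<or> x = u \<and> {v, y} \<in> E \<or> y = u \<and> {v, x} \<in> E" if "{x, y} \<in> ?E" for x y
    using that
  proof
    assume "{x, y} \<in> (\<lambda>w. {u, w}) ` (nbrs E v - {u})"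
    then obtain w where w: "{x, y} = {u, w}" "{v, w} \<in> E" unfolding nbrs_def by blast
    then have "x = u \<and> y = w \<or> x = w \<and> y = u" by (simp add: doubleton_eq_iff)
    then show ?thesis using w(2) by blast
  qed simp
  have conn: "connected_graph (induced E (N i))" if "i < 6" for i
  proof -
    let ?R = "reach {e \<in> E. e \<subseteq> N i}"
    have symR: "(y, x) \<in> ?R" if "(x, y) \<in> ?R" for x y
      using that by (rule symD[OF sym_adj_rtrancl])
    have "{(x, y). {x, y} \<in> {e \<in> ?E. e \<subseteq> M i}} \<subseteq> ?R"
    proof (rule subrelI)
      fix x y assume "(x, y) \<in> {(x, y). {x, y} \<in> {e \<in> ?E. e \<subseteq> M i}}"
      then have xy: "{x, y} \<in> ?E" "x \<in> M i" "y \<in> M i" by auto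
      have via: "(u, w) \<in> ?R" if "u \<in> M i" "w \<in> M i" "{v, w} \<in> E" for w
      proof -
        have "(u, v) \<in> {(x, y). {x, y} \<in> {e \<in> E. e \<subseteq> N i}}" "(v, w) \<in> {(x, y). {x, y} \<in> {e \<in> E. e \<subseteq> N i}}"
          using that uv(1) by (auto simp: N_def)
        then show ?thesis by (meson r_into_rtrancl rtrancl_into_rtrancl)
      qed
      from E'[OF xy(1)] show "(x, y) \<in> ?R"
      proof (elim disjE conjE)
        assume "{x, y} \<in> E"
        then have "(x, y) \<in> {(x, y). {x, y} \<in> {e \<in> E. e \<subseteq> N i}}" using xy MN by auto
        then show ?thesis by (rule r_into_rtrancl)
      next
        assume "x = u" "{v, y} \<in> E"
        then show ?thesis using via[of y] xy by simp
      next
        assume "y = u" "{v, x} \<in> E"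
        then show ?thesis using symR[OF via[of x]] xy by simp
      qed
    qed
    then have sub: "reach {e \<in> ?E. e \<subseteq> M i} \<subseteq> ?R" by (rule rtrancl_subset_rtrancl)
    have MM: "(x, y) \<in> ?R" if "x \<in> M i" "y \<in> M i" for x y
      using M[OF \<open>i < 6\<close>] sub that by (auto simp: connected_graph_def induced_def)
    have "M i \<noteq> {}" using M[OF \<open>i < 6\<close>] by (simp add: connected_graph_def induced_def)
    then have "\<exists>r. r \<in> M i \<and> (u \<in> M i \<longrightarrow> r = u)" by (cases "u \<in> M i") auto
    then obtain r where r: "r \<in> M i" "u \<in> M i \<longrightarrow> r = u" by blast
    have "(r, x) \<in> ?R" if "x \<in> N i" for x
    proof (cases "x \<in> M i")
      case True then show ?thesis using MM r by blast
    next
      case False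
      then have "x = v" "u \<in> M i" using that by (auto simp: N_def split: if_splits)
      then have "(r, x) \<in> {(x, y). {x, y} \<in> {e \<in> E. e \<subseteq> N i}}" using r uv(1) by (auto simp: N_def)
      then show ?thesis by (rule r_into_rtrancl)
    qed
    moreover have "r \<in> N i" using r(1) MN by blast
    ultimately show ?thesis using connected_graph_alt[of r "induced E (N i)"] by (simp add: induced_def)
  qed
  have vM: "v \<notin> M i" if "i < 6" for i using M[OF that] by blast
  have "N i \<inter> N j = {}" if "i < 6" "j < 6" "i \<noteq> j" for i j
    using Mdisj[OF that] vM[OF that(1)] vM[OF that(2)] by (auto simp: N_def)
  moreover have "N i \<subseteq> V" if "i < 6" for i using M[OF that] uv(3) by (auto simp: N_def)
  moreover have "\<exists>x\<in>N i. \<exists>y\<in>N j. {x, y} \<in> E" if ij: "i < 3" "j \<in> {3..<6}" for i j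
  proof -
    obtain x y where xy: "x \<in> M i" "y \<in> M j" "{x, y} \<in> ?E" using Madj[OF ij] by blast
    then have xyN: "x \<in> N i" "y \<in> N j" using MN by blast+
    from E'[OF xy(3)] show ?thesis
    proof (elim disjE conjE)
      assume "{x, y} \<in> E" then show ?thesis using xyN by blast
    next
      assume "x = u" "{v, y} \<in> E"
      moreover have "v \<in> N i" using xy(1) \<open>x = u\<close> by (simp add: N_def)
      ultimately show ?thesis using xyN by blast
    next
      assume "y = u" "{v, x} \<in> E"
      moreover have "v \<in> N j" using xy(2) \<open>y = u\<close> by (simp add: N_def)
      moreover have "{x, v} \<in> E" using \<open>{v, x} \<in> E\<close> by (simp add: insert_commute)
      ultimately show ?thesis using xyN by blast
    qed
  qed
  ultimately show ?thesis unfolding K33_minor_def using conn by (intro exI[of _ N]) simp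
qed

text \<open>If every edge at a vertex \<open>v\<close> of degree \<open>5\<close> lies in three triangles, then the neighbours of \<open>v\<close>
  induce \<open>K\<^sub>5\<close> minus a matching; two of them together with \<open>v\<close> form one side of a \<open>K\<^sub>3\<^sub>,\<^sub>3\<close>.\<close>

lemma K33_minor_degree_5:
  assumes N: "N = nbrs E v" "card N = 5" "N \<subseteq> V" "v \<in> V" "v \<notin> N" and loopless: "\<And>u. u \<notin> nbrs E u"
    and tri: "\<And>u. u \<in> N \<Longrightarrow> card (N \<inter> nbrs E u) \<ge> 3"
  shows "K33_minor V E"
proof -
  have fin: "finite N" using N(2) by (simp add: card_ge_0_finite)
  have "\<exists>a b. a \<in> N \<and> b \<in> N \<and> a \<noteq> b \<and> N - {a, b} \<subseteq> nbrs E a \<inter> nbrs E b"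
  proof (cases "\<exists>a b. a \<in> N \<and> b \<in> N \<and> a \<noteq> b \<and> b \<notin> nbrs E a")
    case True
    then obtain a b where ab: "a \<in> N" "b \<in> N" "a \<noteq> b" "b \<notin> nbrs E a" by blast
    then have ab': "a \<notin> nbrs E b" by (auto simp: nbrs_def insert_commute)
    have c3: "card (N - {a, b}) = 3" using ab N(2) by (simp add: card_Diff_subset)
    have "N \<inter> nbrs E a \<subseteq> N - {a, b}" "N \<inter> nbrs E b \<subseteq> N - {a, b}" using ab ab' loopless by blast+
    then have "N \<inter> nbrs E a = N - {a, b}" "N \<inter> nbrs E b = N - {a, b}"
      using tri[OF ab(1)] tri[OF ab(2)] c3 fin card_seteq[of "N - {a, b}"] by auto
    then show ?thesis using ab by blast
  next
    case False
    have "N \<noteq> {}" using N(2) by (metis card.empty zero_neq_numeral)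
    then obtain a where a: "a \<in> N" by blast
    have "card (N - {a}) = 4" using a N(2) by simp
    then have "N - {a} \<noteq> {}" by (metis card.empty zero_neq_numeral)
    then obtain b where "b \<in> N" "b \<noteq> a" by blast
    then show ?thesis using a False by blast
  qed
  then obtain a b where ab: "a \<in> N" "b \<in> N" "a \<noteq> b" "N - {a, b} \<subseteq> nbrs E a \<inter> nbrs E b" by blast
  have "card (N - {a, b}) = 3" using ab N(2) by (simp add: card_Diff_subset)
  then obtain c d e where cde: "N - {a, b} = {c, d, e}" "c \<noteq> d" "d \<noteq> e" "c \<noteq> e" by (auto simp: card_3_iff)
  have va: "v \<noteq> a" "v \<noteq> b" "v \<notin> {c, d, e}" using N(5) ab cde(1) by blast+
  have abc: "a \<notin> {c, d, e}" "b \<notin> {c, d, e}" unfolding cde(1)[symmetric] by blast+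
  have "{c, d, e} \<subseteq> nbrs E v" using cde(1) N(1) by blast
  moreover have "{c, d, e} \<subseteq> nbrs E a \<inter> nbrs E b" using cde(1) ab(4) by simp
  ultimately have adj: "{x, y} \<in> E" if "x \<in> {v, a, b}" "y \<in> {c, d, e}" for x y
    using that unfolding nbrs_def by blast
  have inV: "a \<in> V" "b \<in> V" "c \<in> V" "d \<in> V" "e \<in> V" using cde(1) ab N(3) by blast+
  let ?A = "\<lambda>i::nat. {[v, a, b] ! i}" and ?B = "\<lambda>i::nat. {[c, d, e] ! i}"
  show ?thesis
    by (rule K33_minorI[of ?A V E ?B])
      (use inV N(4) va abc ab(3) cde(2-4) adj in \<open>auto simp: all_less_3 connected_induced_singleton\<close>)
qed

text \<open>Here \<open>v\<close> and \<open>N\<close> form a \<open>K\<^sub>5\<close>. A component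
  \<open>D\<close> of the rest with three neighbours in \<open>N\<close> gives the minor at once:
  \<open>{v}\<close>, the fourth vertex \<open>{d}\<close> and \<open>D\<close> against these three.
  Otherwise an adjacent pair in \<open>N\<close> separates \<open>D\<close> from the remaining
  vertices, and one of the two parts is still dense enough for induction.\<close>

lemma K33_minor_degree_4:
  fixes V :: "'a set"
  assumes G: "finite_simple_graph (Graph V E)" and E: "card E + 4 = 3 * card V"
    and N: "N = nbrs E v" "card N = 4" "v \<in> V"
    and tri: "\<And>u. u \<in> N \<Longrightarrow> card (N \<inter> nbrs E u) \<ge> 3"
    and IH: "\<And>(V' :: 'a set) E'. card V' < card V \<Longrightarrow> finite_simple_graph (Graph V' E') \<Longrightarrow> card V' \<ge> 2 \<Longrightarrow>
      3 * card V' \<le> card E' + 4 \<Longrightarrow> K33_minor V' E'"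
  shows "K33_minor V E"
proof -
  note sg = finite_simple_graphD[OF G, simplified]
  have NV: "N \<subseteq> V - {v}" using nbrs_simple[OF G, of v] N(1) by simp
  have fin: "finite N" using N(2) by (simp add: card_ge_0_finite)
  have adj: "{x, y} \<in> E" if "x \<in> N" "y \<in> N" "x \<noteq> y" for x y
  proof -
    have "N \<inter> nbrs E x \<subseteq> N - {x}" using nbrs_simple[OF G, of x] by auto
    moreover have "card (N - {x}) = 3" using that N(2) by simp
    ultimately have "N \<inter> nbrs E x = N - {x}" using tri[OF that(1)] fin by (intro card_seteq) auto
    then have "y \<in> nbrs E x" using that by blast
    then show ?thesis by (simp add: nbrs_def)
  qed
  \<comment> \<open>On five vertices there are only 10 edges, one fewer than the 11
    required.\<close>
  have "V \<noteq> insert v N"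
  proof
    assume V: "V = insert v N"
    have "v \<notin> N" using NV by blast
    then have cV: "card V = 5" using N(2) V fin by simp
    have "E \<subseteq> {e. e \<subseteq> V \<and> card e = 2}" using sg(3,4) by blast
    then have "card E \<le> card {e. e \<subseteq> V \<and> card e = 2}" using sg(1) by (intro card_mono) auto
    also have "\<dots> = 10" using n_subsets[OF sg(1), of 2] cV by (simp add: choose_two)
    finally show False using E cV by simp
  qed
  then obtain z where z: "z \<in> V" "z \<notin> insert v N" using NV N(3) by blast
  define Z where "Z = V - insert v N"
  define D where "D = {x. (z, x) \<in> reach {e \<in> E. e \<subseteq> Z}}"
  have zD: "z \<in> D" by (simp add: D_def)
  have DZ: "D \<subseteq> Z"
  proof
    fix x assume "x \<in> D"
    then have "(z, x) \<in> reach {e \<in> E. e \<subseteq> Z}" by (simp add: D_def)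
    then show "x \<in> Z" by (induction rule: rtrancl_induct) (use z in \<open>auto simp: Z_def\<close>)
  qed
  have Dclosed: "y \<in> D" if "x \<in> D" "{x, y} \<in> E" "y \<in> Z" for x y
  proof -
    have "(x, y) \<in> {(x, y). {x, y} \<in> {e \<in> E. e \<subseteq> Z}}" using that DZ by auto
    then show ?thesis using that(1) unfolding D_def by (auto intro: rtrancl_into_rtrancl)
  qed
  have Dconn: "connected_graph (induced E D)"
  proof -
    have "(z, x) \<in> reach {e \<in> E. e \<subseteq> D}" if "x \<in> D" for x
    proof -
      have "(z, x) \<in> reach {e \<in> E. e \<subseteq> Z}" using that by (simp add: D_def)
      then show ?thesis
      proof (induction rule: rtrancl_induct)
        case (step x y)
        have "x \<in> D" using step(1) by (simp add: D_def)
        moreover from step(1,2) have "y \<in> D" unfolding D_def by (auto intro: rtrancl_into_rtrancl)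
        ultimately have "(x, y) \<in> {(x, y). {x, y} \<in> {e \<in> E. e \<subseteq> D}}" using step(2) by auto
        with step(3) show ?case by (rule rtrancl_into_rtrancl)
      qed simp
    qed
    then show ?thesis using connected_graph_alt[of z "induced E D"] zD by (simp add: induced_def)
  qed
  have DN: "y \<in> D \<union> N" if "x \<in> D" "{x, y} \<in> E" for x y
  proof -
    have "y \<in> V" using that(2) sg(3) by blast
    moreover have "y \<noteq> v"
    proof
      assume "y = v"
      then have "x \<in> N" using that(2) N(1) by (simp add: nbrs_def insert_commute)
      then show False using that(1) DZ by (auto simp: Z_def)
    qed
    ultimately show ?thesis using Dclosed[OF that] by (auto simp: Z_def)
  qed
  define ND where "ND = {y \<in> N. \<exists>x\<in>D. {x, y} \<in> E}"
  have finD: "finite D" using DZ sg(1) unfolding Z_def by (meson finite_Diff finite_subset)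
  show ?thesis
  proof (cases "card ND \<ge> 3")
    case True
    then obtain T where T: "T \<subseteq> ND" "card T = 3" by (meson obtain_subset_with_card_n)
    then obtain a b c where abc: "T = {a, b, c}" "a \<noteq> b" "b \<noteq> c" "a \<noteq> c" by (auto simp: card_3_iff)
    have abcN: "a \<in> N" "b \<in> N" "c \<in> N" and abcD: "\<And>y. y \<in> {a, b, c} \<Longrightarrow> \<exists>x\<in>D. {x, y} \<in> E"
      using T(1) abc(1) by (auto simp: ND_def)
    have "card (N - {a, b, c}) = 1" using N(2) abcN abc by (simp add: card_Diff_subset)
    then have "N - {a, b, c} \<noteq> {}" by (metis card.empty zero_neq_one)
    then obtain d where d: "d \<in> N" "d \<notin> {a, b, c}" by blast
    have vadj: "{v, y} \<in> E" if "y \<in> N" for y using that N(1) by (simp add: nbrs_def)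
    have nD: "v \<notin> D" "a \<notin> D" "b \<notin> D" "c \<notin> D" "d \<notin> D" using DZ abcN d(1) by (auto simp: Z_def)
    have nv: "v \<noteq> a" "v \<noteq> b" "v \<noteq> c" "v \<noteq> d" using NV abcN d(1) by blast+
    have inV: "a \<in> V" "b \<in> V" "c \<in> V" "d \<in> V" "D \<subseteq> V" using NV abcN d(1) DZ by (auto simp: Z_def)
    have dadj: "{d, y} \<in> E" if "y \<in> {a, b, c}" for y using adj[of d y] that d abcN by auto
    let ?A = "\<lambda>i::nat. [{v}, {d}, D] ! i" and ?B = "\<lambda>i::nat. {[a, b, c] ! i}"
    show ?thesis
      by (rule K33_minorI[of ?A V E ?B])
        (use inV N(3) nv nD d abc(2-4) vadj dadj abcN abcD Dconn in \<open>auto simp: all_less_3 connected_induced_singleton\<close>)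
  next
    case False
    have "ND \<subseteq> N" by (auto simp: ND_def)
    moreover have "card ND \<le> 2" using False by simp
    \<comment> \<open>\<open>ND\<close> may have fewer than two vertices; padding it inside
      \<open>N\<close> makes \<open>K\<close> a pair that spans an edge.\<close>
    ultimately obtain K where K: "ND \<subseteq> K" "K \<subseteq> N" "card K = 2"
      using exists_subset_between[of ND 2 N] fin N(2) by auto
    then obtain a b where ab: "K = {a, b}" "a \<noteq> b" by (auto simp: card_2_iff)
    define V1 E1 V2 E2 where "V1 = V - D" and "E1 = {e \<in> E. e \<subseteq> V1}" and "V2 = D \<union> K" and "E2 = {e \<in> E. e \<subseteq> V2}"
    have DV: "D \<subseteq> V" and KD: "K \<inter> D = {}" using DZ K(2) by (auto simp: Z_def)
    have "E \<subseteq> E1 \<union> E2"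
    proof
      fix e assume e: "e \<in> E"
      show "e \<in> E1 \<union> E2"
      proof (cases "e \<inter> D = {}")
        case True
        then show ?thesis using e sg(3) by (auto simp: E1_def V1_def)
      next
        case False
        then obtain x where x: "x \<in> e" "x \<in> D" by blast
        obtain y where y: "e = {x, y}"
          using sg(4)[OF e] x(1) by (auto simp: card_2_iff)
        have "y \<in> D \<union> K"
          using DN[OF x(2)] e y K(1) x(2) by (auto simp: ND_def)
        then show ?thesis using e x y by (auto simp: E2_def V2_def)
      qed
    qed
    then have E12: "E1 \<union> E2 = E" by (auto simp: E1_def E2_def)
    have finE: "finite E1" "finite E2" using sg(2) by (auto simp: E1_def E2_def)
    have "{a, b} \<in> E" using adj[of a b] ab K(2) by auto
    then have "{a, b} \<in> E1 \<inter> E2" using ab KD K(2) NV by (auto simp: E1_def E2_def V1_def V2_def)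
    then have "card (E1 \<inter> E2) \<ge> 1" using finE by (metis One_nat_def Suc_leI card_gt_0_iff empty_iff finite_Int)
    then have cE: "card E + 1 \<le> card E1 + card E2" using card_Un_Int[OF finE] E12 by simp
    have cD: "card D \<ge> 1" using zD finD by (metis One_nat_def Suc_leI card_gt_0_iff empty_iff)
    have cV: "card V \<ge> card D + 5"
    proof -
      have "D \<union> insert v N \<subseteq> V" "D \<inter> insert v N = {}" using DZ NV N(3) by (auto simp: Z_def)
      then have "card D + card (insert v N) \<le> card V" using sg(1) finD fin
        by (metis card_Un_disjoint card_mono finite_insert)
      moreover have "v \<notin> N" using NV by blast
      ultimately show ?thesis using N(2) fin by simp
    qed
    have c1: "card V1 = card V - card D" unfolding V1_def using DV finD by (simp add: card_Diff_subset)
    have c2: "card V2 = card D + 2"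
      unfolding V2_def using KD K(3) finD fin K(2) by (subst card_Un_disjoint) (auto intro: finite_subset)
    have s1: "finite_simple_graph (Graph V1 E1)" and s2: "finite_simple_graph (Graph V2 E2)"
      using sg finD finite_subset[OF K(2) fin] by (auto simp: finite_simple_graph_def E1_def E2_def V1_def V2_def)
    have m1: "K33_minor V1 E1" if "3 * card V1 \<le> card E1 + 4"
      using IH[OF _ s1] that c1 cD cV by simp
    have m2: "K33_minor V2 E2" if "3 * card V2 \<le> card E2 + 4"
      using IH[OF _ s2] that c2 cD cV by simp
    \<comment> \<open>Let n1 + n2 = n + 2 be the orders of the parts. With at most 3 n1 - 5 and 3 n2
      - 5 edges in them, and the edge on \<open>K\<close> counted twice, \<open>E\<close> would have
      at most 3n - 5 edges.\<close>
    have "3 * card V1 \<le> card E1 + 4 \<or> 3 * card V2 \<le> card E2 + 4"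
      using cE c1 c2 cV E by linarith
    moreover have "V1 \<subseteq> V" "V2 \<subseteq> V" "E1 \<subseteq> E" "E2 \<subseteq> E" using DV K(2) NV by (auto simp: V1_def V2_def E1_def E2_def)
    ultimately show ?thesis using m1 m2 K33_minor_mono by metis
  qed
qed

text \<open>If all degrees were at least 6, counting each edge at both of its ends would give 6n
  \<le> 2e.\<close>

lemma ex_degree_le_5:
  assumes G: "finite_simple_graph G" and few: "card (edges G) < 3 * card (verts G)"
  shows "\<exists>v\<in>verts G. card (nbrs (edges G) v) \<le> 5"
proof (rule ccontr)
  assume "\<not> ?thesis"
  then have ge: "6 \<le> card {e \<in> edges G. v \<in> e}" if "v \<in> verts G" for v
    using card_edges_at[OF G, of v] that by fastforce
  have "card {v \<in> verts G. v \<in> e} = 2" if "e \<in> edges G" for e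
  proof -
    have "{v \<in> verts G. v \<in> e} = e" using finite_simple_graphD(3)[OF G that] by blast
    then show ?thesis using finite_simple_graphD(4)[OF G that] by simp
  qed
  then have "(\<Sum>v\<in>verts G. card {e \<in> edges G. v \<in> e}) = 2 * card (edges G)"
    using finite_simple_graphD(1,2)[OF G] by (intro sum_multicount) auto
  moreover have "(\<Sum>v\<in>verts G. 6) \<le> (\<Sum>v\<in>verts G. card {e \<in> edges G. v \<in> e})"
    by (rule sum_mono) (rule ge)
  ultimately show False using few by simp
qed

theorem K33_minor_dense:
  fixes V :: "'a set"
  assumes "finite_simple_graph (Graph V E)" "card V \<ge> 2" "3 * card V \<le> card E + 4"
  shows "K33_minor V E"
  using assms
proof (induction "card V" arbitrary: V E rule: less_induct)
  case less
  note sg = finite_simple_graphD[OF less.prems(1), simplified]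
  have "3 * card V - 4 \<le> card E" using less.prems(3) by simp
  \<comment> \<open>Surplus edges are discarded: with exactly 3n - 4 edges the average degree is
    below 6, and there is a vertex of degree at most 5.\<close>
  then obtain F where F: "F \<subseteq> E" "card F = 3 * card V - 4" by (meson obtain_subset_with_card_n)
  then have cF: "card F + 4 = 3 * card V" using less.prems(2) by simp
  have G: "finite_simple_graph (Graph V F)" using sg F(1) by (auto simp: finite_simple_graph_def)
  note sF = finite_simple_graphD[OF G, simplified]
  have IH: "K33_minor V' E'" if "card V' < card V" "finite_simple_graph (Graph V' E')" "card V' \<ge> 2" "3 * card V' \<le> card E' + 4" for V' :: "'a set" and E'
    using less.hyps[of V' E'] that by blast
  have n3: "card V \<ge> 3"
  proof (rule ccontr)
    assume "\<not> card V \<ge> 3"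
    then have c2: "card V = 2" using less.prems(2) by simp
    have "F \<subseteq> {V}"
    proof
      fix e assume "e \<in> F"
      then have "e \<subseteq> V" "card e = card V" using sF(3,4) c2 by auto
      then show "e \<in> {V}" using card_subset_eq[OF sF(1)] by blast
    qed
    then have "card F \<le> 1" using card_mono[of "{V}" F] by simp
    then show False using cF c2 by simp
  qed
  have "\<exists>v\<in>V. card (nbrs F v) \<le> 5" using ex_degree_le_5[OF G] cF by simp
  then obtain v where v: "v \<in> V" "card (nbrs F v) \<le> 5" by blast
  define N where "N = nbrs F v"
  have NV: "N \<subseteq> V - {v}" using nbrs_simple[OF G, of v] by (simp add: N_def)
  have finN: "finite N" using NV sF(1) by (meson finite_Diff finite_subset)
  have cv: "card (V - {v}) = card V - 1" using v(1) by simp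
  have "K33_minor V F"
  proof (cases "N = {}")
    case True
    have "v \<notin> e" if "e \<in> F" for e
      using edges_at_eq[OF G, of v] that True by (auto simp: N_def)
    then have "finite_simple_graph (Graph (V - {v}) F)" using sF by (auto simp: finite_simple_graph_def)
    then have "K33_minor (V - {v}) F" using IH[of "V - {v}" F] n3 cv cF by simp
    then show ?thesis by (rule K33_minor_mono) auto
  next
    case False
    show ?thesis
    proof (cases "\<forall>u\<in>N. card (N \<inter> nbrs F u) \<ge> 3")
      \<comment> \<open>Contracting \<open>v\<close> into \<open>u\<close> loses their edge and one
        edge for each triangle on it, three edges at most. This is what the bound allows for one
        vertex fewer.\<close>
      case False
      then obtain u where u: "u \<in> N" "card (N \<inter> nbrs F u) \<le> 2" by force
      define F' where "F' = {e \<in> F. v \<notin> e} \<union> (\<lambda>w. {u, w}) ` (N - {u})"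
      have uV: "u \<in> V" "u \<noteq> v" "{u, v} \<in> F" using u(1) NV by (auto simp: N_def nbrs_def insert_commute)
      have s: "finite_simple_graph (Graph (V - {v}) F')"
        using sF uV NV by (auto simp: finite_simple_graph_def F'_def)
      let ?new = "(\<lambda>w. {u, w}) ` (N - {u} - nbrs F u)"
      have finF': "finite F'" using finite_simple_graphD(2)[OF s] by simp
      have "{e \<in> F. v \<notin> e} \<inter> ?new = {}" by (auto simp: nbrs_def)
      then have "card ({e \<in> F. v \<notin> e} \<union> ?new) = card {e \<in> F. v \<notin> e} + card ?new"
        using sF(2) finN by (intro card_Un_disjoint) auto
      moreover have "card ({e \<in> F. v \<notin> e} \<union> ?new) \<le> card F'"
        using finF' by (intro card_mono) (auto simp: F'_def)
      moreover have "card ?new = card (N - {u} - nbrs F u)"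
        by (rule card_image) (auto simp: inj_on_def doubleton_eq_iff)
      moreover have "card F = card {e \<in> F. v \<notin> e} + card N"
      proof -
        have "F = {e \<in> F. v \<notin> e} \<union> {e \<in> F. v \<in> e}" by blast
        then have "card F = card {e \<in> F. v \<notin> e} + card {e \<in> F. v \<in> e}"
          using sF(2) by (metis (no_types, lifting) card_Un_disjoint disjoint_iff finite_Un mem_Collect_eq)
        then show ?thesis using card_edges_at[OF G, of v] by (simp add: N_def)
      qed
      moreover have "card N \<le> card (N - {u} - nbrs F u) + 3"
      proof -
        have "N = (N - {u} - nbrs F u) \<union> ({u} \<union> (N \<inter> nbrs F u))" using u(1) by blast
        then have "card N \<le> card (N - {u} - nbrs F u) + card ({u} \<union> (N \<inter> nbrs F u))"
          by (metis card_Un_le)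
        also have "card ({u} \<union> (N \<inter> nbrs F u)) \<le> 1 + card (N \<inter> nbrs F u)"
          using card_Un_le[of "{u}" "N \<inter> nbrs F u"] by simp
        finally show ?thesis using u(2) by simp
      qed
      ultimately have "card F \<le> card F' + 3" by linarith
      then have "K33_minor (V - {v}) F'" using IH[of "V - {v}" F'] s n3 cv cF by simp
      then show ?thesis using K33_minor_contract[OF uV(3,1) v(1) uV(2)] by (simp add: F'_def N_def)
    next
      case True
      \<comment> \<open>\<open>N\<close> contains \<open>u\<close> and at least three neighbours of
        \<open>u\<close>, so the degree of \<open>v\<close> is 4 or 5.\<close>
      obtain u where u: "u \<in> N" using False by blast
      have "N \<inter> nbrs F u \<subseteq> N - {u}" using nbrs_simple[OF G, of u] by auto
      then have "card (N \<inter> nbrs F u) \<le> card (N - {u})" using finN by (intro card_mono) auto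
      moreover have "card (N - {u}) = card N - 1" using u by simp
      ultimately have "card N \<ge> 4" using True u by fastforce
      then consider "card N = 4" | "card N = 5" using v(2)[folded N_def] by linarith
      then show ?thesis
      proof cases
        case 1
        show ?thesis by (rule K33_minor_degree_4[OF G cF N_def 1 v(1)]) (use True IH in auto)
      next
        case 2
        have "w \<notin> nbrs F w" for w using nbrs_simple[OF G, of w] by auto
        then show ?thesis by (intro K33_minor_degree_5[OF N_def 2 _ v(1)]) (use True NV in auto)
      qed
    qed
  qed
  then show ?case by (rule K33_minor_mono[OF _ subset_refl F(1)])
qed

section \<open>Planarity\<close>

subsection \<open>Crossing chords of a Jordan curve\<close>

text \<open>A chord is used through its interior, which is connected, nonempty and touches the curve
  at both ends of the chord.\<close>

lemma arc_connected_interior: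
  fixes g :: "real \<Rightarrow> complex"
  assumes "arc g"
  shows "connected (path_image g - {pathstart g, pathfinish g})"
    and "path_image g - {pathstart g, pathfinish g} = g ` {0<..<1}"
    and "g (1/2) \<in> path_image g - {pathstart g, pathfinish g}"
    and "pathstart g \<in> closure (path_image g - {pathstart g, pathfinish g})"
    and "pathfinish g \<in> closure (path_image g - {pathstart g, pathfinish g})"
proof -
  have inj: "inj_on g {0..1}" and cont: "continuous_on {0..1} g"
    using assms by (auto simp: arc_def path_def)
  have "g ` ({0..1} - {0, 1}) = g ` {0..1} - g ` {0, 1}"
    by (rule inj_on_image_set_diff[OF inj]) auto
  moreover have "{0..1} - {0, 1} = {0<..<1::real}" by auto
  ultimately show eq: "path_image g - {pathstart g, pathfinish g} = g ` {0<..<1}"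
    by (simp add: path_image_def pathstart_def pathfinish_def)
  have "continuous_on {0<..<1} g" using cont by (rule continuous_on_subset) auto
  then show "connected (path_image g - {pathstart g, pathfinish g})"
    unfolding eq by (rule connected_continuous_image) simp
  show "g (1/2) \<in> path_image g - {pathstart g, pathfinish g}" unfolding eq by auto
  have "g ` closure {0<..<1} \<subseteq> closure (g ` {0<..<1})"
    using cont by (intro image_closure_subset) (auto simp: closure_subset)
  then have "g ` {0..1} \<subseteq> closure (g ` {0<..<1})" by simp
  then show "pathstart g \<in> closure (path_image g - {pathstart g, pathfinish g})"
    "pathfinish g \<in> closure (path_image g - {pathstart g, pathfinish g})"
    unfolding eq by (auto simp: pathstart_def pathfinish_def)
qed

lemma connected_subset_disjoint_open:
  assumes "connected T" "open U" "open V" "U \<inter> V = {}" "T \<subseteq> U \<union> V"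
  shows "T \<subseteq> U \<or> T \<subseteq> V"
  using connectedD[OF assms(1-3)] assms(4,5) by blast

lemma Jordan_loop:
  fixes g1 g2 :: "real \<Rightarrow> complex"
  assumes "arc g1" "arc g2" "pathstart g1 = u" "pathfinish g1 = w" "pathstart g2 = u" "pathfinish g2 = w"
    and "path_image g1 \<inter> path_image g2 \<subseteq> {u, w}"
  obtains U V where "open U" "connected U" "U \<noteq> {}" "open V" "connected V" "V \<noteq> {}" "U \<inter> V = {}"
    "U \<union> V = - (path_image g1 \<union> path_image g2)"
    "path_image g1 \<union> path_image g2 \<subseteq> closure U" "path_image g1 \<union> path_image g2 \<subseteq> closure V"
proof -
  let ?c = "g1 +++ reversepath g2"
  have c: "simple_path ?c"
    using assms by (intro simple_path_join_loop) (auto simp: arc_reversepath)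
  have l: "pathfinish ?c = pathstart ?c" using assms by simp
  have im: "path_image ?c = path_image g1 \<union> path_image g2" using assms by (simp add: path_image_join)
  obtain U V where UV: "U \<noteq> {}" "open U" "connected U" "V \<noteq> {}" "open V" "connected V" "U \<inter> V = {}"
    "U \<union> V = - path_image ?c" "frontier U = path_image ?c" "frontier V = path_image ?c"
    using Jordan_curve[OF c l] by metis
  have "path_image ?c \<subseteq> closure U" "path_image ?c \<subseteq> closure V"
    using UV(9,10) by (auto simp: frontier_def)
  with UV that[of U V] show thesis unfolding im by blast
qed

text \<open>Seen from the other side of the curve, the chord \<open>g\<close> is avoided by a connection to \<open>z\<close> through
  either of the two arcs; Janiszewski's theorem then yields a connection that avoids both.\<close>

lemma crossing_chords_separated:
  fixes g1 g2 g :: "real \<Rightarrow> complex"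
  assumes arcs: "arc g1" "arc g2" "arc g" and ends: "pathstart g1 = u" "pathfinish g1 = w"
      "pathstart g2 = u" "pathfinish g2 = w" "pathstart g = u" "pathfinish g = w"
    and int: "path_image g1 \<inter> path_image g2 \<subseteq> {u, w}" "path_image g1 \<inter> path_image g \<subseteq> {u, w}"
      "path_image g2 \<inter> path_image g \<subseteq> {u, w}"
    and D: "connected D" "D \<inter> (path_image g1 \<union> path_image g2 \<union> path_image g) = {}"
      "p \<in> closure D" "p \<in> path_image g1 - {u, w}" "q \<in> closure D" "q \<in> path_image g2 - {u, w}"
    and yz: "y \<in> path_image g - {u, w}" "z \<in> D"
  shows "\<not> connected_component (- (path_image g1 \<union> path_image g2)) y z"
proof
  let ?C = "path_image g1 \<union> path_image g2"
  assume cc: "connected_component (- ?C) y z"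
  obtain U V where UV: "open U" "connected U" "U \<noteq> {}" "open V" "connected V" "V \<noteq> {}" "U \<inter> V = {}" "U \<union> V = - ?C"
    "?C \<subseteq> closure U" "?C \<subseteq> closure V"
    using Jordan_loop[OF arcs(1,2) ends(1-4) int(1)] by metis
  obtain T where T: "connected T" "T \<subseteq> - ?C" "y \<in> T" "z \<in> T"
    using cc unfolding connected_component_def by blast
  have uw: "u \<in> path_image g1" "w \<in> path_image g1" "u \<in> path_image g2" "w \<in> path_image g2" "u \<in> path_image g" "w \<in> path_image g"
    using ends pathstart_in_path_image pathfinish_in_path_image by metis+
  let ?T = "T \<union> (path_image g - {u, w})"
  have "connected (path_image g - {u, w})" using arc_connected_interior(1)[OF arcs(3)] ends by simp
  then have T': "connected ?T" using T yz by (intro connected_Un) auto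
  have TC: "?T \<inter> ?C = {}" using T(2) int by blast
  \<comment> \<open>\<open>A\<close> is the side of the curve that contains \<open>g\<close> and
    \<open>B\<close> the other one; leaving the roles open covers both components at once.\<close>
  have one_side: False
    if side: "open A" "open B" "connected B" "B \<noteq> {}" "A \<inter> B = {}" "A \<union> B = - ?C" "?C \<subseteq> closure B" "?T \<subseteq> A" for A B
  proof -
    obtain i where i: "i \<in> B" using side(4) by blast
    have BC: "B \<inter> ?C = {}" using side(6) by blast
    have "path_image g \<subseteq> A \<union> ?C" using side(8) uw by blast
    then have Bg: "B \<inter> path_image g = {}" using side(5) BC by blast
    \<comment> \<open>From \<open>z\<close> the way leads through \<open>D\<close> to the contact
      point \<open>r\<close>, and on into \<open>B\<close>, whose closure contains \<open>r\<close>
      too. It avoids \<open>g\<close> and the one arc \<open>h\<close> on which \<open>r\<close>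
      does not lie.\<close>
    have via: "connected_component (- (path_image h \<union> path_image g)) z i"
      if h: "r \<in> closure D" "r \<in> ?C" "r \<notin> path_image h" "r \<notin> path_image g" "path_image h \<subseteq> ?C" for r h
    proof -
      have "connected (insert r B)"
        by (rule connected_intermediate_closure[OF side(3)]) (use side(7) h(2) closure_subset in auto)
      moreover have "connected (insert r D)"
        by (rule connected_intermediate_closure[OF D(1)]) (use h(1) closure_subset in auto)
      ultimately have "connected (insert r B \<union> insert r D)" by (intro connected_Un) auto
      moreover have "insert r B \<union> insert r D \<subseteq> - (path_image h \<union> path_image g)"
        using BC Bg D(2) h by blast
      ultimately show ?thesis using i yz(2) unfolding connected_component_def by blast
    qed
    have "connected_component (- ((path_image g1 \<union> path_image g) \<union> (path_image g2 \<union> path_image g))) z i"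
    proof (rule Janiszewski)
      show "compact (path_image g1 \<union> path_image g)" using arcs by (simp add: compact_Un compact_arc_image)
      show "closed (path_image g2 \<union> path_image g)" using arcs by (simp add: closed_Un closed_arc_image)
      have "(path_image g1 \<union> path_image g) \<inter> (path_image g2 \<union> path_image g) = path_image g"
        using int uw by blast
      then show "connected ((path_image g1 \<union> path_image g) \<inter> (path_image g2 \<union> path_image g))"
        using arcs by (simp add: connected_arc_image)
      show "connected_component (- (path_image g1 \<union> path_image g)) z i"
        by (rule via[of q]) (use D int in auto)
      show "connected_component (- (path_image g2 \<union> path_image g)) z i"
        by (rule via[of p]) (use D int in auto)
    qed
    then obtain S where S: "connected S" "S \<subseteq> - ?C" "z \<in> S" "i \<in> S"
      unfolding connected_component_def by blast
    have "A \<inter> S \<noteq> {}" "B \<inter> S \<noteq> {}" using S(3,4) i T(4) side(8) by blast+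
    then show False using connectedD[OF S(1) side(1,2)] side(5,6) S(2) by blast
  qed
  have "?T \<subseteq> - ?C" using TC by (simp only: disjoint_eq_subset_Compl)
  then have "?T \<subseteq> U \<or> ?T \<subseteq> V"
    unfolding UV(8)[symmetric] by (rule connected_subset_disjoint_open[OF T' UV(1,4,7)])
  then show False
  proof
    assume "?T \<subseteq> U"
    show False by (rule one_side[OF UV(1,4,5,6,7,8,10) \<open>?T \<subseteq> U\<close>])
  next
    assume "?T \<subseteq> V"
    show False by (rule one_side[OF UV(4,1,2,3) _ _ UV(9) \<open>?T \<subseteq> V\<close>]) (use UV(7,8) in blast)+
  qed
qed

definition K33_arcs :: "(nat \<Rightarrow> complex) \<Rightarrow> (nat \<Rightarrow> complex) \<Rightarrow> (nat \<Rightarrow> nat \<Rightarrow> real \<Rightarrow> complex) \<Rightarrow> bool" where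
  "K33_arcs a b g \<longleftrightarrow>
     (\<forall>i<3. \<forall>j<3. arc (g i j) \<and> pathstart (g i j) = a i \<and> pathfinish (g i j) = b j) \<and>
     (\<forall>i<3. \<forall>j<3. \<forall>i'<3. \<forall>j'<3. (i, j) \<noteq> (i', j') \<longrightarrow>
        path_image (g i j) \<inter> path_image (g i' j') \<subseteq> (if i = i' then {a i} else if j = j' then {b j} else {}))"

text \<open>The first three and the last three arcs are the two ways around from \<open>a 0\<close>
  to \<open>b 1\<close>.\<close>

definition hexagon :: "(nat \<Rightarrow> nat \<Rightarrow> real \<Rightarrow> complex) \<Rightarrow> complex set" where
  "hexagon g = path_image (g 0 0) \<union> path_image (g 1 0) \<union> path_image (g 1 1)
     \<union> path_image (g 0 2) \<union> path_image (g 2 2) \<union> path_image (g 2 1)"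

text \<open>The hexagon \<open>a\<^sub>0 b\<^sub>0 a\<^sub>1 b\<^sub>1 a\<^sub>2 b\<^sub>2\<close> has the three chords \<open>a\<^sub>0 b\<^sub>1\<close>, \<open>a\<^sub>1 b\<^sub>2\<close>, \<open>a\<^sub>2 b\<^sub>0\<close>.\<close>

lemma Un3_Int_subset:
  "A \<inter> X \<subseteq> S \<Longrightarrow> B \<inter> X \<subseteq> S \<Longrightarrow> C \<inter> X \<subseteq> S \<Longrightarrow> (A \<union> B \<union> C) \<inter> X \<subseteq> S"
  "X \<inter> A \<subseteq> S \<Longrightarrow> X \<inter> B \<subseteq> S \<Longrightarrow> X \<inter> C \<subseteq> S \<Longrightarrow> X \<inter> (A \<union> B \<union> C) \<subseteq> S"
  by blast+

lemma subset_pair: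
  "X \<subseteq> {p} \<Longrightarrow> X \<subseteq> {p, q}" "X \<subseteq> {q} \<Longrightarrow> X \<subseteq> {p, q}" "X = {} \<Longrightarrow> X \<subseteq> {p, q}"
  by blast+

text \<open>The chord from \<open>a 1\<close> to \<open>b 2\<close> has one end inside each of the
  two arcs into which \<open>a 0\<close> and \<open>b 1\<close> divide the hexagon, so it crosses
  the chord from \<open>a 0\<close> to \<open>b 1\<close>. The parameter 1/2 merely picks a point in
  the interior of a chord.\<close>

lemma K33_chords:
  assumes K: "K33_arcs a b g"
  obtains h1 h2 where "arc h1" "arc h2" "pathstart h1 = a 0" "pathfinish h1 = b 1" "pathstart h2 = a 0" "pathfinish h2 = b 1"
    "path_image h1 \<inter> path_image h2 \<subseteq> {a 0, b 1}" "path_image h1 \<union> path_image h2 = hexagon g"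
    "g 0 1 (1/2) \<notin> hexagon g"
    "\<not> connected_component (- hexagon g) (g 0 1 (1/2)) (g 1 2 (1/2))"
proof -
  have arcg: "arc (g i j)" "pathstart (g i j) = a i" "pathfinish (g i j) = b j" if "i < 3" "j < 3" for i j
    using K that by (simp_all add: K33_arcs_def)
  have X: "path_image (g i j) \<inter> path_image (g i' j') \<subseteq> (if i = i' then {a i} else if j = j' then {b j} else {})"
    if "i < 3" "j < 3" "i' < 3" "j' < 3" "(i, j) \<noteq> (i', j')" for i j i' j'
    using K that unfolding K33_arcs_def by blast
  have ain: "a i \<in> path_image (g i j)" "b j \<in> path_image (g i j)" if "i < 3" "j < 3" for i j
    using arcg[OF that] by (metis pathstart_in_path_image, metis pathfinish_in_path_image)
  have ab: "a i \<noteq> b j" if "i < 3" "j < 3" for i j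
    using arcg[OF that] arc_distinct_ends by metis
  let ?P = "\<lambda>i j. path_image (g i j)"
  have adj: "?P 0 0 \<inter> ?P 1 0 \<subseteq> {b 0}" "?P 0 0 \<inter> ?P 1 1 = {}" "?P 1 0 \<inter> ?P 1 1 \<subseteq> {a 1}"
    "?P 0 2 \<inter> ?P 2 2 \<subseteq> {b 2}" "?P 0 2 \<inter> ?P 2 1 = {}" "?P 2 2 \<inter> ?P 2 1 \<subseteq> {a 2}"
    "?P 0 0 \<inter> ?P 0 2 \<subseteq> {a 0}" "?P 0 0 \<inter> ?P 2 2 = {}" "?P 0 0 \<inter> ?P 2 1 = {}"
    "?P 1 0 \<inter> ?P 0 2 = {}" "?P 1 0 \<inter> ?P 2 2 = {}" "?P 1 0 \<inter> ?P 2 1 = {}"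
    "?P 1 1 \<inter> ?P 0 2 = {}" "?P 1 1 \<inter> ?P 2 2 = {}" "?P 1 1 \<inter> ?P 2 1 \<subseteq> {b 1}"
    "?P 0 0 \<inter> ?P 0 1 \<subseteq> {a 0}" "?P 1 0 \<inter> ?P 0 1 = {}" "?P 1 1 \<inter> ?P 0 1 \<subseteq> {b 1}"
    "?P 0 2 \<inter> ?P 0 1 \<subseteq> {a 0}" "?P 2 2 \<inter> ?P 0 1 = {}" "?P 2 1 \<inter> ?P 0 1 \<subseteq> {b 1}"
    "?P 0 0 \<inter> ?P 1 2 = {}" "?P 1 0 \<inter> ?P 1 2 \<subseteq> {a 1}" "?P 1 1 \<inter> ?P 1 2 \<subseteq> {a 1}"
    "?P 0 2 \<inter> ?P 1 2 \<subseteq> {b 2}" "?P 2 2 \<inter> ?P 1 2 \<subseteq> {b 2}" "?P 2 1 \<inter> ?P 1 2 = {}" "?P 0 1 \<inter> ?P 1 2 = {}"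
    using X[of 0 0 1 0] X[of 0 0 1 1] X[of 1 0 1 1] X[of 0 2 2 2] X[of 0 2 2 1] X[of 2 2 2 1]
      X[of 0 0 0 2] X[of 0 0 2 2] X[of 0 0 2 1] X[of 1 0 0 2] X[of 1 0 2 2] X[of 1 0 2 1]
      X[of 1 1 0 2] X[of 1 1 2 2] X[of 1 1 2 1] X[of 0 0 0 1] X[of 1 0 0 1] X[of 1 1 0 1]
      X[of 0 2 0 1] X[of 2 2 0 1] X[of 2 1 0 1] X[of 0 0 1 2] X[of 1 0 1 2] X[of 1 1 1 2]
      X[of 0 2 1 2] X[of 2 2 1 2] X[of 2 1 1 2] X[of 0 1 1 2] by simp_all
  define h1 where "h1 = g 0 0 +++ (reversepath (g 1 0) +++ g 1 1)"
  define h2 where "h2 = g 0 2 +++ (reversepath (g 2 2) +++ g 2 1)"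
  have A1: "arc (reversepath (g 1 0) +++ g 1 1)" "arc (reversepath (g 2 2) +++ g 2 1)"
    using arcg adj by (auto intro!: arc_join simp: arc_reversepath)
  have h: "arc h1" "arc h2"
    unfolding h1_def h2_def using arcg adj A1 by (auto intro!: arc_join simp: path_image_join)
  have im: "path_image h1 = ?P 0 0 \<union> ?P 1 0 \<union> ?P 1 1" "path_image h2 = ?P 0 2 \<union> ?P 2 2 \<union> ?P 2 1"
    unfolding h1_def h2_def using arcg by (auto simp: path_image_join)
  have ends: "pathstart h1 = a 0" "pathfinish h1 = b 1" "pathstart h2 = a 0" "pathfinish h2 = b 1"
    unfolding h1_def h2_def using arcg by simp_all
  have hh: "path_image h1 \<inter> path_image h2 \<subseteq> {a 0, b 1}" unfolding im
    by (intro Un3_Int_subset adj(7)[THEN subset_pair(1)] adj(15)[THEN subset_pair(2)] adj(8-14)[THEN subset_pair(3)])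
  have hex: "path_image h1 \<union> path_image h2 = hexagon g" unfolding im hexagon_def by blast
  have h01: "path_image h1 \<inter> ?P 0 1 \<subseteq> {a 0, b 1}" "path_image h2 \<inter> ?P 0 1 \<subseteq> {a 0, b 1}"
    unfolding im
    by (intro Un3_Int_subset adj(16,19)[THEN subset_pair(1)] adj(18,21)[THEN subset_pair(2)] adj(17,20)[THEN subset_pair(3)])+
  define D where "D = ?P 1 2 - {a 1, b 2}"
  have D: "connected D" "a 1 \<in> closure D" "b 2 \<in> closure D" "g 1 2 (1/2) \<in> D"
    using arc_connected_interior[of "g 1 2"] arcg[of 1 2] by (simp_all add: D_def)
  have y: "g 0 1 (1/2) \<in> ?P 0 1 - {a 0, b 1}"
    using arc_connected_interior(3)[of "g 0 1"] arcg[of 0 1] by simp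
  have "path_image h1 \<inter> ?P 1 2 \<subseteq> {a 1, b 2}" "path_image h2 \<inter> ?P 1 2 \<subseteq> {a 1, b 2}"
    unfolding im
    by (intro Un3_Int_subset adj(23,24)[THEN subset_pair(1)] adj(25,26)[THEN subset_pair(2)] adj(22,27)[THEN subset_pair(3)])+
  then have Dd: "D \<inter> (path_image h1 \<union> path_image h2 \<union> ?P 0 1) = {}"
    unfolding D_def using adj(28) by auto
  have a1: "a 1 \<in> path_image h1 - {a 0, b 1}"
  proof -
    have "a 1 \<noteq> a 0" using ain(1)[of 0 0] ain(1)[of 1 1] adj(2) by auto
    then show ?thesis using ain(1)[of 1 0] ab[of 1 1] by (simp add: im)
  qed
  have b2: "b 2 \<in> path_image h2 - {a 0, b 1}"
  proof -
    have "b 2 \<noteq> b 1" using ain(2)[of 0 2] ain(2)[of 2 1] adj(5) by auto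
    then show ?thesis using ain(2)[of 0 2] ab[of 0 2] by (simp add: im)
  qed
  have "\<not> connected_component (- (path_image h1 \<union> path_image h2)) (g 0 1 (1/2)) (g 1 2 (1/2))"
    using crossing_chords_separated[OF h arcg(1)[of 0 1] ends _ _ hh h01 D(1) Dd D(2) a1 D(3) b2 y D(4)] arcg[of 0 1]
    by simp
  moreover have "g 0 1 (1/2) \<notin> hexagon g" using y h01 unfolding hex[symmetric] by blast
  ultimately show thesis using that[OF h ends hh hex] unfolding hex by blast
qed

text \<open>Raising both indices by one modulo 3 maps the hexagon to itself and permutes its chords
  cyclically, so a statement about one pair of chords yields all three.\<close>

lemma K33_arcs_rotate:
  assumes "K33_arcs a b g"
  shows "K33_arcs (\<lambda>i. a (Suc i mod 3)) (\<lambda>i. b (Suc i mod 3)) (\<lambda>i j. g (Suc i mod 3) (Suc j mod 3))"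
proof -
  have inj: "Suc i mod 3 = Suc i' mod 3 \<longleftrightarrow> i = i'" if "i < 3" "i' < 3" for i i' :: nat
    using that by (auto simp: mod_Suc)
  let ?s = "\<lambda>i. Suc i mod 3"
  show ?thesis
    unfolding K33_arcs_def
  proof (intro conjI allI impI)
    fix i j :: nat assume ij: "i < 3" "j < 3"
    have "?s i < 3" "?s j < 3" by simp_all
    then have "arc (g (?s i) (?s j)) \<and> pathstart (g (?s i) (?s j)) = a (?s i) \<and> pathfinish (g (?s i) (?s j)) = b (?s j)"
      using assms unfolding K33_arcs_def by blast
    then show "arc (g (?s i) (?s j))" "pathstart (g (?s i) (?s j)) = a (?s i)" "pathfinish (g (?s i) (?s j)) = b (?s j)"
      by simp_all
  next
    fix i j i' j' :: nat assume ij: "i < 3" "j < 3" "i' < 3" "j' < 3" "(i, j) \<noteq> (i', j')"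
    have ne: "(?s i, ?s j) \<noteq> (?s i', ?s j')" using inj[of i i'] inj[of j j'] ij by simp
    have "?s i < 3" "?s j < 3" "?s i' < 3" "?s j' < 3" by simp_all
    then have "path_image (g (?s i) (?s j)) \<inter> path_image (g (?s i') (?s j')) \<subseteq>
        (if ?s i = ?s i' then {a (?s i)} else if ?s j = ?s j' then {b (?s j)} else {})"
      using assms ne unfolding K33_arcs_def by blast
    then show "path_image (g (?s i) (?s j)) \<inter> path_image (g (?s i') (?s j')) \<subseteq>
        (if i = i' then {a (?s i)} else if j = j' then {b (?s j)} else {})"
      unfolding inj[OF ij(1,3)] inj[OF ij(2,4)] .
  qed
qed

theorem no_K33_arcs: "\<not> K33_arcs a b g"
proof
  assume K0: "K33_arcs a b g"
  define g1 where "g1 = (\<lambda>i j. g (Suc i mod 3) (Suc j mod 3))"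
  define g2 where "g2 = (\<lambda>i j. g1 (Suc i mod 3) (Suc j mod 3))"
  obtain a1 b1 where K1: "K33_arcs a1 b1 g1" using K33_arcs_rotate[OF K0] unfolding g1_def by blast
  obtain a2 b2 where K2: "K33_arcs a2 b2 g2" using K33_arcs_rotate[OF K1] unfolding g2_def by blast
  have s: "Suc 0 mod 3 = (1::nat)" "Suc 1 mod 3 = (2::nat)" "Suc 2 mod 3 = (0::nat)" by simp_all
  have hex: "hexagon g1 = hexagon g" unfolding hexagon_def g1_def s by (simp only: Un_ac)
  have "hexagon g2 = hexagon g1" unfolding hexagon_def g2_def s by (simp only: Un_ac)
  then have hex: "hexagon g1 = hexagon g" "hexagon g2 = hexagon g" using hex by simp_all
  have mid: "g1 0 1 = g 1 2" "g1 1 2 = g 2 0" "g2 0 1 = g 2 0" "g2 1 2 = g 0 1"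
    unfolding g1_def g2_def s by (rule refl)+
  let ?x = "g 0 1 (1/2)" and ?y = "g 1 2 (1/2)" and ?z = "g 2 0 (1/2)"
  obtain h1 h2 where h: "arc h1" "arc h2" "pathstart h1 = a 0" "pathfinish h1 = b 1" "pathstart h2 = a 0" "pathfinish h2 = b 1"
    "path_image h1 \<inter> path_image h2 \<subseteq> {a 0, b 1}" "path_image h1 \<union> path_image h2 = hexagon g"
    and xy: "?x \<notin> hexagon g" "\<not> connected_component (- hexagon g) ?x ?y"
    using K33_chords[OF K0] by metis
  have yz: "?y \<notin> hexagon g" "\<not> connected_component (- hexagon g) ?y ?z"
    using K33_chords[OF K1] unfolding hex mid by metis+
  have zx: "?z \<notin> hexagon g" "\<not> connected_component (- hexagon g) ?z ?x"
    using K33_chords[OF K2] unfolding hex mid by metis+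
  obtain U V where UV: "connected U" "connected V" "U \<union> V = - hexagon g"
    using Jordan_loop[OF h(1-7)] unfolding h(8) by metis
  have same: "connected_component (- hexagon g) p q" if "p \<in> U \<and> q \<in> U \<or> p \<in> V \<and> q \<in> V" for p q
  proof -
    have "U \<subseteq> - hexagon g" "V \<subseteq> - hexagon g" using UV(3) by blast+
    then show ?thesis using that UV(1,2) unfolding connected_component_def by blast
  qed
  have "?x \<in> U \<union> V" "?y \<in> U \<union> V" "?z \<in> U \<union> V" unfolding UV(3) using xy yz zx by blast+
  then show False using same[of ?x ?y] same[of ?y ?z] same[of ?z ?x] xy yz zx by blast
qed

section \<open>Drawn edges and paths as arcs\<close>

lemma drawing_edge_arc:
  assumes "plane_drawing G p \<gamma>" "{x, y} \<in> edges G"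
  shows "\<exists>h. arc h \<and> pathstart h = p x \<and> pathfinish h = p y \<and> path_image h = path_image (\<gamma> {x, y})"
proof -
  have *: "arc (\<gamma> {x, y})" "{pathstart (\<gamma> {x, y}), pathfinish (\<gamma> {x, y})} = {p x, p y}"
    using assms by (auto simp: plane_drawing_def)
  then consider "pathstart (\<gamma> {x, y}) = p x" "pathfinish (\<gamma> {x, y}) = p y"
    | "pathstart (\<gamma> {x, y}) = p y" "pathfinish (\<gamma> {x, y}) = p x"
    by (auto simp: doubleton_eq_iff)
  then show ?thesis
  proof cases
    case 1
    then show ?thesis using *(1) by blast
  next
    case 2
    then show ?thesis using *(1) by (intro exI[of _ "reversepath (\<gamma> {x, y})"]) (simp add: arc_reversepath)
  qed
qed

text \<open>By the drawing conditions a common point is an end of both arcs, and \<open>p\<close> is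
  injective on the vertices.\<close>

lemma drawing_edges_meet:
  assumes G: "finite_simple_graph G" and d: "plane_drawing G p \<gamma>" and ef: "e \<in> edges G" "f \<in> edges G" "e \<noteq> f"
  shows "path_image (\<gamma> e) \<inter> path_image (\<gamma> f) \<subseteq> p ` (e \<inter> f)"
proof -
  have "(path_image (\<gamma> e) - p ` e) \<inter> path_image (\<gamma> f) = {}" "(path_image (\<gamma> f) - p ` f) \<inter> path_image (\<gamma> e) = {}"
    using d ef unfolding plane_drawing_def by metis+
  then have "path_image (\<gamma> e) \<inter> path_image (\<gamma> f) \<subseteq> p ` e \<inter> p ` f" by blast
  also have "\<dots> = p ` (e \<inter> f)"
    using d finite_simple_graphD(3)[OF G] ef unfolding plane_drawing_def by (metis inj_on_image_Int)
  finally show ?thesis .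
qed

text \<open>The arcs of the edges are joined one by one. As \<open>x\<close> does not occur again on
  the path, the arc of the first edge meets those of the later ones at most in
  \<open>p y\<close>.\<close>

lemma drawing_path_arc:
  assumes G: "finite_simple_graph G" and d: "plane_drawing G p \<gamma>"
  shows "gpath (edges G) (x # y # xs) \<Longrightarrow> \<exists>h. arc h \<and> pathstart h = p x \<and> pathfinish h = p (last (y # xs)) \<and>
    path_image h = (\<Union>e\<in>ledges (x # y # xs). path_image (\<gamma> e))"
proof (induction xs arbitrary: x y)
  case Nil
  then have "{x, y} \<in> edges G" by (simp add: gpath_def)
  from drawing_edge_arc[OF d this] show ?case by simp
next
  case (Cons z zs)
  have tl: "gpath (edges G) (y # z # zs)" and xy: "{x, y} \<in> edges G" and x: "x \<notin> set (y # z # zs)"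
    using Cons.prems by (auto simp: gpath_def)
  obtain h1 where h1: "arc h1" "pathstart h1 = p x" "pathfinish h1 = p y" "path_image h1 = path_image (\<gamma> {x, y})"
    using drawing_edge_arc[OF d xy] by blast
  obtain h2 where h2: "arc h2" "pathstart h2 = p y" "pathfinish h2 = p (last (z # zs))"
    "path_image h2 = (\<Union>e\<in>ledges (y # z # zs). path_image (\<gamma> e))"
    using Cons.IH[OF tl] by blast
  have "path_image (\<gamma> {x, y}) \<inter> path_image (\<gamma> e) \<subseteq> {p y}" if e: "e \<in> ledges (y # z # zs)" for e
  proof -
    have "x \<notin> e" using ledges_subset[OF e] x by blast
    moreover have "e \<in> edges G" using tl e unfolding gpath_def by blast
    moreover have "e \<noteq> {x, y}" using \<open>x \<notin> e\<close> by blast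
    ultimately have "path_image (\<gamma> {x, y}) \<inter> path_image (\<gamma> e) \<subseteq> p ` ({x, y} \<inter> e)"
      by (intro drawing_edges_meet[OF G d xy]) auto
    then show ?thesis using \<open>x \<notin> e\<close> by auto
  qed
  then have "path_image h1 \<inter> path_image h2 \<subseteq> {p y}" unfolding h1(4) h2(4) by blast
  then have "arc (h1 +++ h2)" using h1 h2 by (intro arc_join) auto
  moreover have "path_image (h1 +++ h2) = (\<Union>e\<in>ledges (x # y # z # zs). path_image (\<gamma> e))"
    using h1 h2 by (simp add: path_image_join)
  ultimately show ?case using h1 h2 by (intro exI[of _ "h1 +++ h2"]) simp
qed

section \<open>From a minor to a subdivision\<close>

lemma induced_path:
  assumes "connected_graph (induced E X)" "x \<in> X" "y \<in> X"
  obtains P where "gpath E P" "hd P = x" "last P = y" "set P \<subseteq> X"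
proof -
  have "(x, y) \<in> reach {e \<in> E. e \<subseteq> X}"
    using assms by (simp add: connected_graph_def induced_def)
  then obtain P where P: "gpath {e \<in> E. e \<subseteq> X} P" "hd P = x" "last P = y" by (rule rtrancl_gpath)
  have "set P \<subseteq> X" using P assms(2) by (intro gpath_subset[OF P(1)]) auto
  moreover have "gpath E P" using P(1) by (rule gpath_mono) auto
  ultimately show thesis using that P by blast
qed

text \<open>A path between the first two given vertices and a path from the third up to its first
  contact \<open>m\<close> with it form the legs; a leg may consist of \<open>m\<close> alone. Since
  every branch set has only three neighbouring branch sets to reach, such tripods turn the minor
  into a subdivision.\<close>

lemma tripod:
  fixes f :: "nat \<Rightarrow> 'a"
  assumes conn: "connected_graph (induced E X)" and f: "\<And>i. i < 3 \<Longrightarrow> f i \<in> X"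
  shows "\<exists>m L. (\<forall>i<3. gpath E (L i) \<and> hd (L i) = m \<and> last (L i) = f i \<and> set (L i) \<subseteq> X) \<and>
    (\<forall>i<3. \<forall>j<3. i \<noteq> j \<longrightarrow> set (L i) \<inter> set (L j) = {m})"
proof -
  obtain P where P: "gpath E P" "hd P = f 0" "last P = f 1" "set P \<subseteq> X"
    using induced_path[OF conn, of "f 0" "f 1"] f by auto
  obtain Q where Q: "gpath E Q" "hd Q = f 2" "last Q = f 0" "set Q \<subseteq> X"
    using induced_path[OF conn, of "f 2" "f 0"] f by auto
  have "f 0 \<in> set P" "f 0 \<in> set Q" using gpath_hd[OF P(1)] gpath_last[OF Q(1)] P(2) Q(3) by simp_all
  then have "set Q \<inter> set P \<noteq> {}" by blast
  then obtain R zs where R: "Q = R @ zs" "gpath E R" "set R \<inter> set P = {last R}"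
    by (rule gpath_first_hit[OF Q(1)])
  define m where "m = last R"
  have "m \<in> set P" using R(3) m_def by blast
  then obtain us vs where us: "P = us @ m # vs" by (meson split_list)
  have Rne: "R \<noteq> []" using R(2) by (simp add: gpath_def)
  define L where "L = (\<lambda>i::nat. if i = 0 then rev (us @ [m]) else if i = 1 then m # vs else rev R)"
  have L: "L 0 = rev (us @ [m])" "L 1 = m # vs" "L 2 = rev R" by (simp_all add: L_def)
  have dP: "distinct (us @ m # vs)" using P(1) us by (simp add: gpath_def)
  have "gpath E (us @ [m])" "gpath E (m # vs)"
    using P(1) unfolding us by (rule gpath_prefix, rule gpath_suffix)
  then have 1: "gpath E (L 0)" "gpath E (L 1)" "gpath E (L 2)"
    using R(2) by (simp_all only: L gpath_rev)
  have 2: "hd (L 0) = m" "hd (L 1) = m" "hd (L 2) = m"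
    using Rne unfolding L by (simp_all add: m_def hd_rev)
  have "hd (us @ [m]) = f 0" using P(2) us by (cases us) auto
  moreover have "last (m # vs) = f 1" using P(3) us by simp
  moreover have "hd R = f 2" using Q(2) R(1) Rne by simp
  ultimately have 3: "last (L 0) = f 0" "last (L 1) = f 1" "last (L 2) = f 2"
    unfolding L by (simp_all only: last_rev)
  have 4: "set (L 0) \<subseteq> X" "set (L 1) \<subseteq> X" "set (L 2) \<subseteq> X"
    using P(4) Q(4) R(1) us unfolding L by auto
  have RP: "set R \<inter> set P = {m}" "m \<in> set R" using R(3) Rne by (auto simp: m_def)
  have 5: "set (L 0) \<inter> set (L 1) = {m}" "set (L 0) \<inter> set (L 2) = {m}" "set (L 1) \<inter> set (L 2) = {m}"
    using dP RP unfolding us L by auto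
  have "gpath E (L i) \<and> hd (L i) = m \<and> last (L i) = f i \<and> set (L i) \<subseteq> X" if "i < 3" for i
  proof -
    have "i = 0 \<or> i = 1 \<or> i = 2" using that by linarith
    then show ?thesis using 1 2 3 4 by blast
  qed
  moreover have "set (L i) \<inter> set (L j) = {m}" if "i < 3" "j < 3" "i \<noteq> j" for i j
  proof -
    have "i = 0 \<or> i = 1 \<or> i = 2" "j = 0 \<or> j = 1 \<or> j = 2" using that by linarith+
    then show ?thesis using that(3) 5 by (elim disjE) (simp_all add: Int_commute)
  qed
  ultimately show ?thesis by blast
qed

text \<open>Every branch set contributes a tripod to its three contact vertices. The path from the
  centre \<open>m i\<close> to the centre \<open>n j\<close> is a leg, an edge between the branch
  sets and a leg run backwards; both legs are nonempty, so the path has an edge to draw.\<close>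

lemma K33_minor_paths:
  assumes "K33_minor V E"
  shows "\<exists>m n P. (\<forall>i<3. \<forall>j<3. gpath E (P i j) \<and> hd (P i j) = m i \<and> last (P i j) = n j \<and> length (P i j) \<ge> 2) \<and>
    (\<forall>i<3::nat. \<forall>j<3::nat. \<forall>i'<3. \<forall>j'<3. (i, j) \<noteq> (i', j') \<longrightarrow>
      set (P i j) \<inter> set (P i' j') \<subseteq> (if i = i' then {m i} else if j = j' then {n j} else {}))"
proof -
  obtain M :: "nat \<Rightarrow> 'a set" where M: "\<forall>i<6. M i \<subseteq> V \<and> connected_graph (induced E (M i))"
    "\<forall>i<6. \<forall>j<6. i \<noteq> j \<longrightarrow> M i \<inter> M j = {}" "\<forall>i<3. \<forall>j\<in>{3..<6}. \<exists>x\<in>M i. \<exists>y\<in>M j. {x, y} \<in> E"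
    using assms unfolding K33_minor_def by (elim exE conjE)
  define B where "B j = M (j + 3)" for j
  have conn: "connected_graph (induced E (M i))" "connected_graph (induced E (B i))" if "i < 3" for i
    using M(1) that by (simp_all add: B_def)
  have AA: "M i \<inter> M j = {}" "B i \<inter> B j = {}" if "i < 3" "j < 3" "i \<noteq> j" for i j
    using M(2) that by (simp_all add: B_def)
  have AB: "M i \<inter> B j = {}" if "i < 3" "j < 3" for i j
    using M(2) that by (simp add: B_def)
  have "\<exists>xy. fst xy \<in> M i \<and> snd xy \<in> B j \<and> {fst xy, snd xy} \<in> E" if ij: "i < 3" "j < 3" for i j
  proof -
    have "j + 3 \<in> {3..<6}" using ij by simp
    then obtain x y where "x \<in> M i" "y \<in> M (j + 3)" "{x, y} \<in> E" using M(3) ij(1) by blast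
    then show ?thesis by (intro exI[of _ "(x, y)"]) (simp add: B_def)
  qed
  then obtain xy where xy: "\<And>i j. i < 3 \<Longrightarrow> j < 3 \<Longrightarrow> fst (xy i j) \<in> M i \<and> snd (xy i j) \<in> B j \<and> {fst (xy i j), snd (xy i j)} \<in> E"
    by metis
  define Pt where "Pt f X m L \<longleftrightarrow> (\<forall>i<3. gpath E (L i) \<and> hd (L i) = m \<and> last (L i) = f i \<and> set (L i) \<subseteq> X) \<and>
    (\<forall>i<3. \<forall>j<3. i \<noteq> j \<longrightarrow> set (L i) \<inter> set (L j) = {m})" for f :: "nat \<Rightarrow> 'a" and X m and L :: "nat \<Rightarrow> 'a list"
  have "\<exists>m L. Pt (\<lambda>j. fst (xy i j)) (M i) m L" if "i < 3" for i
    unfolding Pt_def using tripod[OF conn(1)[OF that], of "\<lambda>j. fst (xy i j)"] xy that by blast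
  then obtain m L where L: "\<And>i. i < 3 \<Longrightarrow> Pt (\<lambda>j. fst (xy i j)) (M i) (m i) (L i)" by metis
  have "\<exists>n K. Pt (\<lambda>i. snd (xy i j)) (B j) n K" if "j < 3" for j
    unfolding Pt_def using tripod[OF conn(2)[OF that], of "\<lambda>i. snd (xy i j)"] xy that by blast
  then obtain n K where K: "\<And>j. j < 3 \<Longrightarrow> Pt (\<lambda>i. snd (xy i j)) (B j) (n j) (K j)" by metis
  have L1: "gpath E (L i j) \<and> hd (L i j) = m i \<and> last (L i j) = fst (xy i j) \<and> set (L i j) \<subseteq> M i" if "i < 3" "j < 3" for i j
    using L[OF that(1)] that(2) by (simp add: Pt_def)
  have L2: "set (L i j) \<inter> set (L i j') = {m i}" if "i < 3" "j < 3" "j' < 3" "j \<noteq> j'" for i j j'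
    using L[OF that(1)] that(2-) by (simp add: Pt_def)
  have K1: "gpath E (K j i) \<and> hd (K j i) = n j \<and> last (K j i) = snd (xy i j) \<and> set (K j i) \<subseteq> B j" if "i < 3" "j < 3" for i j
    using K[OF that(2)] that(1) by (simp add: Pt_def)
  have K2: "set (K j i) \<inter> set (K j i') = {n j}" if "j < 3" "i < 3" "i' < 3" "i \<noteq> i'" for i i' j
    using K[OF that(1)] that(2-) by (simp add: Pt_def)
  define P where "P i j = L i j @ rev (K j i)" for i j
  have P1: "gpath E (P i j) \<and> hd (P i j) = m i \<and> last (P i j) = n j \<and> length (P i j) \<ge> 2" if ij: "i < 3" "j < 3" for i j
  proof -
    note l = L1[OF ij] and k = K1[OF ij]
    have ne: "L i j \<noteq> []" "K j i \<noteq> []" using l k by (simp_all add: gpath_def)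
    have "set (L i j) \<inter> set (K j i) = {}" using l k AB[OF ij] by blast
    moreover have "ledges (P i j) = insert {fst (xy i j), snd (xy i j)} (ledges (L i j) \<union> ledges (K j i))"
      unfolding P_def using ne l k by (simp add: ledges_append hd_rev)
    ultimately have "gpath E (P i j)" using l k xy[OF ij] ne by (simp add: gpath_def P_def)
    moreover have "hd (P i j) = m i" "last (P i j) = n j" using l k ne by (simp_all add: P_def last_rev)
    moreover have "length (P i j) \<ge> 2" using ne unfolding P_def by (cases "L i j"; cases "K j i") auto
    ultimately show ?thesis by blast
  qed
  have P2: "set (P i j) \<inter> set (P i' j') \<subseteq> (if i = i' then {m i} else if j = j' then {n j} else {})"
    if ij: "i < 3" "j < 3" "i' < 3" "j' < 3" "(i, j) \<noteq> (i', j')" for i j i' j'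
  proof -
    have s: "set (P i j) = set (L i j) \<union> set (K j i)" "set (P i' j') = set (L i' j') \<union> set (K j' i')"
      by (simp_all add: P_def)
    have LM: "set (L i j) \<subseteq> M i" "set (L i' j') \<subseteq> M i'" "set (K j i) \<subseteq> B j" "set (K j' i') \<subseteq> B j'"
      using L1 K1 ij by simp_all
    have LK: "set (L i j) \<inter> set (K j' i') = {}" "set (K j i) \<inter> set (L i' j') = {}"
      using LM AB[OF ij(1,4)] AB[OF ij(3,2)] by blast+
    have LL: "set (L i j) \<inter> set (L i' j') = {}" if "i \<noteq> i'" using LM AA(1)[OF ij(1,3) that] by blast
    have KK: "set (K j i) \<inter> set (K j' i') = {}" if "j \<noteq> j'" using LM AA(2)[OF ij(2,4) that] by blast
    consider "i = i'" "j \<noteq> j'" | "i \<noteq> i'" "j = j'" | "i \<noteq> i'" "j \<noteq> j'" using ij(5) by blast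
    then show ?thesis
    proof cases
      case 1
      then have "set (L i j) \<inter> set (L i' j') = {m i}" using L2[OF ij(1,2,4)] by simp
      then show ?thesis using KK[OF 1(2)] LK 1 unfolding s by auto
    next
      case 2
      then have "set (K j i) \<inter> set (K j' i') = {n j}" using K2[OF ij(2,1,3)] by simp
      then show ?thesis using LL[OF 2(1)] LK 2 unfolding s by auto
    next
      case 3
      then show ?thesis using LL KK LK unfolding s by auto
    qed
  qed
  show ?thesis
  proof (rule exI[of _ m], rule exI[of _ n], rule exI[of _ P], rule conjI)
    show "\<forall>i<3. \<forall>j<3. gpath E (P i j) \<and> hd (P i j) = m i \<and> last (P i j) = n j \<and> length (P i j) \<ge> 2"
      using P1 by blast
    show "\<forall>i<3. \<forall>j<3. \<forall>i'<3. \<forall>j'<3. (i, j) \<noteq> (i', j') \<longrightarrow>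
        set (P i j) \<inter> set (P i' j') \<subseteq> (if i = i' then {m i} else if j = j' then {n j} else {})"
      by (intro allI impI) (rule P2)
  qed
qed

theorem planar_no_K33_minor:
  fixes G :: "'a graph"
  assumes G: "finite_simple_graph G" and "planar_graph G"
  shows "\<not> K33_minor (verts G) (edges G)"
proof
  assume "K33_minor (verts G) (edges G)"
  from K33_minor_paths[OF this] obtain m n P where
    PX: "\<forall>i<3. \<forall>j<3. gpath (edges G) (P i j) \<and> hd (P i j) = m i \<and> last (P i j) = n j \<and> length (P i j) \<ge> 2"
    "\<forall>i<3::nat. \<forall>j<3::nat. \<forall>i'<3. \<forall>j'<3. (i, j) \<noteq> (i', j') \<longrightarrow>
      set (P i j) \<inter> set (P i' j') \<subseteq> (if i = i' then {m i} else if j = j' then {n j} else {})"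
    by (elim exE conjE)
  have P: "gpath (edges G) (P i j) \<and> hd (P i j) = m i \<and> last (P i j) = n j \<and> length (P i j) \<ge> 2"
    if "i < 3" "j < 3" for i j using PX(1) that by blast
  have X: "set (P i j) \<inter> set (P i' j') \<subseteq> (if i = i' then {m i} else if j = j' then {n j} else {})"
    if "i < 3" "j < 3" "i' < 3" "j' < 3" "(i, j) \<noteq> (i', j')" for i j i' j'
    using PX(2) that by blast
  obtain p \<gamma> where d: "plane_drawing G p \<gamma>" using assms(2) by (auto simp: planar_graph_def)
  have "\<exists>h. arc h \<and> pathstart h = p (m i) \<and> pathfinish h = p (n j) \<and> path_image h = (\<Union>e\<in>ledges (P i j). path_image (\<gamma> e))"
    if ij: "i < 3" "j < 3" for i j
  proof -
    obtain x y zs where eq: "P i j = x # y # zs"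
      using P[OF ij] by (metis Suc_le_length_iff numeral_2_eq_2)
    have "gpath (edges G) (x # y # zs)" "x = m i" "last (y # zs) = n j"
      using P[OF ij] unfolding eq list.sel last.simps by auto
    with drawing_path_arc[OF G d this(1)] show ?thesis by (simp only: eq)
  qed
  then obtain g where g: "\<And>i j. i < 3 \<Longrightarrow> j < 3 \<Longrightarrow> arc (g i j) \<and> pathstart (g i j) = p (m i) \<and>
      pathfinish (g i j) = p (n j) \<and> path_image (g i j) = (\<Union>e\<in>ledges (P i j). path_image (\<gamma> e))"
    by metis
  have "K33_arcs (\<lambda>i. p (m i)) (\<lambda>j. p (n j)) g"
    unfolding K33_arcs_def
  proof (intro conjI allI impI)
    fix i j :: nat assume ij: "i < 3" "j < 3"
    from g[OF ij] show "arc (g i j)" "pathstart (g i j) = p (m i)" "pathfinish (g i j) = p (n j)" by simp_all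
  next
    fix i j i' j' :: nat assume ij: "i < 3" "j < 3" "i' < 3" "j' < 3" "(i, j) \<noteq> (i', j')"
    let ?S = "if i = i' then {m i} else if j = j' then {n j} else {}"
    have S: "set (P i j) \<inter> set (P i' j') \<subseteq> ?S" by (rule X[OF ij])
    moreover have "\<exists>v. ?S \<subseteq> {v}" by auto
    ultimately obtain v where "set (P i j) \<inter> set (P i' j') \<subseteq> {v}" by blast
    \<comment> \<open>With at most one common vertex two of the paths share no edge. Thus only arcs
      of different edges are compared, and these meet in common ends.\<close>
    then have disj: "ledges (P i j) \<inter> ledges (P i' j') = {}"
      using P[OF ij(1,2)] by (intro ledges_meet_once) (auto simp: gpath_def)
    have "path_image (\<gamma> e) \<inter> path_image (\<gamma> f) \<subseteq> p ` ?S" if e: "e \<in> ledges (P i j)" and f: "f \<in> ledges (P i' j')" for e f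
    proof -
      have "e \<in> edges G" "f \<in> edges G" using P[OF ij(1,2)] P[OF ij(3,4)] e f unfolding gpath_def by blast+
      moreover have "e \<noteq> f" using disj e f by blast
      ultimately have "path_image (\<gamma> e) \<inter> path_image (\<gamma> f) \<subseteq> p ` (e \<inter> f)" by (rule drawing_edges_meet[OF G d])
      also have "\<dots> \<subseteq> p ` ?S" using ledges_subset[OF e] ledges_subset[OF f] S by (intro image_mono) blast
      finally show ?thesis .
    qed
    then have meet: "x \<in> p ` ?S" if "e \<in> ledges (P i j)" "f \<in> ledges (P i' j')" "x \<in> path_image (\<gamma> e)" "x \<in> path_image (\<gamma> f)"
      for e f x using that by (meson IntI subsetD)
    have im: "path_image (g i j) = (\<Union>e\<in>ledges (P i j). path_image (\<gamma> e))"
      "path_image (g i' j') = (\<Union>e\<in>ledges (P i' j'). path_image (\<gamma> e))"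
      using g[OF ij(1,2)] g[OF ij(3,4)] by simp_all
    have "path_image (g i j) \<inter> path_image (g i' j') \<subseteq> p ` ?S"
      unfolding im by (intro subsetI, elim IntE UN_E) (rule meet)
    also have "p ` ?S = (if i = i' then {p (m i)} else if j = j' then {p (n j)} else {})" by simp
    finally show "path_image (g i j) \<inter> path_image (g i' j') \<subseteq>
        (if i = i' then {p (m i)} else if j = j' then {p (n j)} else {})" .
  qed
  then show False using no_K33_arcs by blast
qed

section \<open>Small degrees in planar graphs and the conclusion\<close>

lemma planar_min_degree:
  assumes G: "finite_simple_graph G" and "planar_graph G" and n: "card (verts G) \<ge> 2"
  shows "\<exists>v\<in>verts G. card (nbrs (edges G) v) \<le> 5"
proof (rule ex_degree_le_5[OF G], rule ccontr)
  assume "\<not> card (edges G) < 3 * card (verts G)"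
  then have "K33_minor (verts G) (edges G)" using G n by (intro K33_minor_dense) simp_all
  then show False using planar_no_K33_minor[OF assms(1,2)] by blast
qed

text \<open>Deleting all neighbours of \<open>v\<close> either isolates \<open>v\<close> from what
  remains or leaves \<open>v\<close> alone.\<close>

lemma connectivity_le_degree:
  assumes G: "finite_simple_graph G" and v: "v \<in> verts G"
  shows "connectivity G \<le> card (nbrs (edges G) v)"
proof (rule connectivity_attained(2)[OF G])
  let ?Q = "nbrs (edges G) v"
  show "?Q \<subseteq> verts G" using nbrs_simple[OF G, of v] by blast
  show "\<not> connected_graph (delete_verts G ?Q) \<or> trivial_graph (delete_verts G ?Q)"
  proof (rule disjCI, rule notI)
    assume nt: "\<not> trivial_graph (delete_verts G ?Q)" and con: "connected_graph (delete_verts G ?Q)"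
    have vQ: "v \<in> verts (delete_verts G ?Q)" using v nbrs_simple[OF G, of v] by (auto simp: delete_verts_def)
    have "\<not> verts (delete_verts G ?Q) \<subseteq> {v}"
    proof
      assume "verts (delete_verts G ?Q) \<subseteq> {v}"
      then have "card (verts (delete_verts G ?Q)) \<le> card {v}" by (intro card_mono) auto
      then show False using nt by (simp add: trivial_graph_def)
    qed
    then obtain w where "w \<in> verts (delete_verts G ?Q)" "w \<noteq> v" by blast
    then obtain e where e: "e \<in> edges (delete_verts G ?Q)" "v \<in> e"
      using connected_edge_at[OF con vQ, of w] by blast
    then have "e \<in> edges G" "e \<inter> ?Q = {}" by (auto simp: delete_verts_def)
    moreover from this e(2) obtain u where "e = {v, u}" "u \<in> ?Q" using edges_at_eq[OF G, of v] by blast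
    ultimately show False by blast
  qed
qed

theorem theorem4:
  fixes G :: "'a graph"
  assumes "finite_simple_graph G"
    and "connected_graph G"
    and "planar_graph G"
    and "card (verts G) \<ge> 3"
  shows "int (connectivity G) - 1 \<le> int (three_connectivity G) \<and>
         three_connectivity G \<le> connectivity G"
proof
  note G = assms(1)
  obtain v where "v \<in> verts G" "card (nbrs (edges G) v) \<le> 5"
    using planar_min_degree[OF G assms(3)] assms(4) by auto
  then have k: "connectivity G \<le> 5" using connectivity_le_degree[OF G] by fastforce
  let ?A = "{set_connectivity G S | S. S \<subseteq> verts G \<and> card S = 3}"
  \<comment> \<open>There is a set of three vertices, so the minimum is taken over a nonempty
    set.\<close>
  obtain S where "S \<subseteq> verts G" "card S = 3" using assms(4) by (meson obtain_subset_with_card_n)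
  then have "?A \<noteq> {}" by blast
  moreover have "finite ?A" by (rule finite_three_sets[OF finite_simple_graphD(1)[OF G]])
  ultimately have "connectivity G - 1 \<le> Min ?A"
    using set_connectivity_ge_connectivity_minus_1[OF G _ _ k] by (subst Min_ge_iff) auto
  \<comment> \<open>The truncated difference is at least the integer one, so the bound carries over
    to connectivity 0 as well.\<close>
  then show "int (connectivity G) - 1 \<le> int (three_connectivity G)"
    unfolding three_connectivity_def by linarith
  show "three_connectivity G \<le> connectivity G"
    by (rule three_connectivity_le_connectivity[OF G assms(4)])
qed

end
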